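(* Let $n\ge 2$ and let $A\in L(\mathbb{C}^n)$ be such that $m(A)>0$. Then $$\widehat{S}_A(\mathbb{B}^n)=\overline{\widehat{S}_A(\mathbb{B}^n)\cap \mathcal{A}(\mathbb{B}^n)}.$$ In particular, for every $n\ge 2$, $S^*(\mathbb{B}^n)=\overline{S^*(\mathbb{B}^n)\cap \mathcal{A}(\mathbb{B}^n)}$.
   Context: $\mathbb{B}^n$ is the open Euclidean unit ball of $\mathbb{C}^n$, with inner product $\langle z,w\rangle=\sum_{j=1}^n z_j\overline{w}_j$. $L(\mathbb{C}^n)$ is the space of linear operators on $\mathbb{C}^n$; for $A\in L(\mathbb{C}^n)$, $m(A)=\min\{\Re\langle A(z),z\rangle:\|z\|=1\}$. $H(\mathbb{B}^n)$ is the space of holomorphic mappings $\mathbb{B}^n\to\mathbb{C}^n$ with the topology of locally uniform convergence; overlines denote closures in $H(\mathbb{B}^n)$. $S(\mathbb{B}^n)$ is the set of all univalent (i.e. biholomorphic onto their image) $f\in H(\mathbb{B}^n)$ that are normalized: $f(0)=0$, $Df(0)=I_n$. For $m(A)>0$, $\widehat{S}_A(\mathbb{B}^n)$ is the set of mappings spirallike with respect to $A$: all $f\in S(\mathbb{B}^n)$ with $e^{-tA}f(\mathbb{B}^n)\subseteq f(\mathbb{B}^n)$ for all $t\ge 0$. $S^*(\mathbb{B}^n)$ is the set of all $f\in S(\mathbb{B}^n)$ whose image is starlike with respect to the origin. $\mathrm{Aut}(\mathbb{C}^n)$ is the set of holomorphic automorphisms of $\mathbb{C}^n$ and $\mathcal{A}(\mathbb{B}^n)=\{\Phi|_{\mathbb{B}^n}:\Phi\in\mathrm{Aut}(\mathbb{C}^n)\}$.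 *)

theory Defs
  imports "HOL-Analysis.Analysis"
begin

text \<open>
  \<open>\<complex>\<^sup>n\<close> is \<^typ>\<open>complex^'n\<close>, whose \<^const>\<open>norm\<close> is the Euclidean one.  The library's
  \<^const>\<open>inner\<close> on this type is only the real part of the Hermitian inner product.
\<close>

definition hinner :: "complex^'n \<Rightarrow> complex^'n \<Rightarrow> complex" where
  "hinner z w = (\<Sum>j\<in>UNIV. z $ j * cnj (w $ j))"

abbreviation complex_linear :: "(complex^'n \<Rightarrow> complex^'n) \<Rightarrow> bool" where
  "complex_linear \<equiv> Vector_Spaces.linear (*s) (*s)"

definition unit_ball :: "(complex^'n) set" where
  "unit_ball = ball 0 1"

text \<open>The infimum is a minimum, see \<open>m_op_attained\<close> below.\<close>

definition m_op :: "(complex^'n \<Rightarrow> complex^'n) \<Rightarrow> real" where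
  "m_op A = Inf {Re (hinner (A z) z) |z. norm z = 1}"

text \<open>
  The operator exponential \<open>e\<^sup>A\<close>, as its power series evaluated at a vector.  (The library's
  \<^const>\<open>exp\<close> is not applicable: operators on \<open>\<complex>\<^sup>n\<close> form no instance of a Banach algebra class,
  and multiplication on \<^typ>\<open>complex^'n^'n\<close> is entrywise.)
\<close>

definition op_exp :: "(complex^'n \<Rightarrow> complex^'n) \<Rightarrow> complex^'n \<Rightarrow> complex^'n" where
  "op_exp A z = (\<Sum>k. (A ^^ k) z /\<^sub>R fact k)"

text \<open>Holomorphy on an open set is complex Frechet differentiability at each of its points.\<close>

definition holomorphic_map_on ::
    "(complex^'n \<Rightarrow> complex^'n) \<Rightarrow> (complex^'n) set \<Rightarrow> bool" where
  "holomorphic_map_on f S \<longleftrightarrow>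
     open S \<and> (\<forall>z\<in>S. \<exists>D. complex_linear D \<and> (f has_derivative D) (at z))"

definition biholomorphism ::
    "(complex^'n \<Rightarrow> complex^'n) \<Rightarrow> (complex^'n) set \<Rightarrow> (complex^'n) set \<Rightarrow> bool" where
  "biholomorphism f U V \<longleftrightarrow>
     bij_betw f U V \<and> holomorphic_map_on f U \<and> holomorphic_map_on (inv_into U f) V"

text \<open>
  A mapping on the ball is a function that is \<^const>\<open>undefined\<close> outside the ball, so that equality
  of functions is equality of mappings.
\<close>

definition hol_maps :: "(complex^'n \<Rightarrow> complex^'n) set" where
  "hol_maps = {f \<in> extensional unit_ball. holomorphic_map_on f unit_ball}"

text \<open>
  The topology of locally uniform convergence: the ball is locally compact, so neighbourhoods are
  given by uniform closeness on compact subsets.  See \<open>limitin_hol_topology\<close> below.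
\<close>

definition hol_topology :: "(complex^'n \<Rightarrow> complex^'n) topology" where
  "hol_topology = topology (\<lambda>U. U \<subseteq> hol_maps \<and>
     (\<forall>f\<in>U. \<exists>K e. compact K \<and> K \<subseteq> unit_ball \<and> e > 0 \<and>
        (\<forall>g\<in>hol_maps. (\<forall>z\<in>K. dist (g z) (f z) < e) \<longrightarrow> g \<in> U)))"

definition normalized_univalent :: "(complex^'n \<Rightarrow> complex^'n) set" where
  "normalized_univalent = {f \<in> hol_maps. biholomorphism f unit_ball (f ` unit_ball) \<and>
     f 0 = 0 \<and> (f has_derivative (\<lambda>v. v)) (at 0)}"

definition spirallike_maps ::
    "(complex^'n \<Rightarrow> complex^'n) \<Rightarrow> (complex^'n \<Rightarrow> complex^'n) set" where
  "spirallike_maps A = {f \<in> normalized_univalent.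
     \<forall>t\<ge>0. op_exp (\<lambda>z. (- t) *\<^sub>R A z) ` (f ` unit_ball) \<subseteq> f ` unit_ball}"

definition starlike_maps :: "(complex^'n \<Rightarrow> complex^'n) set" where
  "starlike_maps = {f \<in> normalized_univalent.
     \<forall>w\<in>f ` unit_ball. closed_segment 0 w \<subseteq> f ` unit_ball}"

definition Aut_space :: "(complex^'n \<Rightarrow> complex^'n) set" where
  "Aut_space = {\<Phi>. biholomorphism \<Phi> UNIV UNIV}"

definition Aut_restrictions :: "(complex^'n \<Rightarrow> complex^'n) set" where
  "Aut_restrictions = (\<lambda>\<Phi>. restrict \<Phi> unit_ball) ` Aut_space"

lemma m_op_attained:
  fixes A :: "complex^'n \<Rightarrow> complex^'n"
  assumes "complex_linear A"
  shows "\<exists>z. norm z = 1 \<and> m_op A = Re (hinner (A z) z) \<and>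
           (\<forall>w. norm w = 1 \<longrightarrow> Re (hinner (A z) z) \<le> Re (hinner (A w) w))"
proof -
  let ?g = "\<lambda>z. Re (hinner (A z) z)"
  have "A = (*v) (matrix A)"
    using assms by (metis matrix_vector_mul ext)
  then have "continuous_on UNIV A"
    by (metis matrix_vector_mul_linear linear_continuous_on linear_conv_bounded_linear)
  then have contA: "continuous_on (sphere 0 1) A"
    using continuous_on_subset by blast
  have "continuous_on (sphere 0 1) ?g"
    unfolding hinner_def by (intro continuous_intros contA)
  moreover have "sphere (0::complex^'n) 1 \<noteq> {}"
    by simp
  ultimately obtain z where z: "norm z = 1" "\<And>w. norm w = 1 \<Longrightarrow> ?g z \<le> ?g w"
    using continuous_attains_inf[of "sphere (0::complex^'n) 1" ?g] by auto
  have "m_op A = ?g z"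
    unfolding m_op_def by (rule cInf_eq_minimum) (use z in auto)
  with z show ?thesis by auto
qed

lemma openin_hol_topology:
  fixes U :: "(complex^'n \<Rightarrow> complex^'n) set"
  shows "openin hol_topology U \<longleftrightarrow> U \<subseteq> hol_maps \<and>
     (\<forall>f\<in>U. \<exists>K e. compact K \<and> K \<subseteq> unit_ball \<and> e > 0 \<and>
        (\<forall>g\<in>hol_maps. (\<forall>z\<in>K. dist (g z) (f z) < e) \<longrightarrow> g \<in> U))"
proof -
  define N where "N f U \<longleftrightarrow> (\<exists>K e. compact K \<and> K \<subseteq> unit_ball \<and> e > 0 \<and>
        (\<forall>g\<in>hol_maps. (\<forall>z\<in>K. dist (g z) (f z) < e) \<longrightarrow> g \<in> U))"
    for f :: "complex^'n \<Rightarrow> complex^'n" and U :: "(complex^'n \<Rightarrow> complex^'n) set"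
  have N_Int: "N f (S \<inter> T)" if S: "N f S" and T: "N f T" for f S T
  proof -
    obtain K e where K: "compact K" "K \<subseteq> unit_ball" "e > 0"
      "\<And>g. g \<in> hol_maps \<Longrightarrow> \<forall>z\<in>K. dist (g z) (f z) < e \<Longrightarrow> g \<in> S"
      using S unfolding N_def by blast
    obtain K' e' where K': "compact K'" "K' \<subseteq> unit_ball" "e' > 0"
      "\<And>g. g \<in> hol_maps \<Longrightarrow> \<forall>z\<in>K'. dist (g z) (f z) < e' \<Longrightarrow> g \<in> T"
      using T unfolding N_def by blast
    show ?thesis
      unfolding N_def
      by (rule exI[of _ "K \<union> K'"], rule exI[of _ "min e e'"]) (use K K' in auto)
  qed
  have N_mono: "N f T" if "N f S" "S \<subseteq> T" for f S T
    using that unfolding N_def by blast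
  have "istopology (\<lambda>U. U \<subseteq> hol_maps \<and> (\<forall>f\<in>U. N f U))"
    unfolding istopology_def using N_Int N_mono by (auto, meson Union_upper)
  then show ?thesis
    unfolding hol_topology_def N_def by (simp add: topology_inverse')
qed

lemma topspace_hol_topology: "topspace hol_topology = hol_maps"
proof -
  have "openin hol_topology hol_maps"
    unfolding openin_hol_topology by (auto intro!: exI[of _ "{}"] exI[of _ "1::real"])
  then show ?thesis
    by (metis openin_hol_topology openin_subset openin_topspace subset_antisym)
qed

lemma limitin_hol_topology:
  fixes f :: "complex^'n \<Rightarrow> complex^'n"
  assumes "\<forall>\<^sub>F i in F. h i \<in> hol_maps" and f: "f \<in> hol_maps"
  shows "limitin hol_topology h f F \<longleftrightarrow>
           (\<forall>K. compact K \<and> K \<subseteq> unit_ball \<longrightarrow> uniform_limit K h f F)"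
proof
  assume lim: "limitin hol_topology h f F"
  show "\<forall>K. compact K \<and> K \<subseteq> unit_ball \<longrightarrow> uniform_limit K h f F"
  proof (intro allI impI uniform_limitI)
    fix K :: "(complex^'n) set" and e :: real
    assume K: "compact K \<and> K \<subseteq> unit_ball" and e: "e > 0"
    define U where "U = {g \<in> hol_maps. \<exists>d<e. \<forall>z\<in>K. dist (g z) (f z) \<le> d}"
    have "openin hol_topology U"
      unfolding openin_hol_topology
    proof (intro conjI ballI)
      fix g assume "g \<in> U"
      then obtain d where d: "d < e" "\<forall>z\<in>K. dist (g z) (f z) \<le> d"
        unfolding U_def by auto
      have "g' \<in> U" if g': "g' \<in> hol_maps" "\<forall>z\<in>K. dist (g' z) (g z) < (e - d) / 2" for g'
      proof -
        have "dist (g' z) (f z) \<le> d + (e - d) / 2" if "z \<in> K" for z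
        proof -
          have "dist (g z) (f z) \<le> d" "dist (g' z) (g z) < (e - d) / 2"
            using d(2) g'(2) that by auto
          then show ?thesis
            using dist_triangle[of "g' z" "f z" "g z"] by linarith
        qed
        moreover have "d + (e - d) / 2 < e" using d(1) by (simp add: field_simps)
        ultimately show ?thesis using g'(1) unfolding U_def by (simp, intro exI[of _ "d + (e - d) / 2"]) simp
      qed
      then show "\<exists>K e. compact K \<and> K \<subseteq> unit_ball \<and> e > 0 \<and>
          (\<forall>g'\<in>hol_maps. (\<forall>z\<in>K. dist (g' z) (g z) < e) \<longrightarrow> g' \<in> U)"
        using K d(1) by (intro exI[of _ K] exI[of _ "(e - d) / 2"]) simp
    qed (auto simp: U_def)
    moreover have "f \<in> U"
      using f e unfolding U_def by (simp, intro exI[of _ 0]) simp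
    ultimately have "\<forall>\<^sub>F i in F. h i \<in> U"
      using lim unfolding limitin_def by blast
    then show "\<forall>\<^sub>F i in F. \<forall>z\<in>K. dist (h i z) (f z) < e"
      by (rule eventually_mono) (unfold U_def, blast intro: le_less_trans)
  qed
next
  assume R: "\<forall>K. compact K \<and> K \<subseteq> unit_ball \<longrightarrow> uniform_limit K h f F"
  show "limitin hol_topology h f F"
    unfolding limitin_def topspace_hol_topology
  proof (intro conjI allI impI f)
    fix U assume U: "openin hol_topology U \<and> f \<in> U"
    then have "\<exists>K e. compact K \<and> K \<subseteq> unit_ball \<and> e > 0 \<and>
        (\<forall>g\<in>hol_maps. (\<forall>z\<in>K. dist (g z) (f z) < e) \<longrightarrow> g \<in> U)"
      by (auto simp only: openin_hol_topology)
    then obtain K e where K: "compact K" "K \<subseteq> unit_ball" "e > 0"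
      "\<And>g. g \<in> hol_maps \<Longrightarrow> \<forall>z\<in>K. dist (g z) (f z) < e \<Longrightarrow> g \<in> U"
      by blast
    have "\<forall>\<^sub>F i in F. \<forall>z\<in>K. dist (h i z) (f z) < e"
      using R K(1-3) by (simp add: uniform_limit_iff)
    with assms(1) show "\<forall>\<^sub>F i in F. h i \<in> U"
      by eventually_elim (rule K(4))
  qed
qed

end

theory Submission
  imports Defs "HOL-Complex_Analysis.Complex_Analysis"
begin

text \<open>
  Closedness: limits of normalized univalent maps are univalent (Hurwitz for the Jacobian determinant,
  Brouwer for injectivity), and the self-maps \<open>f\<inverse> \<circ> e\<^sup>-\<^sup>t\<^sup>A \<circ> f\<close> of the ball stay in compact sets by
  the Schwarz lemma.

  Density: no Runge theory is needed, because a spirallike \<open>f\<close> satisfies \<open>f = e\<^sup>t\<^sup>A \<circ> f \<circ> v\<^sub>t\<close> with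
  \<open>v\<^sub>t = f\<inverse> \<circ> e\<^sup>-\<^sup>t\<^sup>A \<circ> f\<close>.  Harnack's inequality and \<open>m(A) > 0\<close> make \<open>v\<^sub>t\<close> decay exponentially on
  smaller balls, so \<open>f\<close> may be replaced near \<open>0\<close> by an automorphism with the same jet of high order.
  The semigroup \<open>v\<^sub>t\<close> is generated by a holomorphic field on the ball; its Taylor polynomials are sums
  of shears and overshears (Andersen-Lempert), so \<open>v\<^sub>t\<close> is a limit of compositions of automorphisms.
  On a smaller ball the generator \<open>(D\<Psi>)\<inverse> A \<Psi>\<close> of a \<open>C\<^sup>1\<close>-close normalized automorphism \<open>\<Psi>\<close> still has
  nonnegative real part, which makes \<open>\<Psi>\<close> spirallike there; finally rescale the ball.
\<close>

subsection \<open>Holomorphic functions and maps of several variables\<close>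

text \<open>The boundary shapes the proof: Harnack's factor \<open>(1 - |z|) / (1 + |z|)\<close>
  degenerates there, so decay of the semigroup and positivity of a perturbed generator hold only
  with constants that depend on a smaller ball. Hence the final dilation. The order of the jet is
  forced by a race. Undoing \<open>v\<^sub>t\<close> costs a factor \<open>exp (a t)\<close>, with
  \<open>a\<close> a bound for \<open>A\<close>, while a jet of order \<open>K\<close> is evaluated
  at points of size \<open>exp (- c t)\<close> and errs by a multiple of
  \<open>exp (- c K t)\<close>. So \<open>K\<close> is fixed with \<open>c K > a\<close>, then
  \<open>t\<close> is taken large, and only for this \<open>t\<close> is \<open>v\<^sub>t\<close>
  approximated. Positivity is delicate at the origin, where the real part to be preserved is itself
  only of order \<open>|y|^2\<close>. The approximant must therefore fix \<open>0\<close>, which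
  makes the error of its generator of order \<open>|y|\<close>. Analytic estimates are reduced to
  one variable by restriction to complex lines; multi-indices appear only in the splitting of
  monomial fields. That splitting is where \<open>n \<ge> 2\<close> enters: the directions
  \<open>e\<^sub>j - c e\<^sub>l\<close> need a second coordinate. The starlike case is
  \<open>A\<close> = identity.\<close>

lemma complex_linear_iff:
  fixes L :: "complex^'n \<Rightarrow> complex^'n"
  shows "complex_linear L \<longleftrightarrow> (\<forall>x y. L (x + y) = L x + L y) \<and> (\<forall>c x. L (c *s x) = c *s L x)"
  by (simp add: Vector_Spaces.linear_iff vec.vector_space_axioms)

lemma scaleR_eq_smult: "r *\<^sub>R v = complex_of_real r *s (v :: complex^'n)"
  unfolding vec_eq_iff by (simp) (simp add: scaleR_conv_of_real)

lemma complex_linear_bounded_linear: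
  fixes L :: "complex^'n \<Rightarrow> complex^'n"
  assumes "complex_linear L"
  shows "bounded_linear L"
  using assms unfolding complex_linear_iff
  by (intro linear_conv_bounded_linear[THEN iffD1] linearI) (auto simp: scaleR_eq_smult)

lemma complex_linear_imp_linear:
  fixes L :: "complex^'n \<Rightarrow> complex^'n"
  shows "complex_linear L \<Longrightarrow> linear L"
  by (rule bounded_linear.linear[OF complex_linear_bounded_linear])

lemma norm_smult [simp]: "norm (c *s (v :: complex^'n)) = norm c * norm v"
  by (simp add: norm_vec_def norm_mult L2_set_right_distrib)

lemma bounded_linear_smult_left: "bounded_linear (\<lambda>c. c *s (v :: complex^'n))"
  by (rule bounded_linear_intro[where K = "norm v"])
     (auto simp: scaleR_eq_smult scaleR_conv_of_real algebra_simps vector_sadd_rdistrib)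

lemma bounded_linear_smult_right: "bounded_linear (\<lambda>v :: complex^'n. c *s v)"
  by (rule bounded_linear_intro[where K = "norm c"])
     (auto simp: scaleR_eq_smult algebra_simps vector_add_ldistrib)

lemma vec_eq_sum_axis: "(v :: complex^'n) = (\<Sum>j\<in>UNIV. v $ j *s axis j 1)"
  by (simp add: vec_eq_iff axis_def if_distrib cong: if_cong)

lemma hinner_smult_left: "hinner (c *s z) w = c * hinner z w"
  by (simp add: hinner_def sum_distrib_left mult_ac)

lemma hinner_add_left: "hinner (z + z') w = hinner z w + hinner z' w"
  by (simp add: hinner_def sum.distrib algebra_simps)

lemma hinner_diff_left: "hinner (z - z') w = hinner z w - hinner z' w"
  by (simp add: hinner_def sum_subtractf algebra_simps)

lemma Re_hinner: "Re (hinner z w) = z \<bullet> w"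
  by (simp add: hinner_def inner_vec_def inner_complex_def)

lemma hinner_self: "hinner z z = complex_of_real ((norm z)\<^sup>2)"
proof -
  have "hinner z z = (\<Sum>j\<in>UNIV. complex_of_real ((norm (z $ j))\<^sup>2))"
    unfolding hinner_def by (intro sum.cong refl) (metis complex_norm_square)
  also have "\<dots> = complex_of_real ((norm z)\<^sup>2)"
    by (simp add: norm_vec_def L2_set_def real_sqrt_pow2 sum_nonneg)
  finally show ?thesis .
qed

lemma norm_hinner_le: "norm (hinner z w) \<le> norm z * norm w"
proof (cases "hinner z w = 0")
  case False
  \<comment> \<open>Rotating by a unimodular factor makes the pairing real and nonnegative, so the
    real Cauchy-Schwarz inequality applies.\<close>
  define c where "c = cnj (sgn (hinner z w))"
  have "c * hinner z w = complex_of_real (norm (hinner z w))"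
    using False complex_norm_square[of "hinner z w"] unfolding c_def sgn_div_norm
    by (simp add: scaleR_conv_of_real field_simps power2_eq_square)
  then have "norm (hinner z w) = (c *s z) \<bullet> w"
    by (metis Re_complex_of_real Re_hinner hinner_smult_left)
  also have "\<dots> \<le> norm (c *s z) * norm w"
    by (rule norm_cauchy_schwarz)
  also have "norm c = 1" using False by (simp add: c_def norm_sgn)
  then have "norm (c *s z) = norm z" by simp
  finally show ?thesis .
qed simp

text \<open>Testing against \<open>x\<close> divided by its norm suffices. Vector estimates thus
  follow from scalar ones for \<open>hinner (f z) w\<close> without a constant depending on the
  dimension.\<close>

lemma norm_le_hinner:
  assumes "\<And>w. norm w = 1 \<Longrightarrow> norm (hinner x w) \<le> B" "B \<ge> 0"
  shows "norm x \<le> B"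
proof (cases "x = 0")
  case False
  let ?w = "complex_of_real (1 / norm x) *s x"
  have "hinner x ?w = (1 / norm x) * hinner x x"
    by (simp add: hinner_def sum_distrib_left mult_ac)
  then have "hinner x ?w = complex_of_real (norm x)"
    using False by (simp add: hinner_self power2_eq_square)
  moreover have "norm ?w = 1" using False by (simp add: norm_divide)
  ultimately show ?thesis using assms(1)[of ?w] by simp
qed (use assms in simp)

lemma bounded_linear_hinner: "bounded_linear (\<lambda>z. hinner z w)"
  by (rule bounded_linear_intro[where K = "norm w"])
     (auto simp: scaleR_eq_smult hinner_smult_left hinner_add_left norm_hinner_le scaleR_conv_of_real)

text \<open>Homogeneity alone is demanded of \<open>D\<close>, since its additivity is part of
  \<open>has_derivative\<close>; together they say that \<open>D\<close> is complex linear.\<close>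

definition hol_fun_on :: "(complex^'n \<Rightarrow> complex) \<Rightarrow> (complex^'n) set \<Rightarrow> bool" where
  "hol_fun_on f S \<longleftrightarrow> open S \<and>
     (\<forall>z\<in>S. \<exists>D. (\<forall>c v. D (c *s v) = c * D v) \<and> (f has_derivative D) (at z))"

abbreviation fd :: "(complex^'n \<Rightarrow> 'b::real_normed_vector) \<Rightarrow> complex^'n \<Rightarrow> complex^'n \<Rightarrow> 'b" where
  "fd f z \<equiv> frechet_derivative f (at z)"

lemma hol_fun_on_open: "hol_fun_on f S \<Longrightarrow> open S"
  by (simp add: hol_fun_on_def)

lemma hol_map_on_open: "holomorphic_map_on f S \<Longrightarrow> open S"
  by (simp add: holomorphic_map_on_def)

lemma hol_map_on_subset: "holomorphic_map_on f S \<Longrightarrow> T \<subseteq> S \<Longrightarrow> open T \<Longrightarrow> holomorphic_map_on f T"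
  by (auto simp: holomorphic_map_on_def)

lemma hol_fun_on_fd:
  assumes "hol_fun_on f S" "z \<in> S"
  shows "(f has_derivative fd f z) (at z)" "fd f z (c *s v) = c * fd f z v"
proof -
  obtain D where D: "\<forall>c v. D (c *s v) = c * D v" "(f has_derivative D) (at z)"
    using assms unfolding hol_fun_on_def by blast
  then have "fd f z = D" using frechet_derivative_at by metis
  with D show "(f has_derivative fd f z) (at z)" "fd f z (c *s v) = c * fd f z v" by auto
qed

lemma hol_map_on_fd:
  assumes "holomorphic_map_on f S" "z \<in> S"
  shows "(f has_derivative fd f z) (at z)" "complex_linear (fd f z)"
proof -
  obtain D where D: "complex_linear D" "(f has_derivative D) (at z)"
    using assms by (auto simp: holomorphic_map_on_def)
  then have "fd f z = D" using frechet_derivative_at by metis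
  with D show "(f has_derivative fd f z) (at z)" "complex_linear (fd f z)" by auto
qed

lemma hol_map_on_continuous: "holomorphic_map_on f S \<Longrightarrow> continuous_on S f"
  by (meson continuous_at_imp_continuous_on has_derivative_continuous hol_map_on_fd(1))

lemma hol_fun_on_continuous: "hol_fun_on f S \<Longrightarrow> continuous_on S f"
  by (meson continuous_at_imp_continuous_on has_derivative_continuous hol_fun_on_fd(1))

lemma hol_map_on_cong:
  assumes "holomorphic_map_on f S" "\<And>z. z \<in> S \<Longrightarrow> f z = g z"
  shows "holomorphic_map_on g S"
  using assms unfolding holomorphic_map_on_def
  by (metis (mono_tags, lifting) has_derivative_transform_within_open)

lemma hol_map_on_componentwise:
  fixes f :: "complex^'n \<Rightarrow> complex^'n"
  shows "holomorphic_map_on f S \<longleftrightarrow> open S \<and> (\<forall>i. hol_fun_on (\<lambda>z. f z $ i) S)"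
proof (intro iffI conjI allI)
  assume f: "holomorphic_map_on f S"
  then show "open S" by (rule hol_map_on_open)
  fix i
  show "hol_fun_on (\<lambda>z. f z $ i) S"
    unfolding hol_fun_on_def
  proof (intro conjI ballI)
    fix z assume z: "z \<in> S"
    have "((\<lambda>z. f z $ i) has_derivative (\<lambda>v. fd f z v $ i)) (at z)"
      by (rule bounded_linear.has_derivative[OF bounded_linear_vec_nth hol_map_on_fd(1)[OF f z]])
    moreover have "fd f z (c *s v) $ i = c * fd f z v $ i" for c v
      using hol_map_on_fd(2)[OF f z] by (simp add: complex_linear_iff)
    ultimately show "\<exists>D. (\<forall>c v. D (c *s v) = c * D v) \<and> ((\<lambda>z. f z $ i) has_derivative D) (at z)"
      by (intro exI[of _ "\<lambda>v. fd f z v $ i"]) simp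
  qed (use f in \<open>simp add: hol_map_on_open\<close>)
next
  assume f: "open S \<and> (\<forall>i. hol_fun_on (\<lambda>z. f z $ i) S)"
  show "holomorphic_map_on f S"
    unfolding holomorphic_map_on_def
  proof (intro conjI ballI)
    fix z assume z: "z \<in> S"
    define D where "D v = (\<chi> i. fd (\<lambda>z. f z $ i) z v)" for v
    have *: "((\<lambda>z. f z $ i) has_derivative (\<lambda>v. D v $ i)) (at z)" for i
      using hol_fun_on_fd(1)[of "\<lambda>z. f z $ i" S z] f z by (simp add: D_def eta_contract_eq)
    have "(f has_derivative D) (at z)"
      unfolding has_derivative_componentwise_within[of f]
    proof
      fix b :: "complex^'n" assume "b \<in> Basis"
      then obtain i c where b: "b = axis i c" by (auto simp: Basis_vec_def)
      show "((\<lambda>x. f x \<bullet> b) has_derivative (\<lambda>x. D x \<bullet> b)) (at z)"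
        unfolding b inner_axis by (intro has_derivative_inner_left *)
    qed
    then have "bounded_linear D" by (rule has_derivative_bounded_linear)
    then have "D (x + y) = D x + D y" for x y
      by (simp add: bounded_linear.linear linear_add)
    moreover have "D (c *s x) = c *s D x" for c x
      using f z hol_fun_on_fd(2)[of "\<lambda>z. f z $ _" S z] by (simp add: D_def vec_eq_iff)
    ultimately have "complex_linear D"
      unfolding complex_linear_iff by blast
    with \<open>(f has_derivative D) (at z)\<close> show "\<exists>D. complex_linear D \<and> (f has_derivative D) (at z)" by blast
  qed (use f in simp)
qed

lemma hol_fun_on_hinner:
  assumes "holomorphic_map_on f S"
  shows "hol_fun_on (\<lambda>z. hinner (f z) w) S"
    and "z \<in> S \<Longrightarrow> fd (\<lambda>z. hinner (f z) w) z v = hinner (fd f z v) w"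
proof -
  have *: "((\<lambda>z. hinner (f z) w) has_derivative (\<lambda>v. hinner (fd f z v) w)) (at z)" if "z \<in> S" for z
    by (rule bounded_linear.has_derivative[OF bounded_linear_hinner hol_map_on_fd(1)[OF assms that]])
  show "hol_fun_on (\<lambda>z. hinner (f z) w) S"
    unfolding hol_fun_on_def
    using * hol_map_on_fd(2)[OF assms] assms
    by (auto simp: hol_map_on_open complex_linear_iff hinner_smult_left
        intro!: exI[of _ "\<lambda>v. hinner (fd f _ v) w"])
  show "z \<in> S \<Longrightarrow> fd (\<lambda>z. hinner (f z) w) z v = hinner (fd f z v) w"
    using frechet_derivative_at[OF *] by metis
qed

lemma hol_map_on_compose:
  assumes "holomorphic_map_on g T" "holomorphic_map_on f S" "f ` S \<subseteq> T"
  shows "holomorphic_map_on (\<lambda>z. g (f z)) S"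
    and "z \<in> S \<Longrightarrow> fd (\<lambda>z. g (f z)) z v = fd g (f z) (fd f z v)"
proof -
  have *: "((\<lambda>z. g (f z)) has_derivative (\<lambda>v. fd g (f z) (fd f z v))) (at z)" if "z \<in> S" for z
  proof -
    have "f z \<in> T" using assms(3) that by auto
    from diff_chain_at[OF hol_map_on_fd(1)[OF assms(2) that] hol_map_on_fd(1)[OF assms(1) this]]
    show ?thesis by (simp add: o_def)
  qed
  have lin: "complex_linear (\<lambda>v. fd g (f z) (fd f z v))" if "z \<in> S" for z
  proof -
    have "f z \<in> T" using assms(3) that by auto
    then show ?thesis
      using hol_map_on_fd(2)[OF assms(2) that] hol_map_on_fd(2)[OF assms(1), of "f z"]
      by (simp add: complex_linear_iff)
  qed
  show "holomorphic_map_on (\<lambda>z. g (f z)) S"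
    unfolding holomorphic_map_on_def using * lin assms(2) hol_map_on_open by blast
  show "z \<in> S \<Longrightarrow> fd (\<lambda>z. g (f z)) z v = fd g (f z) (fd f z v)"
    using frechet_derivative_at[OF *] by metis
qed

lemma hol_fun_on_compose:
  assumes "hol_fun_on g T" "holomorphic_map_on f S" "f ` S \<subseteq> T"
  shows "hol_fun_on (\<lambda>z. g (f z)) S"
  unfolding hol_fun_on_def
proof (intro conjI ballI)
  fix z assume "z \<in> S"
  then have fz: "f z \<in> T" using assms(3) by auto
  show "\<exists>D. (\<forall>c v. D (c *s v) = c * D v) \<and> ((\<lambda>z. g (f z)) has_derivative D) (at z)"
    using diff_chain_at[OF hol_map_on_fd(1)[OF assms(2) \<open>z \<in> S\<close>] hol_fun_on_fd(1)[OF assms(1) fz]]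
      hol_fun_on_fd(2)[OF assms(1) fz] hol_map_on_fd(2)[OF assms(2) \<open>z \<in> S\<close>]
    by (intro exI[of _ "\<lambda>v. fd g (f z) (fd f z v)"]) (simp add: o_def complex_linear_iff)
qed (use assms hol_map_on_open in blast)

lemma hol_fun_on_const: "open S \<Longrightarrow> hol_fun_on (\<lambda>_. c) S"
  unfolding hol_fun_on_def by (auto intro!: exI[of _ "\<lambda>_. 0"])

lemma hol_fun_on_nth: "open S \<Longrightarrow> hol_fun_on (\<lambda>z. z $ i) S"
  unfolding hol_fun_on_def
  by (auto intro!: exI[of _ "\<lambda>v. v $ i"] bounded_linear_imp_has_derivative bounded_linear_vec_nth)

lemma hol_fun_on_add:
  "hol_fun_on f S \<Longrightarrow> hol_fun_on g S \<Longrightarrow> hol_fun_on (\<lambda>z. f z + g z) S"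
  unfolding hol_fun_on_def
proof (intro conjI ballI, goal_cases)
  case (2 z)
  then obtain D E where "\<forall>c v. D (c *s v) = c * D v" "(f has_derivative D) (at z)"
    "\<forall>c v. E (c *s v) = c * E v" "(g has_derivative E) (at z)"
    by meson
  then show ?case
    by (intro exI[of _ "\<lambda>v. D v + E v"]) (auto simp: algebra_simps intro!: derivative_eq_intros)
qed simp

lemma hol_fun_on_mult:
  assumes "hol_fun_on f S" "hol_fun_on g S"
  shows "hol_fun_on (\<lambda>z. f z * g z) S"
  unfolding hol_fun_on_def
proof (intro conjI ballI)
  fix z assume z: "z \<in> S"
  show "\<exists>D. (\<forall>c v. D (c *s v) = c * D v) \<and> ((\<lambda>z. f z * g z) has_derivative D) (at z)"
    using hol_fun_on_fd[OF assms(1) z] hol_fun_on_fd[OF assms(2) z]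
    by (intro exI[of _ "\<lambda>v. f z * fd g z v + fd f z v * g z"])
       (auto simp: algebra_simps intro!: derivative_eq_intros)
qed (use assms hol_fun_on_open in blast)

lemma hol_fun_on_prod:
  "open S \<Longrightarrow> (\<And>i. i \<in> I \<Longrightarrow> hol_fun_on (f i) S) \<Longrightarrow> hol_fun_on (\<lambda>z. \<Prod>i\<in>I. f i z) S"
  by (induction I rule: infinite_finite_induct) (auto intro: hol_fun_on_mult hol_fun_on_const)

lemma hol_fun_on_power: "hol_fun_on f S \<Longrightarrow> hol_fun_on (\<lambda>z. f z ^ k) S"
  by (induction k) (auto intro: hol_fun_on_mult hol_fun_on_const dest: hol_fun_on_open)

lemma hol_fun_on_exp:
  assumes "hol_fun_on f S"
  shows "hol_fun_on (\<lambda>z. exp (f z)) S"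
  unfolding hol_fun_on_def
proof (intro conjI ballI)
  fix z assume z: "z \<in> S"
  show "\<exists>D. (\<forall>c v. D (c *s v) = c * D v) \<and> ((\<lambda>z. exp (f z)) has_derivative D) (at z)"
    using hol_fun_on_fd[OF assms z]
      diff_chain_at[OF hol_fun_on_fd(1)[OF assms z] DERIV_exp[unfolded has_field_derivative_def]]
    by (intro exI[of _ "\<lambda>v. exp (f z) * fd f z v"]) (simp add: o_def)
qed (use assms hol_fun_on_open in blast)

lemma hol_map_on_add:
  "holomorphic_map_on f S \<Longrightarrow> holomorphic_map_on g S \<Longrightarrow> holomorphic_map_on (\<lambda>z. f z + g z) S"
  by (auto simp: hol_map_on_componentwise intro: hol_fun_on_add)

lemma hol_map_on_smult:
  "hol_fun_on f S \<Longrightarrow> holomorphic_map_on g S \<Longrightarrow> holomorphic_map_on (\<lambda>z. f z *s g z) S"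
  by (auto simp: hol_map_on_componentwise intro: hol_fun_on_mult)

lemma hol_map_on_const: "open S \<Longrightarrow> holomorphic_map_on (\<lambda>_. c) S"
  by (auto simp: hol_map_on_componentwise intro: hol_fun_on_const)

lemma hol_map_on_id: "open S \<Longrightarrow> holomorphic_map_on (\<lambda>z. z) S"
  by (auto simp: hol_map_on_componentwise intro: hol_fun_on_nth)

lemma hol_map_on_linear: "complex_linear L \<Longrightarrow> open S \<Longrightarrow> holomorphic_map_on L S"
  by (auto simp: holomorphic_map_on_def intro!: exI[of _ L] bounded_linear_imp_has_derivative
      complex_linear_bounded_linear)

lemma hol_map_on_diff:
  assumes "holomorphic_map_on f S" "holomorphic_map_on g S"
  shows "holomorphic_map_on (\<lambda>z. f z - g z) S"
proof -
  have "holomorphic_map_on (\<lambda>z. f z + (\<lambda>_. -1) z *s g z) S"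
    using assms by (intro hol_map_on_add hol_map_on_smult hol_fun_on_const) (auto dest: hol_map_on_open)
  then show ?thesis by (simp flip: vector_sneg_minus1)
qed

lemma fd_eqI: "(f has_derivative D) (at z) \<Longrightarrow> fd f z = D"
  using frechet_derivative_at by metis

text \<open>The bridge to one-variable theory: complex homogeneity of the differential is what makes
  the derivative along a complex line multiplication by a complex number.\<close>

lemma slice_has_field_derivative:
  assumes "hol_fun_on f S" "z + \<zeta> *s u \<in> S"
  shows "((\<lambda>\<zeta>. f (z + \<zeta> *s u)) has_field_derivative fd f (z + \<zeta> *s u) u) (at \<zeta>)"
proof -
  have "((\<lambda>\<zeta>. z + \<zeta> *s u) has_derivative (\<lambda>h. h *s u)) (at \<zeta>)"
    by (auto intro!: derivative_eq_intros bounded_linear_imp_has_derivative[OF bounded_linear_smult_left])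
  from diff_chain_at[OF this hol_fun_on_fd(1)[OF assms]]
  have "((\<lambda>\<zeta>. f (z + \<zeta> *s u)) has_derivative (\<lambda>h. h * fd f (z + \<zeta> *s u) u)) (at \<zeta>)"
    by (simp add: o_def hol_fun_on_fd(2)[OF assms])
  moreover have "(\<lambda>h. h * fd f (z + \<zeta> *s u) u) = (*) (fd f (z + \<zeta> *s u) u)"
    by (simp add: fun_eq_iff mult.commute)
  ultimately show ?thesis
    by (simp add: has_field_derivative_def)
qed

lemma slice_holomorphic:
  assumes "hol_fun_on f S" "\<And>\<zeta>. \<zeta> \<in> T \<Longrightarrow> z + \<zeta> *s u \<in> S"
  shows "(\<lambda>\<zeta>. f (z + \<zeta> *s u)) holomorphic_on T"
  using slice_has_field_derivative[OF assms(1)] assms(2)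
  by (meson field_differentiable_at_within field_differentiable_def holomorphic_onI)

subsection \<open>Cauchy estimates, Taylor expansion and Weierstrass convergence\<close>

text \<open>Meant for candidates \<open>D\<close> that arise as limits of differentials: a quadratic
  remainder with a uniform constant survives pointwise limits, a mere little-o condition does
  not.\<close>

lemma has_derivative_quadratic_remainder:
  fixes f :: "'a::real_normed_vector \<Rightarrow> 'b::real_normed_vector"
  assumes D: "bounded_linear D" and "\<delta> > 0"
    and bd: "\<And>u. norm u < \<delta> \<Longrightarrow> norm (f (z + u) - f z - D u) \<le> C * (norm u)\<^sup>2"
  shows "(f has_derivative D) (at z)"
  unfolding has_derivative_at_alt
proof (intro conjI D allI impI)
  fix e :: real assume e: "e > 0"
  define d where "d = min \<delta> (e / (\<bar>C\<bar> + 1))"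
  have d: "d > 0" using e \<open>\<delta> > 0\<close> by (simp add: d_def add_nonneg_pos)
  show "\<exists>d>0. \<forall>y. norm (y - z) < d \<longrightarrow> norm (f y - f z - D (y - z)) \<le> e * norm (y - z)"
  proof (intro exI[of _ d] conjI d allI impI)
    fix y assume y: "norm (y - z) < d"
    have "norm (f y - f z - D (y - z)) \<le> C * (norm (y - z))\<^sup>2"
      using bd[of "y - z"] y by (simp add: d_def)
    also have "\<dots> \<le> (\<bar>C\<bar> + 1) * (norm (y - z))\<^sup>2"
      by (intro mult_right_mono) auto
    also have "\<dots> = ((\<bar>C\<bar> + 1) * norm (y - z)) * norm (y - z)"
      by (simp add: power2_eq_square)
    also have "\<dots> \<le> e * norm (y - z)"
    proof (intro mult_right_mono)
      have "norm (y - z) \<le> e / (\<bar>C\<bar> + 1)" using y by (simp add: d_def)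
      then show "(\<bar>C\<bar> + 1) * norm (y - z) \<le> e" by (simp add: field_simps add_nonneg_pos)
    qed simp
    finally show "norm (f y - f z - D (y - z)) \<le> e * norm (y - z)" .
  qed
qed

text \<open>The homogeneous part of degree \<open>k\<close> of the Taylor expansion at 0, read off
  as a Taylor coefficient of the one-variable slice through \<open>u\<close>; no partial derivatives
  or multi-indices are involved.\<close>

definition hpart :: "(complex^'n \<Rightarrow> complex) \<Rightarrow> nat \<Rightarrow> complex^'n \<Rightarrow> complex" where
  "hpart f k u = (deriv ^^ k) (\<lambda>\<zeta>. f (\<zeta> *s u)) 0 / fact k"

lemma hpart_0: "hpart f 0 u = f 0"
  by (simp add: hpart_def)

lemma hpart_at_0: "hpart f k 0 = (if k = 0 then f 0 else 0)"
  by (simp add: hpart_def)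

lemma hpart_1:
  assumes "hol_fun_on f S" "0 \<in> S"
  shows "hpart f 1 u = fd f 0 u"
  using DERIV_imp_deriv[OF slice_has_field_derivative[of f S 0 0 u]] assms by (simp add: hpart_def)

lemma hpart_bound:
  assumes f: "hol_fun_on f S" "cball 0 \<rho> \<subseteq> S" and M: "\<And>z. z \<in> cball 0 \<rho> \<Longrightarrow> norm (f z) \<le> M"
    and r: "r > 0" "r * norm u \<le> \<rho>"
  shows "norm (hpart f k u) \<le> M / r ^ k"
proof -
  have mem: "\<zeta> *s u \<in> cball 0 \<rho>" if "norm \<zeta> \<le> r" for \<zeta>
    using r(2) mult_right_mono[OF that, of "norm u"] by simp
  then have memS: "\<zeta> *s u \<in> S" if "norm \<zeta> \<le> r" for \<zeta>
    using that f(2) by blast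
  have hol: "(\<lambda>\<zeta>. f (\<zeta> *s u)) holomorphic_on cball 0 r"
    using slice_holomorphic[OF f(1), of "cball 0 r" 0 u] memS by simp
  have "norm ((deriv ^^ k) (\<lambda>\<zeta>. f (\<zeta> *s u)) 0) \<le> fact k * M / r ^ k"
  proof (rule Cauchy_inequality)
    show "(\<lambda>\<zeta>. f (\<zeta> *s u)) holomorphic_on ball 0 r"
      using hol by (rule holomorphic_on_subset) auto
    show "continuous_on (cball 0 r) (\<lambda>\<zeta>. f (\<zeta> *s u))"
      using hol by (rule holomorphic_on_imp_continuous_on)
    show "\<And>x. norm (0 - x) = r \<Longrightarrow> norm (f (x *s u)) \<le> M"
      by (rule M, rule mem) auto
  qed (use r in auto)
  moreover have "r ^ k > 0" using r(1) by simp
  ultimately show ?thesis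
    by (simp add: hpart_def norm_divide pos_le_divide_eq pos_divide_le_eq mult_ac)
qed

text \<open>The slice through \<open>u\<close> is holomorphic on a disc of radius
  \<open>r > 1\<close>, so its power series converges at 1, where the slice takes the value
  \<open>f u\<close>. Cauchy's inequality dominates the tail by a geometric series of ratio
  \<open>1 / r\<close>.\<close>

lemma taylor_remainder:
  assumes f: "hol_fun_on f S" "cball 0 \<rho> \<subseteq> S" and M: "\<And>z. z \<in> cball 0 \<rho> \<Longrightarrow> norm (f z) \<le> M"
    and r: "r > 1" "r * norm u \<le> \<rho>"
  shows "norm (f u - (\<Sum>k<K. hpart f k u)) \<le> M * (1 / r) ^ K / (1 - 1 / r)"
proof -
  have mem: "\<zeta> *s u \<in> cball 0 \<rho>" if "norm \<zeta> \<le> r" for \<zeta>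
    using r(2) mult_right_mono[OF that, of "norm u"] by simp
  then have memS: "\<zeta> *s u \<in> S" if "norm \<zeta> < r" for \<zeta>
    using that f(2) less_imp_le by blast
  have hol: "(\<lambda>\<zeta>. f (\<zeta> *s u)) holomorphic_on ball 0 r"
    using slice_holomorphic[OF f(1), of "ball 0 r" 0 u] memS by simp
  have "(\<lambda>k. (deriv ^^ k) (\<lambda>\<zeta>. f (\<zeta> *s u)) 0 / fact k * (1 - 0) ^ k) sums f (1 *s u)"
    using holomorphic_power_series[OF hol, of 1] r by simp
  then have "(\<lambda>k. hpart f k u) sums f u"
    by (simp add: hpart_def)
  then have s: "(\<lambda>k. hpart f (k + K) u) sums (f u - (\<Sum>k<K. hpart f k u))"
    by (rule sums_split_initial_segment)
  have b: "norm (hpart f (k + K) u) \<le> M * (1 / r) ^ K * (1 / r) ^ k" for k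
    using hpart_bound[OF f M, of r u "k + K"] r by (simp add: power_add power_divide mult_ac)
  have g: "(\<lambda>k. M * (1 / r) ^ K * (1 / r) ^ k) sums (M * (1 / r) ^ K * (1 / (1 - 1 / r)))"
    by (intro sums_mult geometric_sums) (use r in simp)
  have "norm (f u - (\<Sum>k<K. hpart f k u)) = norm (\<Sum>k. hpart f (k + K) u)"
    using s by (simp add: sums_iff)
  also have "\<dots> \<le> (\<Sum>k. M * (1 / r) ^ K * (1 / r) ^ k)"
    using g b by (intro norm_suminf_le) (simp_all add: sums_iff)
  also have "\<dots> = M * (1 / r) ^ K / (1 - 1 / r)"
    using g by (simp add: sums_iff)
  finally show ?thesis .
qed

text \<open>The largest admissible radius, \<open>r = \<rho> / norm u \<ge> 2\<close>, turns the
  geometric bound into vanishing of order \<open>K\<close> at the origin.\<close>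

lemma taylor_remainder2:
  assumes f: "hol_fun_on f S" "cball 0 \<rho> \<subseteq> S" and M: "\<And>z. z \<in> cball 0 \<rho> \<Longrightarrow> norm (f z) \<le> M"
    and u: "norm u \<le> \<rho> / 2" and \<rho>: "\<rho> > 0"
  shows "norm (f u - (\<Sum>k<K. hpart f k u)) \<le> 2 * M * (norm u / \<rho>) ^ K"
proof (cases "u = 0")
  case True
  have "norm (f 0) \<le> M" using M[of 0] \<rho> by simp
  moreover have "0 \<le> norm (f 0)" by simp
  ultimately have "norm (f 0) \<le> 2 * M" "0 \<le> M" by linarith+
  moreover have "(\<Sum>k<K. hpart f k 0) = (if K = 0 then 0 else f 0)"
    by (simp add: hpart_at_0 sum.delta)
  ultimately show ?thesis using True by (simp add: zero_le_mult_iff)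
next
  case False
  define r where "r = \<rho> / norm u"
  have r: "r \<ge> 2" "r * norm u \<le> \<rho>" using u False by (auto simp: r_def field_simps)
  have M0: "0 \<le> M" using M[of 0] \<rho> norm_ge_zero[of "f 0"] by (simp, linarith)
  have "norm (f u - (\<Sum>k<K. hpart f k u)) \<le> M * (1 / r) ^ K / (1 - 1 / r)"
    using r by (intro taylor_remainder[OF f M]) auto
  also have "\<dots> \<le> M * (1 / r) ^ K / (1 / 2)"
    using r M0 by (intro divide_left_mono mult_nonneg_nonneg zero_le_power) (auto simp: field_simps)
  also have "\<dots> = 2 * M * (norm u / \<rho>) ^ K"
    by (simp add: r_def)
  finally show ?thesis .
qed

lemma hol_fun_on_translate:
  assumes "hol_fun_on f S"
  shows "hol_fun_on (\<lambda>u. f (z + u)) ((+) z -` S)"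
proof -
  have "open ((+) z -` S)"
    using assms by (intro open_vimage continuous_intros) (auto dest: hol_fun_on_open)
  then show ?thesis
    by (intro hol_fun_on_compose[OF assms] hol_map_on_add hol_map_on_const hol_map_on_id) auto
qed

text \<open>The parts of degree 0 and 1 of the translated function are \<open>f z\<close> and
  \<open>fd f z u\<close>, so this is the case \<open>K = 2\<close> of the Taylor remainder.\<close>

lemma second_order_bound:
  assumes f: "hol_fun_on f S" "cball z \<rho> \<subseteq> S" and M: "\<And>w. w \<in> cball z \<rho> \<Longrightarrow> norm (f w) \<le> M"
    and u: "norm u \<le> \<rho> / 2" and \<rho>: "\<rho> > 0"
  shows "norm (f (z + u) - f z - fd f z u) \<le> 2 * M * (norm u / \<rho>)\<^sup>2"
proof -
  let ?g = "\<lambda>u. f (z + u)"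
  have z: "z \<in> S" using f(2) \<rho> by auto
  have g: "hol_fun_on ?g ((+) z -` S)" by (rule hol_fun_on_translate[OF f(1)])
  have sub: "cball 0 \<rho> \<subseteq> (+) z -` S" using f(2) by (auto simp: subset_iff dist_norm)
  have "((\<lambda>u. f (z + u)) has_derivative fd f z) (at 0)"
    using diff_chain_at[of "\<lambda>u. z + u" "\<lambda>u. u" 0 f "fd f z"] hol_fun_on_fd(1)[OF f(1) z]
      has_derivative_add[OF has_derivative_const[of z] has_derivative_ident, of "at 0"]
    by (simp add: o_def)
  then have "hpart ?g 1 u = fd f z u"
    using hpart_1[OF g] z by (simp add: fd_eqI)
  then have "(\<Sum>k<2. hpart ?g k u) = f z + fd f z u"
    by (simp add: numeral_2_eq_2 hpart_0)
  moreover have "norm (?g u - (\<Sum>k<2. hpart ?g k u)) \<le> 2 * M * (norm u / \<rho>)\<^sup>2"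
    by (rule taylor_remainder2[OF g sub _ u \<rho>]) (rule M, simp add: dist_norm)
  ultimately show ?thesis by (simp add: algebra_simps)
qed

text \<open>The differential is the Taylor part of degree 1 of the translated function, estimated on
  the largest circle that fits in the direction \<open>u\<close>, of radius
  \<open>\<rho> / norm u\<close>.\<close>

lemma cauchy_fd_bound:
  assumes f: "hol_fun_on f S" "cball z \<rho> \<subseteq> S" and M: "\<And>w. w \<in> cball z \<rho> \<Longrightarrow> norm (f w) \<le> M"
    and \<rho>: "\<rho> > 0"
  shows "norm (fd f z u) \<le> M * norm u / \<rho>"
proof (cases "u = 0")
  case True
  have "fd f z (0 *s 0) = 0 * fd f z 0"
    using hol_fun_on_fd(2)[OF f(1)] f(2) \<rho> by (meson centre_in_cball less_imp_le subsetD)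
  then show ?thesis using True by simp
next
  case False
  let ?g = "\<lambda>u. f (z + u)"
  have z: "z \<in> S" using f(2) \<rho> by auto
  have g: "hol_fun_on ?g ((+) z -` S)" by (rule hol_fun_on_translate[OF f(1)])
  have sub: "cball 0 \<rho> \<subseteq> (+) z -` S" using f(2) by (auto simp: subset_iff dist_norm)
  have "((\<lambda>u. f (z + u)) has_derivative fd f z) (at 0)"
    using diff_chain_at[of "\<lambda>u. z + u" "\<lambda>u. u" 0 f "fd f z"] hol_fun_on_fd(1)[OF f(1) z]
      has_derivative_add[OF has_derivative_const[of z] has_derivative_ident, of "at 0"]
    by (simp add: o_def)
  then have "hpart ?g 1 u = fd f z u"
    using hpart_1[OF g] z by (simp add: fd_eqI)
  moreover have "norm (hpart ?g 1 u) \<le> M / (\<rho> / norm u) ^ 1"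
    by (rule hpart_bound[OF g sub]) (use M False \<rho> in \<open>auto simp: dist_norm\<close>)
  ultimately show ?thesis by simp
qed

lemma second_order_bound_map:
  fixes f :: "complex^'n \<Rightarrow> complex^'n"
  assumes f: "holomorphic_map_on f S" "cball z \<rho> \<subseteq> S"
    and M: "\<And>w. w \<in> cball z \<rho> \<Longrightarrow> norm (f w) \<le> M"
    and u: "norm u \<le> \<rho> / 2" and \<rho>: "\<rho> > 0"
  shows "norm (f (z + u) - f z - fd f z u) \<le> 2 * M * (norm u / \<rho>)\<^sup>2"
proof (rule norm_le_hinner)
  have M0: "0 \<le> M" using M[of z] \<rho> norm_ge_zero[of "f z"] by (simp, linarith)
  then show "0 \<le> 2 * M * (norm u / \<rho>)\<^sup>2" by simp
  fix w :: "complex^'n" assume w: "norm w = 1"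
  have z: "z \<in> S" using f(2) \<rho> by auto
  have "norm (hinner (f y) w) \<le> M" if "y \<in> cball z \<rho>" for y
    using norm_hinner_le[of "f y" w] M[OF that] w by simp
  from second_order_bound[OF hol_fun_on_hinner(1)[OF f(1)] f(2) this u \<rho>]
  show "norm (hinner (f (z + u) - f z - fd f z u) w) \<le> 2 * M * (norm u / \<rho>)\<^sup>2"
    by (simp add: hinner_diff_left hol_fun_on_hinner(2)[OF f(1) z])
qed

lemma cauchy_fd_bound_map:
  fixes f :: "complex^'n \<Rightarrow> complex^'n"
  assumes f: "holomorphic_map_on f S" "cball z \<rho> \<subseteq> S"
    and M: "\<And>w. w \<in> cball z \<rho> \<Longrightarrow> norm (f w) \<le> M"
    and \<rho>: "\<rho> > 0"
  shows "norm (fd f z u) \<le> M * norm u / \<rho>"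
proof (rule norm_le_hinner)
  have M0: "0 \<le> M" using M[of z] \<rho> norm_ge_zero[of "f z"] by (simp, linarith)
  then show "0 \<le> M * norm u / \<rho>" using \<rho> by simp
  fix w :: "complex^'n" assume w: "norm w = 1"
  have z: "z \<in> S" using f(2) \<rho> by auto
  have "norm (hinner (f y) w) \<le> M" if "y \<in> cball z \<rho>" for y
    using norm_hinner_le[of "f y" w] M[OF that] w by simp
  from cauchy_fd_bound[OF hol_fun_on_hinner(1)[OF f(1)] f(2) this \<rho>]
  show "norm (hinner (fd f z u) w) \<le> M * norm u / \<rho>"
    by (simp add: hol_fun_on_hinner(2)[OF f(1) z])
qed

lemma cball_subset_cball_0:
  fixes z :: "'a::euclidean_space"
  shows "norm z + d \<le> r \<Longrightarrow> cball z d \<subseteq> cball 0 r"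
  by (simp add: cball_subset_cball_iff)

lemma hol_map_on_bounded_cball:
  fixes X :: "complex^'n \<Rightarrow> complex^'n"
  assumes "holomorphic_map_on X S" "cball 0 R \<subseteq> S"
  obtains N where "N > 0" "\<And>w. norm w \<le> R \<Longrightarrow> norm (X w) \<le> N"
proof -
  have "compact (X ` cball 0 R)"
    using hol_map_on_continuous[OF assms(1)] assms(2)
    by (intro compact_continuous_image compact_cball) (rule continuous_on_subset)
  then obtain N where "N > 0" "\<And>w. w \<in> cball 0 R \<Longrightarrow> norm (X w) \<le> N"
    by (metis bounded_pos compact_imp_bounded imageI)
  then show ?thesis using that by simp
qed

text \<open>Around each point of the smaller ball a ball of radius \<open>R' - R\<close> fits into
  the larger one, so Cauchy's estimate bounds the differential; convexity then gives the Lipschitz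
  constant.\<close>

lemma lipschitz_on_smaller_ball:
  fixes f :: "complex^'n \<Rightarrow> complex^'n"
  assumes f: "holomorphic_map_on f S" "cball 0 R' \<subseteq> S"
    and M: "\<And>w. w \<in> cball 0 R' \<Longrightarrow> norm (f w) \<le> M"
    and R: "R < R'" and xy: "x \<in> cball 0 R" "y \<in> cball 0 R"
  shows "norm (f x - f y) \<le> M / (R' - R) * norm (x - y)"
proof (rule differentiable_bound[where S = "cball 0 R" and f' = "fd f"])
  fix z :: "complex^'n" assume z: "z \<in> cball 0 R"
  have zS: "z \<in> S" using z R f(2) by auto
  then show "(f has_derivative fd f z) (at z within cball 0 R)"
    using hol_map_on_fd(1)[OF f(1)] has_derivative_at_withinI by blast
  have sub: "cball z (R' - R) \<subseteq> cball 0 R'"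
    by (rule cball_subset_cball_0) (use z in simp)
  show "onorm (fd f z) \<le> M / (R' - R)"
  proof (rule onorm_bound)
    show "0 \<le> M / (R' - R)"
      using order_trans[OF norm_ge_zero M[of z]] z R by simp
    show "norm (fd f z u) \<le> M / (R' - R) * norm u" for u
      using cauchy_fd_bound_map[OF f(1), of z "R' - R" M u] sub f(2) M R by (simp add: subset_iff)
  qed
qed (use xy in auto)

lemma entire_lipschitz:
  fixes f :: "complex^'n \<Rightarrow> complex^'n"
  assumes "holomorphic_map_on f UNIV"
  obtains L where "L > 0" "\<And>x y. x \<in> cball 0 R \<Longrightarrow> y \<in> cball 0 R \<Longrightarrow> norm (f x - f y) \<le> L * norm (x - y)"
proof -
  obtain M where M: "M > 0" "\<And>w. norm w \<le> R + 1 \<Longrightarrow> norm (f w) \<le> M"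
    using hol_map_on_bounded_cball[OF assms subset_UNIV] by metis
  show ?thesis
  proof (rule that[of M])
    show "norm (f x - f y) \<le> M * norm (x - y)" if "x \<in> cball 0 R" "y \<in> cball 0 R" for x y
      using lipschitz_on_smaller_ball[OF assms, of "R + 1" M R x y] M that by auto
  qed (rule M(1))
qed

lemma hol_fun_on_diff:
  assumes "hol_fun_on f S" "hol_fun_on g S"
  shows "hol_fun_on (\<lambda>z. f z - g z) S"
    and "z \<in> S \<Longrightarrow> fd (\<lambda>z. f z - g z) z u = fd f z u - fd g z u"
proof -
  have "hol_fun_on (\<lambda>z. f z + (\<lambda>_. -1) z * g z) S"
    using assms by (intro hol_fun_on_add hol_fun_on_mult hol_fun_on_const) (auto dest: hol_fun_on_open)
  then show "hol_fun_on (\<lambda>z. f z - g z) S" by simp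
  assume "z \<in> S"
  then show "fd (\<lambda>z. f z - g z) z u = fd f z u - fd g z u"
    by (subst fd_eqI[OF has_derivative_diff]) (use assms hol_fun_on_fd in auto)
qed

text \<open>Cauchy's estimate for the differences \<open>f m - f n\<close> makes the differentials a
  Cauchy sequence. Their limit is complex linear, and it is the differential of \<open>g\<close>
  because the second-order bound holds for all large \<open>n\<close> with one constant.\<close>

lemma weierstrass_hol_fun:
  assumes S: "open S" and f: "\<And>n. hol_fun_on (f n) S"
    and lim: "\<And>z. z \<in> S \<Longrightarrow> \<exists>\<rho>>0. cball z \<rho> \<subseteq> S \<and> uniform_limit (cball z \<rho>) f g sequentially"
  shows "hol_fun_on g S"
    and "z \<in> S \<Longrightarrow> (\<lambda>n. fd (f n) z u) \<longlonglongrightarrow> fd g z u"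
proof -
  have *: "\<exists>D. (\<forall>c v. D (c *s v) = c * D v) \<and> (g has_derivative D) (at z) \<and>
      (\<forall>u. (\<lambda>n. fd (f n) z u) \<longlonglongrightarrow> D u)" if z: "z \<in> S" for z
  proof -
    obtain \<rho> where \<rho>: "\<rho> > 0" "cball z \<rho> \<subseteq> S" "uniform_limit (cball z \<rho>) f g sequentially"
      using lim[OF z] by blast
    have "continuous_on (cball z \<rho>) g"
    proof (rule uniform_limit_theorem[OF _ \<rho>(3)])
      show "\<forall>\<^sub>F n in sequentially. continuous_on (cball z \<rho>) (f n)"
        by (rule always_eventually) (use continuous_on_subset[OF hol_fun_on_continuous[OF f] \<rho>(2)] in blast)
    qed simp
    then have "compact (g ` cball z \<rho>)" by (intro compact_continuous_image) auto
    then obtain M where M: "\<And>w. w \<in> cball z \<rho> \<Longrightarrow> norm (g w) \<le> M"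
      by (metis bounded_pos compact_imp_bounded imageI)
    have close: "\<exists>N. \<forall>n\<ge>N. \<forall>w\<in>cball z \<rho>. norm (f n w - g w) < e" if "e > 0" for e
      using uniform_limitD[OF \<rho>(3) that] by (simp add: eventually_sequentially dist_norm)
    obtain N1 where N1: "\<And>n w. n \<ge> N1 \<Longrightarrow> w \<in> cball z \<rho> \<Longrightarrow> norm (f n w - g w) < 1"
      using close[OF zero_less_one] by blast
    have fM: "norm (f n w) \<le> M + 1" if "n \<ge> N1" "w \<in> cball z \<rho>" for n w
      using N1[OF that] M[OF that(2)] norm_triangle_sub[of "f n w" "g w"] by linarith
    have "Cauchy (\<lambda>n. fd (f n) z u)" for u
    proof (rule CauchyI)
      fix e :: real assume e: "e > 0"
      \<comment> \<open>Functions that are \<open>2 * e'\<close> apart have differentials at most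
        \<open>2 * e' * norm u / \<rho>\<close> apart; the summand 1 covers
        \<open>u = 0\<close>.\<close>
      define e' where "e' = e * \<rho> / (2 * (norm u + 1))"
      have e': "e' > 0" using e \<rho> by (simp add: e'_def add_nonneg_pos)
      obtain N where N: "\<And>n w. n \<ge> N \<Longrightarrow> w \<in> cball z \<rho> \<Longrightarrow> norm (f n w - g w) < e'"
        using close[OF e'] by blast
      have "norm (fd (f m) z u - fd (f n) z u) < e" if "m \<ge> N" "n \<ge> N" for m n
      proof -
        have "norm (f m w - f n w) \<le> 2 * e'" if "w \<in> cball z \<rho>" for w
          using N[OF \<open>m \<ge> N\<close> that] N[OF \<open>n \<ge> N\<close> that] norm_triangle_ineq4[of "f m w - g w" "f n w - g w"] by simp
        from cauchy_fd_bound[OF hol_fun_on_diff(1)[OF f f] \<rho>(2) this \<rho>(1), of u]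
        have "norm (fd (f m) z u - fd (f n) z u) \<le> 2 * e' * norm u / \<rho>"
          by (simp add: hol_fun_on_diff(2)[OF f f z])
        also have "\<dots> = e * (norm u / (norm u + 1))"
          using \<rho> norm_ge_zero[of u] by (simp add: e'_def divide_simps)
        also have "\<dots> < e * 1"
          using e add_nonneg_pos[OF norm_ge_zero[of u] zero_less_one]
          by (intro mult_strict_left_mono) (auto simp: pos_divide_less_eq)
        finally show ?thesis by simp
      qed
      then show "\<exists>N. \<forall>m\<ge>N. \<forall>n\<ge>N. norm (fd (f m) z u - fd (f n) z u) < e" by blast
    qed
    then have "\<exists>l. (\<lambda>n. fd (f n) z u) \<longlonglongrightarrow> l" for u
      using Cauchy_convergent convergent_def by blast
    then obtain D where D: "\<And>u. (\<lambda>n. fd (f n) z u) \<longlonglongrightarrow> D u" by metis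
    have lin: "linear (fd (f n) z)" for n
      using hol_fun_on_fd(1)[OF f z] has_derivative_linear by blast
    have hom: "D (c *s v) = c * D v" for c v
    proof (rule LIMSEQ_unique[OF D])
      show "(\<lambda>n. fd (f n) z (c *s v)) \<longlonglongrightarrow> c * D v"
        using tendsto_mult_left[OF D[of v], of c] by (simp add: hol_fun_on_fd(2)[OF f z])
    qed
    have add: "D (u + v) = D u + D v" for u v
    proof (rule LIMSEQ_unique[OF D])
      show "(\<lambda>n. fd (f n) z (u + v)) \<longlonglongrightarrow> D u + D v"
        using tendsto_add[OF D[of u] D[of v]] by (simp add: linear_add[OF lin])
    qed
    have bd: "norm (D u) \<le> (M + 1) * norm u / \<rho>" for u
    proof (rule LIMSEQ_le_const2[OF tendsto_norm[OF D]])
      show "\<exists>N. \<forall>n\<ge>N. norm (fd (f n) z u) \<le> (M + 1) * norm u / \<rho>"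
        using cauchy_fd_bound[OF f \<rho>(2) fM \<rho>(1)] by blast
    qed
    have "bounded_linear D"
      by (rule bounded_linear_intro[where K = "(M + 1) / \<rho>"])
         (use add hom bd in \<open>auto simp: scaleR_eq_smult scaleR_conv_of_real mult_ac\<close>)
    moreover have "norm (g (z + u) - g z - D u) \<le> (2 * (M + 1) / \<rho>\<^sup>2) * (norm u)\<^sup>2"
      if u: "norm u < \<rho> / 2" for u
    proof -
      have gl: "(\<lambda>n. f n w) \<longlonglongrightarrow> g w" if "w \<in> cball z \<rho>" for w
        using tendsto_uniform_limitI[OF \<rho>(3) that] .
      have "z + u \<in> cball z \<rho>" "z \<in> cball z \<rho>" using u \<rho> by (auto simp: dist_norm)
      then have "(\<lambda>n. norm (f n (z + u) - f n z - fd (f n) z u)) \<longlonglongrightarrow> norm (g (z + u) - g z - D u)"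
        by (intro tendsto_intros gl D)
      moreover have "norm (f n (z + u) - f n z - fd (f n) z u) \<le> 2 * (M + 1) * (norm u / \<rho>)\<^sup>2" if "n \<ge> N1" for n
        using second_order_bound[OF f \<rho>(2) fM[OF that] _ \<rho>(1)] u by simp
      ultimately have "norm (g (z + u) - g z - D u) \<le> 2 * (M + 1) * (norm u / \<rho>)\<^sup>2"
        by (intro LIMSEQ_le_const2) blast+
      then show ?thesis by (simp add: power_divide)
    qed
    ultimately have "(g has_derivative D) (at z)"
      using \<rho>(1) by (intro has_derivative_quadratic_remainder[of D "\<rho> / 2" g z "2 * (M + 1) / \<rho>\<^sup>2"]) auto
    with hom D show ?thesis by blast
  qed
  then show "hol_fun_on g S" unfolding hol_fun_on_def using S by blast
  show "z \<in> S \<Longrightarrow> (\<lambda>n. fd (f n) z u) \<longlonglongrightarrow> fd g z u"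
    using * fd_eqI by metis
qed

lemma local_uniform_limit_ball:
  fixes F :: "nat \<Rightarrow> 'a::euclidean_space \<Rightarrow> 'b::metric_space"
  assumes lim: "\<And>r. r < 1 \<Longrightarrow> uniform_limit (cball 0 r) F f sequentially" and z: "z \<in> ball 0 1"
  shows "\<exists>\<rho>>0. cball z \<rho> \<subseteq> ball 0 1 \<and> uniform_limit (cball z \<rho>) F f sequentially"
proof -
  define r where "r = (1 + norm z) / 2"
  have r: "r < 1" "norm z < r" using z by (auto simp: r_def)
  have cb: "cball z (r - norm z) \<subseteq> cball 0 r" by (rule cball_subset_cball_0) simp
  then have "cball z (r - norm z) \<subseteq> ball 0 1" using r by fastforce
  then show ?thesis
    using r uniform_limit_on_subset[OF lim[OF r(1)] cb] by (intro exI[of _ "r - norm z"]) simp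
qed

lemma hol_map_on_fd_nth:
  assumes "holomorphic_map_on f S" "z \<in> S"
  shows "fd (\<lambda>z. f z $ i) z u = fd f z u $ i"
  by (subst fd_eqI[OF bounded_linear.has_derivative[OF bounded_linear_vec_nth hol_map_on_fd(1)[OF assms]]]) simp

lemma weierstrass_hol_map:
  fixes f :: "nat \<Rightarrow> complex^'n \<Rightarrow> complex^'n"
  assumes S: "open S" and f: "\<And>n. holomorphic_map_on (f n) S"
    and lim: "\<And>z. z \<in> S \<Longrightarrow> \<exists>\<rho>>0. cball z \<rho> \<subseteq> S \<and> uniform_limit (cball z \<rho>) f g sequentially"
  shows "holomorphic_map_on g S"
    and "z \<in> S \<Longrightarrow> (\<lambda>n. fd (f n) z u) \<longlonglongrightarrow> fd g z u"
proof -
  have fi: "hol_fun_on (\<lambda>z. f n z $ i) S" for n i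
    using f hol_map_on_componentwise by blast
  have limi: "\<exists>\<rho>>0. cball z \<rho> \<subseteq> S \<and> uniform_limit (cball z \<rho>) (\<lambda>n z. f n z $ i) (\<lambda>z. g z $ i) sequentially"
    if "z \<in> S" for z i
    using lim[OF that] bounded_linear.uniform_limit[OF bounded_linear_vec_nth[of i]] by fast
  show g: "holomorphic_map_on g S"
    using weierstrass_hol_fun(1)[OF S fi limi] S hol_map_on_componentwise by blast
  show "z \<in> S \<Longrightarrow> (\<lambda>n. fd (f n) z u) \<longlonglongrightarrow> fd g z u"
    using weierstrass_hol_fun(2)[OF S fi limi]
    by (intro vec_tendstoI) (simp add: hol_map_on_fd_nth[OF f] hol_map_on_fd_nth[OF g])
qed

lemma hol_fun_on_local:
  assumes "open S" "\<And>z. z \<in> S \<Longrightarrow> \<exists>\<rho>>0. ball z \<rho> \<subseteq> S \<and> hol_fun_on f (ball z \<rho>)"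
  shows "hol_fun_on f S"
  unfolding hol_fun_on_def
proof (intro conjI ballI assms(1))
  fix z assume "z \<in> S"
  then obtain \<rho> where "\<rho> > 0" "hol_fun_on f (ball z \<rho>)" using assms(2) by blast
  then show "\<exists>D. (\<forall>c v. D (c *s v) = c * D v) \<and> (f has_derivative D) (at z)"
    unfolding hol_fun_on_def by (meson centre_in_ball)
qed

text \<open>The difference quotients are holomorphic and, by the second-order bound, converge with a
  rate that is uniform near each point, so the Weierstrass theorem applies.\<close>

lemma hol_fun_on_directional_derivative:
  assumes f: "hol_fun_on f S"
  shows "hol_fun_on (\<lambda>z. fd f z u) S"
proof (rule hol_fun_on_local)
  show S: "open S" using f by (rule hol_fun_on_open)
  fix z0 assume "z0 \<in> S"
  then obtain e where e: "e > 0" "cball z0 e \<subseteq> S" using S open_contains_cball by blast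
  \<comment> \<open>A third of the radius: balls of radius \<open>\<rho>\<close> about points of
    \<open>ball z0 (2 * \<rho>)\<close> stay where \<open>f\<close> is bounded by
    \<open>M\<close>.\<close>
  define \<rho> where "\<rho> = e / 3"
  have \<rho>: "\<rho> > 0" "cball z0 (3 * \<rho>) \<subseteq> S" using e by (auto simp: \<rho>_def)
  have "compact (f ` cball z0 (3 * \<rho>))"
    using hol_fun_on_continuous[OF f] \<rho>(2) by (intro compact_continuous_image compact_cball) (rule continuous_on_subset)
  then obtain M where M: "M > 0" "\<And>w. w \<in> cball z0 (3 * \<rho>) \<Longrightarrow> norm (f w) \<le> M"
    by (metis bounded_pos compact_imp_bounded imageI)
  define \<delta> where "\<delta> = \<rho> / (2 * (norm u + 1))"
  have \<delta>: "\<delta> > 0" "\<delta> * norm u \<le> \<rho> / 2"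
  proof -
    have *: "norm u + 1 > 0" using norm_ge_zero[of u] by linarith
    with \<rho>(1) show "\<delta> > 0" by (simp add: \<delta>_def)
    have "\<rho> * norm u \<le> \<rho> * (norm u + 1)" using \<rho>(1) by simp
    with * show "\<delta> * norm u \<le> \<rho> / 2" by (simp add: \<delta>_def field_simps)
  qed
  define h where "h n = complex_of_real (\<delta> / real (Suc n))" for n
  have hn: "norm (h n) = \<delta> / real (Suc n)" for n using \<delta> by (simp add: h_def norm_divide del: of_nat_Suc)
  have h0: "h n \<noteq> 0" for n using \<delta> by (simp add: h_def del: of_nat_Suc)
  have hu: "norm (h n *s u) \<le> \<rho> / 2" for n
  proof -
    have "\<delta> / real (Suc n) * norm u \<le> \<delta> * norm u"
      using \<delta> by (intro mult_right_mono) (auto simp: field_simps)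
    then have "\<delta> / real (Suc n) * norm u \<le> \<rho> / 2" using \<delta>(2) by linarith
    then show ?thesis by (simp only: norm_smult hn)
  qed
  have sub: "cball z \<rho> \<subseteq> cball z0 (3 * \<rho>)" if "z \<in> ball z0 (2 * \<rho>)" for z
    using that by (auto simp: dist_norm) (smt (verit, best) dist_norm dist_triangle)
  define F where "F n z = (f (z + h n *s u) - f z) * inverse (h n)" for n z
  have F: "hol_fun_on (F n) (ball z0 (2 * \<rho>))" for n
    unfolding F_def
  proof (intro hol_fun_on_mult hol_fun_on_diff(1) hol_fun_on_const hol_fun_on_compose[OF f]
      hol_map_on_add hol_map_on_id hol_map_on_const)
    have "z + h n *s u \<in> S" if "z \<in> ball z0 (2 * \<rho>)" for z
      using sub[OF that] hu[of n] \<rho> by (auto simp: dist_norm subset_iff)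
    then show "(\<lambda>z. z + h n *s u) ` ball z0 (2 * \<rho>) \<subseteq> S" by auto
    have "ball z0 (2 * \<rho>) \<subseteq> S" using \<rho> by (auto simp: subset_iff)
    then show "(\<lambda>z. z) ` ball z0 (2 * \<rho>) \<subseteq> S" by simp
  qed auto
  have err: "norm (F n z - fd f z u) \<le> 2 * M * (norm u / \<rho>)\<^sup>2 * (\<delta> / real (Suc n))" if z: "z \<in> ball z0 (2 * \<rho>)" for n z
  proof -
    have zS: "z \<in> S" using sub[OF z] \<rho> by (auto simp: subset_iff)
    have "norm (f (z + h n *s u) - f z - fd f z (h n *s u)) \<le> 2 * M * (norm (h n *s u) / \<rho>)\<^sup>2"
      using sub[OF z] \<rho> M hu by (intro second_order_bound[OF f]) (auto simp: subset_iff)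
    then have "norm (f (z + h n *s u) - f z - h n * fd f z u) \<le> (2 * M * (norm u / \<rho>)\<^sup>2 * norm (h n)) * norm (h n)"
      by (simp add: hol_fun_on_fd(2)[OF f zS] power2_eq_square mult_ac)
    moreover have "f (z + h n *s u) - f z - h n * fd f z u = h n * (F n z - fd f z u)"
      using h0[of n] by (simp add: F_def field_simps)
    ultimately have "norm (h n) * norm (F n z - fd f z u) \<le> norm (h n) * (2 * M * (norm u / \<rho>)\<^sup>2 * norm (h n))"
      by (simp add: norm_mult mult.commute)
    then have "norm (F n z - fd f z u) \<le> 2 * M * (norm u / \<rho>)\<^sup>2 * norm (h n)"
      using h0[of n] by simp
    then show ?thesis by (simp only: hn)
  qed
  have ul: "uniform_limit (ball z0 (2 * \<rho>)) F (\<lambda>z. fd f z u) sequentially"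
  proof (rule uniform_limitI)
    fix e :: real assume e: "e > 0"
    have "(\<lambda>n. 2 * M * (norm u / \<rho>)\<^sup>2 * (\<delta> / real (Suc n))) \<longlonglongrightarrow> 2 * M * (norm u / \<rho>)\<^sup>2 * 0"
      by (intro tendsto_mult tendsto_const LIMSEQ_Suc lim_const_over_n)
    then have "\<forall>\<^sub>F n in sequentially. 2 * M * (norm u / \<rho>)\<^sup>2 * (\<delta> / real (Suc n)) < e"
      by (rule order_tendstoD(2)) (use e in simp)
    then show "\<forall>\<^sub>F n in sequentially. \<forall>x\<in>ball z0 (2 * \<rho>). dist (F n x) (fd f x u) < e"
      by (rule eventually_mono) (use err in \<open>fastforce simp: dist_norm intro: le_less_trans\<close>)
  qed
  have "hol_fun_on (\<lambda>z. fd f z u) (ball z0 (2 * \<rho>))"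
  proof (rule weierstrass_hol_fun(1)[OF _ F])
    fix z assume "z \<in> ball z0 (2 * \<rho>)"
    then obtain r where "r > 0" "cball z r \<subseteq> ball z0 (2 * \<rho>)"
      using open_contains_cball open_ball by blast
    then show "\<exists>\<rho>'>0. cball z \<rho>' \<subseteq> ball z0 (2 * \<rho>) \<and> uniform_limit (cball z \<rho>') F (\<lambda>z. fd f z u) sequentially"
      using uniform_limit_on_subset[OF ul] by blast
  qed auto
  then show "\<exists>\<rho>>0. ball z0 \<rho> \<subseteq> S \<and> hol_fun_on (\<lambda>z. fd f z u) (ball z0 \<rho>)"
    using \<rho> by (intro exI[of _ "2 * \<rho>"]) (auto simp: subset_iff)
qed

text \<open>The constructor imitates Euler's identity, which expresses a homogeneous polynomial
  through its partial derivatives; this is the form in which Taylor parts arise.\<close>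

inductive hom_poly :: "nat \<Rightarrow> (complex^'n \<Rightarrow> complex) \<Rightarrow> bool" where
  hom_poly_const: "hom_poly 0 (\<lambda>_. c)"
| hom_poly_step: "(\<And>j. hom_poly k (q j)) \<Longrightarrow> hom_poly (Suc k) (\<lambda>z. \<Sum>j\<in>UNIV. z $ j * q j z)"

lemma hom_poly_cmult: "hom_poly k p \<Longrightarrow> hom_poly k (\<lambda>z. c * p z)"
proof (induction rule: hom_poly.induct)
  case (hom_poly_const d)
  show ?case by (rule hom_poly.hom_poly_const)
next
  case (hom_poly_step k q)
  have "hom_poly (Suc k) (\<lambda>z. \<Sum>j\<in>UNIV. z $ j * (c * q j z))"
    by (intro hom_poly.hom_poly_step hom_poly_step)
  then show ?case by (simp add: sum_distrib_left mult_ac)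
qed

lemma higher_deriv_sum_cmult:
  assumes "finite J" "open T" "x \<in> T" "\<And>j. j \<in> J \<Longrightarrow> f j holomorphic_on T"
  shows "(deriv ^^ k) (\<lambda>x. \<Sum>j\<in>J. c j * f j x) x = (\<Sum>j\<in>J. c j * (deriv ^^ k) (f j) x)"
  using assms
proof (induction J rule: finite_induct)
  case (insert i J)
  have "(deriv ^^ k) (\<lambda>x. c i * f i x + (\<Sum>j\<in>J. c j * f j x)) x =
      (deriv ^^ k) (\<lambda>x. c i * f i x) x + (deriv ^^ k) (\<lambda>x. \<Sum>j\<in>J. c j * f j x) x"
    using insert.prems by (intro higher_deriv_add[where S = T] holomorphic_intros) auto
  then show ?case
    using insert higher_deriv_cmult[of "f i" T x k "c i"] by simp
qed simp

text \<open>The slice has derivative \<open>\<Sum>j. u $ j * (partial derivative j)\<close> along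
  the line. The factors \<open>u $ j\<close> are constant there, so \<open>k\<close> further
  derivatives pass to the partial derivatives, and \<open>fact (Suc k)\<close> against
  \<open>fact k\<close> leaves the denominator.\<close>

lemma hpart_Suc:
  assumes f: "hol_fun_on f S" "0 \<in> S"
  shows "hpart f (Suc k) u = (\<Sum>j\<in>UNIV. u $ j * hpart (\<lambda>z. fd f z (axis j 1)) k u) / of_nat (Suc k)"
proof -
  define T where "T = (\<lambda>\<zeta>. \<zeta> *s u) -` S"
  have T: "open T" "0 \<in> T"
    unfolding T_def using hol_fun_on_open[OF f(1)] f(2)
      linear_continuous_on[OF bounded_linear_smult_left, of UNIV u]
    by (auto intro!: open_vimage)
  have part: "hol_fun_on (\<lambda>z. fd f z (axis j 1)) S" for j
    by (rule hol_fun_on_directional_derivative[OF f(1)])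
  have hol: "(\<lambda>\<zeta>. fd f (\<zeta> *s u) (axis j 1)) holomorphic_on T" for j
    using slice_holomorphic[OF part, of T 0 u j] by (simp add: T_def)
  have d: "deriv (\<lambda>\<zeta>. f (\<zeta> *s u)) \<zeta> = (\<Sum>j\<in>UNIV. u $ j * fd f (\<zeta> *s u) (axis j 1))" if "\<zeta> \<in> T" for \<zeta>
  proof -
    have m: "\<zeta> *s u \<in> S" using that by (simp add: T_def)
    have "deriv (\<lambda>\<zeta>. f (\<zeta> *s u)) \<zeta> = fd f (\<zeta> *s u) u"
      using DERIV_imp_deriv[OF slice_has_field_derivative[OF f(1), of 0 \<zeta> u]] m by simp
    also have "\<dots> = fd f (\<zeta> *s u) (\<Sum>j\<in>UNIV. u $ j *s axis j 1)"
      using vec_eq_sum_axis[of u] by simp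
    also have "\<dots> = (\<Sum>j\<in>UNIV. fd f (\<zeta> *s u) (u $ j *s axis j 1))"
      by (rule linear_sum) (use hol_fun_on_fd(1)[OF f(1) m] has_derivative_linear in blast)
    finally show ?thesis by (simp add: hol_fun_on_fd(2)[OF f(1) m])
  qed
  have "(deriv ^^ Suc k) (\<lambda>\<zeta>. f (\<zeta> *s u)) 0 = (deriv ^^ k) (deriv (\<lambda>\<zeta>. f (\<zeta> *s u))) 0"
    by (simp add: funpow_Suc_right del: funpow.simps)
  also have "\<dots> = (deriv ^^ k) (\<lambda>\<zeta>. \<Sum>j\<in>UNIV. u $ j * fd f (\<zeta> *s u) (axis j 1)) 0"
  proof (rule higher_deriv_transform_within_open[OF _ _ T])
    show "deriv (\<lambda>\<zeta>. f (\<zeta> *s u)) holomorphic_on T"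
      using slice_holomorphic[OF f(1), of T 0 u] T by (intro holomorphic_deriv) (auto simp: T_def)
    show "(\<lambda>\<zeta>. \<Sum>j\<in>UNIV. u $ j * fd f (\<zeta> *s u) (axis j 1)) holomorphic_on T"
      by (intro holomorphic_intros hol)
  qed (rule d)
  also have "\<dots> = (\<Sum>j\<in>UNIV. u $ j * (deriv ^^ k) (\<lambda>\<zeta>. fd f (\<zeta> *s u) (axis j 1)) 0)"
    by (rule higher_deriv_sum_cmult[OF _ T hol]) auto
  finally show ?thesis
    by (simp add: hpart_def sum_divide_distrib field_simps)
qed

text \<open>The induction runs over all \<open>f\<close> at once, because \<open>hpart_Suc\<close>
  passes to partial derivatives.\<close>

lemma hom_poly_hpart:
  assumes "hol_fun_on f S" "0 \<in> S"
  shows "hom_poly k (hpart f k)"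
  using assms
proof (induction k arbitrary: f)
  case 0
  have "hpart f 0 = (\<lambda>_. f 0)" by (simp add: hpart_0 fun_eq_iff)
  then show ?case by (metis hom_poly_const)
next
  case (Suc k)
  have "hom_poly (Suc k) (\<lambda>u. \<Sum>j\<in>UNIV. u $ j * (inverse (of_nat (Suc k)) * hpart (\<lambda>z. fd f z (axis j 1)) k u))"
    by (intro hom_poly_step hom_poly_cmult Suc.IH hol_fun_on_directional_derivative Suc.prems)
  moreover have "hpart f (Suc k) = (\<lambda>u. \<Sum>j\<in>UNIV. u $ j * (inverse (of_nat (Suc k)) * hpart (\<lambda>z. fd f z (axis j 1)) k u))"
    unfolding fun_eq_iff hpart_Suc[OF Suc.prems] by (simp add: divide_inverse sum_distrib_left mult_ac)
  ultimately show ?case by simp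
qed

subsection \<open>Schwarz lemma, operator exponential and automorphisms\<close>

text \<open>For positive real part the quotient \<open>(q - q 0) / (q + cnj (q 0))\<close> maps the
  disc into itself and fixes 0, so the Schwarz lemma bounds it by \<open>norm \<zeta>\<close>;
  solving for the real part gives the claim. Adding a small positive constant to \<open>p\<close>
  reduces the general case to this one.\<close>

lemma harnack_lower_bound:
  assumes p: "p holomorphic_on ball 0 1" and pos: "\<And>\<zeta>. norm \<zeta> < 1 \<Longrightarrow> 0 \<le> Re (p \<zeta>)"
    and \<zeta>: "norm \<zeta> < 1"
  shows "Re (p 0) * ((1 - norm \<zeta>) / (1 + norm \<zeta>)) \<le> Re (p \<zeta>)"
proof -
  have strict: "Re (q 0) * ((1 - norm \<zeta>) / (1 + norm \<zeta>)) \<le> Re (q \<zeta>)"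
    if q: "q holomorphic_on ball 0 1" and qpos: "\<And>\<zeta>. norm \<zeta> < 1 \<Longrightarrow> 0 < Re (q \<zeta>)" for q
  proof -
    define a where "a = q 0"
    have a: "Re a > 0" using qpos[of 0] by (simp add: a_def)
    define \<phi> where "\<phi> z = (q z - a) / (q z + cnj a)" for z
    have nz: "q z + cnj a \<noteq> 0" if "norm z < 1" for z
      using qpos[OF that] a by (metis add_pos_pos cnj.simps(1) less_irrefl plus_complex.simps(1) zero_complex.simps(1))
    \<comment> \<open>The right-hand side is positive on the right half-plane, so the quotient
      \<open>\<phi>\<close> has modulus below 1.\<close>
    have diff: "(norm (w + cnj a))\<^sup>2 - (norm (w - a))\<^sup>2 = 4 * Re w * Re a" for w
      unfolding cmod_power2 by (simp add: power2_eq_square algebra_simps)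
    have "norm (\<phi> \<zeta>) \<le> norm \<zeta>"
    proof (rule Schwarz_Lemma(1))
      show "\<phi> holomorphic_on ball 0 1"
        unfolding \<phi>_def using nz by (intro holomorphic_intros q) auto
      show "\<phi> 0 = 0" by (simp add: \<phi>_def a_def)
      show "norm (\<phi> z) < 1" if z: "norm z < 1" for z
      proof -
        have "(norm (q z - a))\<^sup>2 < (norm (q z + cnj a))\<^sup>2"
          using diff[of "q z"] mult_pos_pos[OF qpos[OF z] a] by linarith
        then have "norm (q z - a) < norm (q z + cnj a)" by (rule power_less_imp_less_base) simp
        then show ?thesis using nz[OF z] by (simp add: \<phi>_def norm_divide)
      qed
    qed (rule \<zeta>)
    then have "norm (q \<zeta> - a) \<le> norm \<zeta> * norm (q \<zeta> + cnj a)"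
      using nz[OF \<zeta>] by (simp add: \<phi>_def norm_divide field_simps)
    then have "(norm (q \<zeta> - a))\<^sup>2 \<le> (norm \<zeta> * norm (q \<zeta> + cnj a))\<^sup>2"
      by (intro power_mono) auto
    then have "(Re (q \<zeta>) - Re a)\<^sup>2 + (Im (q \<zeta>) - Im a)\<^sup>2
        \<le> (norm \<zeta>)\<^sup>2 * ((Re (q \<zeta>) + Re a)\<^sup>2 + (Im (q \<zeta>) - Im a)\<^sup>2)"
      by (simp add: cmod_power2 power_mult_distrib)
    \<comment> \<open>Both sides of the previous inequality contain the same imaginary term, so it
      cancels in the right direction and only real parts remain.\<close>
    moreover have "(norm \<zeta>)\<^sup>2 * (Im (q \<zeta>) - Im a)\<^sup>2 \<le> 1 * (Im (q \<zeta>) - Im a)\<^sup>2"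
      using \<zeta> by (intro mult_right_mono) (auto simp: power_le_one)
    ultimately have "(Re a - Re (q \<zeta>))\<^sup>2 \<le> (norm \<zeta>)\<^sup>2 * (Re (q \<zeta>) + Re a)\<^sup>2"
      by (simp add: distrib_left power2_commute)
    then have "(Re a - Re (q \<zeta>))\<^sup>2 \<le> (norm \<zeta> * (Re (q \<zeta>) + Re a))\<^sup>2"
      by (simp only: power_mult_distrib)
    then have "Re a - Re (q \<zeta>) \<le> norm \<zeta> * (Re (q \<zeta>) + Re a)"
      by (rule power2_le_imp_le) (use qpos[OF \<zeta>] a in simp)
    then have "Re a * (1 - norm \<zeta>) \<le> Re (q \<zeta>) * (1 + norm \<zeta>)"
      by (simp add: algebra_simps)
    then show ?thesis by (simp add: a_def pos_divide_le_eq add_pos_nonneg)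
  qed
  show ?thesis
  proof (rule field_le_epsilon)
    fix e :: real assume e: "e > 0"
    have k: "0 \<le> (1 - norm \<zeta>) / (1 + norm \<zeta>)" using \<zeta> by (simp add: add_pos_nonneg)
    have "Re (p 0 + of_real e) * ((1 - norm \<zeta>) / (1 + norm \<zeta>)) \<le> Re (p \<zeta> + of_real e)"
    proof (rule strict)
      show "(\<lambda>z. p z + of_real e) holomorphic_on ball 0 1" by (intro holomorphic_intros p)
      show "norm z < 1 \<Longrightarrow> 0 < Re (p z + of_real e)" for z using pos[of z] e by simp
    qed
    moreover have "Re (p 0) * ((1 - norm \<zeta>) / (1 + norm \<zeta>)) \<le> Re (p 0 + of_real e) * ((1 - norm \<zeta>) / (1 + norm \<zeta>))"
      using e k by (intro mult_right_mono) auto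
    ultimately show "Re (p 0) * ((1 - norm \<zeta>) / (1 + norm \<zeta>)) \<le> Re (p \<zeta>) + e" by simp
  qed
qed

text \<open>The one-variable Schwarz lemma on the complex line through \<open>z\<close>, applied to
  the pairing of \<open>v\<close> with each unit vector.\<close>

lemma schwarz_map:
  fixes v :: "complex^'n \<Rightarrow> complex^'n"
  assumes v: "holomorphic_map_on v (ball 0 1)" "v ` ball 0 1 \<subseteq> ball 0 1" "v 0 = 0"
    and z: "norm z < 1"
  shows "norm (v z) \<le> norm z"
proof (cases "z = 0")
  case False
  define u where "u = complex_of_real (1 / norm z) *s z"
  have u: "norm u = 1" "complex_of_real (norm z) *s u = z"
    using False by (auto simp: u_def norm_divide vec_eq_iff)
  show ?thesis
  proof (rule norm_le_hinner)
    fix w :: "complex^'n" assume w: "norm w = 1"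
    let ?q = "\<lambda>\<zeta>. hinner (v (0 + \<zeta> *s u)) w"
    have "norm (?q (complex_of_real (norm z))) \<le> norm (complex_of_real (norm z))"
    proof (rule Schwarz_Lemma(1))
      show "?q holomorphic_on ball 0 1"
        by (rule slice_holomorphic[OF hol_fun_on_hinner(1)[OF v(1)]]) (use u in auto)
      show "norm (?q \<zeta>) < 1" if "norm \<zeta> < 1" for \<zeta>
      proof -
        have "norm (?q \<zeta>) \<le> norm (v (0 + \<zeta> *s u)) * norm w" by (rule norm_hinner_le)
        moreover have "v (0 + \<zeta> *s u) \<in> ball 0 1"
          by (rule subsetD[OF v(2)], rule imageI) (use that u in auto)
        ultimately show ?thesis using w by simp
      qed
    qed (use v z in \<open>auto simp: hinner_def\<close>)
    then show "norm (hinner (v z) w) \<le> norm z" by (simp add: u)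
  qed simp
qed (use v in simp)

text \<open>On the line through \<open>z\<close> with unit direction \<open>u\<close>, the function
  \<open>p = 1 - q / \<zeta>\<close> with \<open>q\<close> the pairing of \<open>v\<close> and
  \<open>u\<close> has nonnegative real part by the Schwarz lemma. Harnack between 0 and
  \<open>norm z\<close> compares the displacement of \<open>v\<close> with that of its linear part;
  for the semigroup, division by \<open>t\<close> will turn this into a comparison of
  generators.\<close>

lemma harnack_map:
  fixes v :: "complex^'n \<Rightarrow> complex^'n"
  assumes v: "holomorphic_map_on v (ball 0 1)" "v ` ball 0 1 \<subseteq> ball 0 1" "v 0 = 0"
    and z: "norm z < 1"
  shows "((norm z)\<^sup>2 - fd v 0 z \<bullet> z) * ((1 - norm z) / (1 + norm z)) \<le> (norm z)\<^sup>2 - v z \<bullet> z"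
proof (cases "z = 0")
  case False
  define u where "u = complex_of_real (1 / norm z) *s z"
  have u: "norm u = 1" "complex_of_real (norm z) *s u = z"
    using False by (auto simp: u_def norm_divide vec_eq_iff)
  have uR: "u = (1 / norm z) *\<^sub>R z" unfolding scaleR_eq_smult by (simp add: u_def)
  let ?q = "\<lambda>\<zeta>. hinner (v (0 + \<zeta> *s u)) u"
  have hol: "?q holomorphic_on ball 0 1"
    by (rule slice_holomorphic[OF hol_fun_on_hinner(1)[OF v(1)]]) (use u in auto)
  have lt1: "norm (?q \<zeta>) < 1" if "norm \<zeta> < 1" for \<zeta>
  proof -
    have "norm (?q \<zeta>) \<le> norm (v (0 + \<zeta> *s u)) * norm u" by (rule norm_hinner_le)
    moreover have "v (0 + \<zeta> *s u) \<in> ball 0 1"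
          by (rule subsetD[OF v(2)], rule imageI) (use that u in auto)
    ultimately show ?thesis using u by simp
  qed
  have q0: "?q 0 = 0" using v by (simp add: hinner_def)
  have schwarz: "norm (?q \<zeta>) \<le> norm \<zeta>" "norm (deriv ?q 0) \<le> 1" if "norm \<zeta> < 1" for \<zeta>
    using Schwarz_Lemma(1,2)[OF hol q0 lt1 that] by auto
  \<comment> \<open>The singularity of the quotient at 0 is removed by the value
    \<open>deriv ?q 0\<close>, which is the pairing of \<open>fd v 0 u\<close> with
    \<open>u\<close>.\<close>
  define p where "p \<zeta> = 1 - (if \<zeta> = 0 then deriv ?q 0 else (?q \<zeta> - ?q 0) / (\<zeta> - 0))" for \<zeta>
  have "deriv ?q 0 = hinner (fd v 0 u) u"
    using DERIV_imp_deriv[OF slice_has_field_derivative[OF hol_fun_on_hinner(1)[OF v(1)], of 0 0 u u]]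
      hol_fun_on_hinner(2)[OF v(1), of 0 u u] by simp
  then have p0: "Re (p 0) = 1 - fd v 0 u \<bullet> u"
    by (simp add: p_def Re_hinner)
  have "Re (p 0) * ((1 - norm (complex_of_real (norm z))) / (1 + norm (complex_of_real (norm z)))) \<le> Re (p (complex_of_real (norm z)))"
  proof (rule harnack_lower_bound)
    show "p holomorphic_on ball 0 1"
      unfolding p_def by (intro holomorphic_intros pole_lemma_open[OF hol]) auto
    show "0 \<le> Re (p \<zeta>)" if \<zeta>: "norm \<zeta> < 1" for \<zeta>
    proof -
      have "norm (1 - p \<zeta>) \<le> 1"
      proof (cases "\<zeta> = 0")
        case True
        then show ?thesis using schwarz(2)[OF \<zeta>] by (simp add: p_def)
      next
        case False
        then have "1 - p \<zeta> = ?q \<zeta> / \<zeta>" using v by (simp add: p_def hinner_def)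
        then show ?thesis using schwarz(1)[OF \<zeta>] False by (simp add: norm_divide)
      qed
      then have "Re (1 - p \<zeta>) \<le> 1" using complex_Re_le_cmod[of "1 - p \<zeta>"] by linarith
      then show ?thesis by simp
    qed
  qed (use z in simp)
  moreover have "p (complex_of_real (norm z)) = 1 - hinner (v z) u / complex_of_real (norm z)"
    using False u v by (simp add: p_def hinner_def)
  then have "Re (p (complex_of_real (norm z))) = 1 - (v z \<bullet> u) / norm z"
    by (simp add: Re_divide_of_real Re_hinner)
  ultimately have "(1 - fd v 0 u \<bullet> u) * ((1 - norm z) / (1 + norm z)) \<le> 1 - (v z \<bullet> u) / norm z"
    by (simp add: p0)
  then have "(norm z)\<^sup>2 * ((1 - fd v 0 u \<bullet> u) * ((1 - norm z) / (1 + norm z))) \<le> (norm z)\<^sup>2 * (1 - (v z \<bullet> u) / norm z)"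
    by (intro mult_left_mono) auto
  moreover have "(norm z)\<^sup>2 * (1 - (v z \<bullet> u) / norm z) = (norm z)\<^sup>2 - v z \<bullet> z"
    using False by (simp add: uR power2_eq_square right_diff_distrib)
  moreover have "fd v 0 u = (1 / norm z) *\<^sub>R fd v 0 z"
    unfolding uR using linear_scale[OF has_derivative_linear[OF hol_map_on_fd(1)[OF v(1), of 0]]] by simp
  then have "(norm z)\<^sup>2 * (1 - fd v 0 u \<bullet> u) = (norm z)\<^sup>2 - fd v 0 z \<bullet> z"
    using False by (simp add: uR power2_eq_square right_diff_distrib)
  ultimately show ?thesis by (simp only: mult.assoc[symmetric])
qed (use v in simp)

section \<open>Linear differential equations and the operator exponential\<close>

lemma vector_derivative_vecI:
  fixes f :: "real \<Rightarrow> complex^'n"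
  assumes "\<And>i. ((\<lambda>t. f t $ i) has_vector_derivative f' $ i) (at t)"
  shows "(f has_vector_derivative f') (at t)"
  unfolding has_vector_derivative_def
  unfolding has_derivative_componentwise_within[of f]
proof
  fix b :: "complex^'n" assume "b \<in> Basis"
  then obtain i c where b: "b = axis i c" by (auto simp: Basis_vec_def)
  have "((\<lambda>x. f x $ i) has_derivative (\<lambda>x. x *\<^sub>R f' $ i)) (at t)"
    using assms by (simp add: has_vector_derivative_def)
  from has_derivative_inner_left[OF this, of c]
  show "((\<lambda>x. f x \<bullet> b) has_derivative (\<lambda>x. x *\<^sub>R f' \<bullet> b)) (at t)"
    unfolding b inner_axis by simp
qed

lemma DERIV_norm_square:
  fixes y :: "real \<Rightarrow> 'a::real_inner"
  assumes "(y has_vector_derivative d) (at t)"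
  shows "((\<lambda>t. (norm (y t))\<^sup>2) has_real_derivative 2 * (y t \<bullet> d)) (at t)"
proof -
  have "((\<lambda>t. y t \<bullet> y t) has_derivative (\<lambda>h. y t \<bullet> (h *\<^sub>R d) + (h *\<^sub>R d) \<bullet> y t)) (at t)"
    using assms unfolding has_vector_derivative_def by (intro has_derivative_inner)
  moreover have "(\<lambda>h. y t \<bullet> (h *\<^sub>R d) + (h *\<^sub>R d) \<bullet> y t) = (*) (2 * (y t \<bullet> d))"
    by (auto simp: fun_eq_iff inner_commute algebra_simps)
  ultimately show ?thesis
    by (simp add: has_field_derivative_def power2_norm_eq_inner)
qed

text \<open>\<open>exp (- 2 * a * t) * (norm (y t))\<^sup>2\<close> is nonincreasing and starts at
  0. This serves as uniqueness for linear equations.\<close>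

lemma gronwall_zero:
  fixes y :: "real \<Rightarrow> 'a::real_inner"
  assumes y: "\<And>t. (y has_vector_derivative y' t) (at t)" and le: "\<And>t. norm (y' t) \<le> a * norm (y t)"
    and y0: "y 0 = 0" and "t \<ge> 0"
  shows "y t = 0"
proof -
  have "exp (- 2 * a * t) * (norm (y t))\<^sup>2 \<le> exp (- 2 * a * 0) * (norm (y 0))\<^sup>2"
  proof (rule DERIV_nonpos_imp_nonincreasing[OF \<open>t \<ge> 0\<close>])
    fix x
    let ?d = "exp (- 2 * a * x) * (2 * (y x \<bullet> y' x)) + exp (- 2 * a * x) * (- 2 * a) * (norm (y x))\<^sup>2"
    have "((\<lambda>x. exp (- 2 * a * x)) has_real_derivative exp (- 2 * a * x) * (- 2 * a)) (at x)"
      by (auto intro!: derivative_eq_intros)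
    from DERIV_mult[OF this DERIV_norm_square[OF y]]
    have "((\<lambda>x. exp (- 2 * a * x) * (norm (y x))\<^sup>2) has_real_derivative ?d) (at x)"
      by (rule DERIV_cong) (simp add: mult_ac)
    moreover have "y x \<bullet> y' x \<le> norm (y x) * (a * norm (y x))"
      using norm_cauchy_schwarz[of "y x" "y' x"] mult_left_mono[OF le[of x] norm_ge_zero[of "y x"]] by linarith
    then have "exp (- 2 * a * x) * (2 * (y x \<bullet> y' x) - 2 * a * (norm (y x))\<^sup>2) \<le> 0"
      by (intro mult_nonneg_nonpos) (auto simp: power2_eq_square mult_ac)
    then have "?d \<le> 0" by (simp add: algebra_simps)
    ultimately show "\<exists>d. ((\<lambda>x. exp (- 2 * a * x) * (norm (y x))\<^sup>2) has_real_derivative d) (at x) \<and> d \<le> 0"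
      by blast
  qed
  then have "exp (- 2 * a * t) * (norm (y t))\<^sup>2 \<le> 0" using y0 by simp
  then show ?thesis by (simp add: mult_le_0_iff)
qed

definition eflow :: "(complex^'n \<Rightarrow> complex^'n) \<Rightarrow> real \<Rightarrow> complex^'n \<Rightarrow> complex^'n" where
  "eflow A t = op_exp (\<lambda>z. t *\<^sub>R A z)"

lemma complex_linear_bound:
  fixes A :: "complex^'n \<Rightarrow> complex^'n"
  assumes "complex_linear A"
  obtains a where "a > 0" "\<And>z. norm (A z) \<le> a * norm z"
  using bounded_linear.pos_bounded[OF complex_linear_bounded_linear[OF assms]] by (metis mult.commute)

lemma funpow_bound:
  fixes A :: "'a::real_normed_vector \<Rightarrow> 'a"
  assumes "\<And>z. norm (A z) \<le> a * norm z" "a \<ge> (0::real)"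
  shows "norm ((A ^^ k) z) \<le> a ^ k * norm z"
proof (induction k)
  case (Suc k)
  have "norm (A ((A ^^ k) z)) \<le> a * norm ((A ^^ k) z)" by (rule assms)
  also have "\<dots> \<le> a * (a ^ k * norm z)" by (intro mult_left_mono Suc assms)
  finally show ?case by (simp add: mult.assoc)
qed simp

lemma funpow_scaleR:
  fixes A :: "complex^'n \<Rightarrow> complex^'n"
  assumes "complex_linear A"
  shows "((\<lambda>z. t *\<^sub>R A z) ^^ k) z = t ^ k *\<^sub>R (A ^^ k) z"
  using assms by (induction k) (auto simp: complex_linear_iff scaleR_eq_smult)

lemma eflow_sums:
  fixes A :: "complex^'n \<Rightarrow> complex^'n"
  assumes A: "complex_linear A"
  shows "(\<lambda>k. (t ^ k / fact k) *\<^sub>R (A ^^ k) z) sums eflow A t z"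
    and "summable (\<lambda>k. norm ((t ^ k / fact k) *\<^sub>R (A ^^ k) z))"
proof -
  obtain a where a: "a > 0" "\<And>z. norm (A z) \<le> a * norm z" using complex_linear_bound[OF A] by blast
  have eq: "((\<lambda>z. t *\<^sub>R A z) ^^ k) z /\<^sub>R fact k = (t ^ k / fact k) *\<^sub>R (A ^^ k) z" for k
    by (simp add: funpow_scaleR[OF A] divide_inverse mult.commute)
  show s: "summable (\<lambda>k. norm ((t ^ k / fact k) *\<^sub>R (A ^^ k) z))"
  proof (rule summable_comparison_test')
    show "summable (\<lambda>k. (\<bar>t\<bar> * a) ^ k /\<^sub>R fact k * norm z)"
      by (intro summable_mult2 summable_exp_generic)
    fix k
    have "norm (norm ((t ^ k / fact k) *\<^sub>R (A ^^ k) z)) \<le> (\<bar>t\<bar> ^ k / fact k) * (a ^ k * norm z)"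
      using mult_left_mono[OF funpow_bound[OF a(2), of k z], of "\<bar>t\<bar> ^ k / fact k"] a(1)
      by (simp add: power_abs)
    then show "norm (norm ((t ^ k / fact k) *\<^sub>R (A ^^ k) z)) \<le> (\<bar>t\<bar> * a) ^ k /\<^sub>R fact k * norm z"
      by (simp add: power_mult_distrib divide_inverse mult_ac)
  qed
  show "(\<lambda>k. (t ^ k / fact k) *\<^sub>R (A ^^ k) z) sums eflow A t z"
    unfolding eflow_def op_exp_def eq using summable_norm_cancel[OF s] by (rule summable_sums)
qed

lemma eflow_0:
  assumes "complex_linear A"
  shows "eflow A 0 z = z"
proof -
  have "(\<lambda>k. (0 ^ k / fact k) *\<^sub>R (A ^^ k) z) sums (\<Sum>k\<in>{0}. (0 ^ k / fact k) *\<^sub>R (A ^^ k) z)"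
    by (rule sums_finite) (auto simp: power_0_left)
  with eflow_sums(1)[OF assms, of 0 z] show ?thesis using sums_unique2 by fastforce
qed

lemma eflow_add: "complex_linear A \<Longrightarrow> eflow A t (x + y) = eflow A t x + eflow A t y"
proof -
  assume A: "complex_linear A"
  have "(A ^^ k) (x + y) = (A ^^ k) x + (A ^^ k) y" for k
    by (induction k) (use A in \<open>auto simp: complex_linear_iff\<close>)
  then show ?thesis
    using sums_unique2[OF eflow_sums(1)[OF A, of t "x + y"]] sums_add[OF eflow_sums(1)[OF A, of t x] eflow_sums(1)[OF A, of t y]]
    by (simp add: scaleR_add_right)
qed

lemma eflow_smult: "complex_linear A \<Longrightarrow> eflow A t (c *s x) = c *s eflow A t x"
proof -
  assume A: "complex_linear A"
  have "(A ^^ k) (c *s x) = c *s (A ^^ k) x" for k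
    by (induction k) (use A in \<open>auto simp: complex_linear_iff\<close>)
  then have "(\<lambda>k. (t ^ k / fact k) *\<^sub>R (A ^^ k) (c *s x)) = (\<lambda>k. c *s ((t ^ k / fact k) *\<^sub>R (A ^^ k) x))"
    by (simp add: fun_eq_iff scaleR_eq_smult mult.commute)
  then show ?thesis
    using sums_unique2[OF eflow_sums(1)[OF A, of t "c *s x"]] bounded_linear.sums[OF bounded_linear_smult_right eflow_sums(1)[OF A, of t x], of c]
    by simp
qed

lemma eflow_linear: "complex_linear A \<Longrightarrow> complex_linear (eflow A t)"
  unfolding complex_linear_iff[of "eflow A t"] by (auto simp: eflow_add eflow_smult)

lemma eflow_commute: "complex_linear A \<Longrightarrow> eflow A t (A z) = A (eflow A t z)"
proof -
  assume A: "complex_linear A"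
  have "(\<lambda>k. A ((t ^ k / fact k) *\<^sub>R (A ^^ k) z)) = (\<lambda>k. (t ^ k / fact k) *\<^sub>R (A ^^ k) (A z))"
    using A by (simp add: fun_eq_iff scaleR_eq_smult complex_linear_iff funpow_swap1)
  then show ?thesis
    using sums_unique2[OF eflow_sums(1)[OF A, of t "A z"]]
      bounded_linear.sums[OF complex_linear_bounded_linear[OF A] eflow_sums(1)[OF A, of t z]]
    by simp
qed

text \<open>Termwise comparison with the scalar exponential series; for the second bound the series
  is shifted by two terms and \<open>fact (k + 2) \<ge> fact k\<close> is used.\<close>

lemma eflow_bounds:
  fixes A :: "complex^'n \<Rightarrow> complex^'n"
  assumes A: "complex_linear A" and a: "a \<ge> 0" "\<And>z. norm (A z) \<le> a * norm z"
  shows "norm (eflow A t z) \<le> exp (a * \<bar>t\<bar>) * norm z"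
    and "norm (eflow A t z - z - t *\<^sub>R A z) \<le> (a * t)\<^sup>2 * exp (a * \<bar>t\<bar>) * norm z"
proof -
  have ex: "(\<lambda>k. (a * \<bar>t\<bar>) ^ k / fact k) sums exp (a * \<bar>t\<bar>)"
    using exp_converges[of "a * \<bar>t\<bar>"] by (simp add: divide_inverse mult.commute)
  have b: "norm ((t ^ k / fact k) *\<^sub>R (A ^^ k) z) \<le> (a * \<bar>t\<bar>) ^ k / fact k * norm z" for k
    using mult_left_mono[OF funpow_bound[OF a(2,1), of k z], of "\<bar>t\<bar> ^ k / fact k"]
    by (simp add: power_abs power_mult_distrib mult_ac)
  show "norm (eflow A t z) \<le> exp (a * \<bar>t\<bar>) * norm z"
    using norm_suminf_le[of "\<lambda>k. (t ^ k / fact k) *\<^sub>R (A ^^ k) z" "\<lambda>k. (a * \<bar>t\<bar>) ^ k / fact k * norm z", OF b] sums_mult2[OF ex, of "norm z"] eflow_sums(1)[OF A, of t z]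
    by (simp add: sums_iff)
  have b2: "norm ((t ^ (k + 2) / fact (k + 2)) *\<^sub>R (A ^^ (k + 2)) z) \<le> (a * t)\<^sup>2 * norm z * ((a * \<bar>t\<bar>) ^ k / fact k)" for k
  proof -
    have "norm ((t ^ (k + 2) / fact (k + 2)) *\<^sub>R (A ^^ (k + 2)) z) \<le> (a * \<bar>t\<bar>) ^ (k + 2) / fact (k + 2) * norm z"
      by (rule b)
    also have "\<dots> \<le> (a * \<bar>t\<bar>) ^ (k + 2) / fact k * norm z"
      using a(1) by (intro mult_right_mono divide_left_mono fact_mono) auto
    also have "\<dots> = (a * t)\<^sup>2 * norm z * ((a * \<bar>t\<bar>) ^ k / fact k)"
    proof -
      have "(a * \<bar>t\<bar>) ^ (k + 2) = (a * \<bar>t\<bar>) ^ k * (a * t)\<^sup>2"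
        by (simp only: power_add power_mult_distrib power2_abs)
      then show ?thesis by (simp only:) simp
    qed
    finally show ?thesis .
  qed
  have s: "(\<lambda>k. (t ^ (k + 2) / fact (k + 2)) *\<^sub>R (A ^^ (k + 2)) z) sums (eflow A t z - (\<Sum>k<2. (t ^ k / fact k) *\<^sub>R (A ^^ k) z))"
    by (rule sums_split_initial_segment[OF eflow_sums(1)[OF A]])
  have "eflow A t z - (\<Sum>k<2. (t ^ k / fact k) *\<^sub>R (A ^^ k) z) = eflow A t z - z - t *\<^sub>R A z"
    by (simp add: numeral_2_eq_2)
  moreover have "norm (eflow A t z - (\<Sum>k<2. (t ^ k / fact k) *\<^sub>R (A ^^ k) z)) \<le> (a * t)\<^sup>2 * norm z * exp (a * \<bar>t\<bar>)"
    using norm_suminf_le[of "\<lambda>k. (t ^ (k + 2) / fact (k + 2)) *\<^sub>R (A ^^ (k + 2)) z" "\<lambda>k. (a * t)\<^sup>2 * norm z * ((a * \<bar>t\<bar>) ^ k / fact k)", OF b2]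
      sums_mult[OF ex, of "(a * t)\<^sup>2 * norm z"]
    unfolding sums_unique[OF s] by (simp only: sums_iff)
  ultimately show "norm (eflow A t z - z - t *\<^sub>R A z) \<le> (a * t)\<^sup>2 * exp (a * \<bar>t\<bar>) * norm z"
    by (simp only: mult_ac)
qed

text \<open>Each component is an everywhere convergent complex power series restricted to real
  \<open>t\<close>. Termwise differentiation shifts its coefficients, which amounts to replacing
  \<open>z\<close> by \<open>A z\<close>.\<close>

lemma eflow_has_vector_derivative:
  fixes A :: "complex^'n \<Rightarrow> complex^'n"
  assumes A: "complex_linear A"
  shows "((\<lambda>t. eflow A t z) has_vector_derivative A (eflow A t z)) (at t)"
proof (rule vector_derivative_vecI)
  fix i
  define c where "c k = (A ^^ k) z $ i / fact k" for k
  have csums: "(\<lambda>k. (A ^^ k) z $ i / fact k * complex_of_real s ^ k) sums (eflow A s z $ i)" for s z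
  proof -
    have "(\<lambda>k. ((s ^ k / fact k) *\<^sub>R (A ^^ k) z) $ i) sums (eflow A s z $ i)"
      by (rule bounded_linear.sums[OF bounded_linear_vec_nth eflow_sums(1)[OF A]])
    moreover have "((s ^ k / fact k) *\<^sub>R v) $ i = v $ i / fact k * complex_of_real s ^ k" for k and v :: "complex^'n"
      by simp (simp add: scaleR_conv_of_real)
    ultimately show ?thesis by (simp only:)
  qed
  have summ: "summable (\<lambda>k. c k * y ^ k)" for y
  proof -
    have "summable (\<lambda>k. norm ((norm y ^ k / fact k) *\<^sub>R (A ^^ k) z))" by (rule eflow_sums(2)[OF A])
    then have "summable (\<lambda>k. norm (c k * y ^ k))"
    proof (rule summable_comparison_test')
      fix k show "norm (norm (c k * y ^ k)) \<le> norm ((norm y ^ k / fact k) *\<^sub>R (A ^^ k) z)"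
        using mult_left_mono[OF Finite_Cartesian_Product.norm_nth_le[of "(A ^^ k) z" i], of "norm y ^ k / fact k"]
        by (simp add: c_def norm_mult norm_divide norm_power mult_ac)
    qed
    then show ?thesis by (rule summable_norm_cancel)
  qed
  have "((\<lambda>x. \<Sum>k. c k * x ^ k) has_field_derivative (\<Sum>k. diffs c k * complex_of_real t ^ k)) (at (complex_of_real t))"
    by (rule termdiffs_strong_converges_everywhere[OF summ])
  then have "((\<lambda>s. \<Sum>k. c k * complex_of_real s ^ k) has_vector_derivative (\<Sum>k. diffs c k * complex_of_real t ^ k)) (at t)"
    by (rule has_vector_derivative_real_field)
  moreover have "(\<Sum>k. c k * complex_of_real s ^ k) = eflow A s z $ i" for s
    using csums[of z s] by (simp add: sums_iff c_def)
  moreover have "diffs c k = (A ^^ k) (A z) $ i / fact k" for k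
    by (simp add: diffs_def c_def funpow_swap1 del: of_nat_Suc)
  then have "(\<Sum>k. diffs c k * complex_of_real t ^ k) = A (eflow A t z) $ i"
    using csums[of "A z" t] eflow_commute[OF A, of t z] by (simp add: sums_iff)
  ultimately show "((\<lambda>t. eflow A t z $ i) has_vector_derivative A (eflow A t z) $ i) (at t)"
    by simp
qed

text \<open>Instead of multiplying series: as functions of \<open>s\<close> both sides solve
  \<open>y' = A y\<close> with the same value at 0, and Gronwall gives uniqueness. Negative
  \<open>s\<close> is handled by reversing time.\<close>

lemma eflow_eflow:
  fixes A :: "complex^'n \<Rightarrow> complex^'n"
  assumes A: "complex_linear A"
  shows "eflow A s (eflow A t z) = eflow A (s + t) z"
proof -
  obtain a where a: "a > 0" "\<And>z. norm (A z) \<le> a * norm z" using complex_linear_bound[OF A] by blast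
  define y where "y s = eflow A (s + t) z - eflow A s (eflow A t z)" for s
  have Adiff: "A (u - v) = A u - A v" for u v
    using linear_diff[OF complex_linear_imp_linear[OF A]] .
  have shift: "((\<lambda>s. eflow A (s + t) z) has_vector_derivative A (eflow A (s + t) z)) (at s)" for s
  proof -
    have "((\<lambda>s. s + t) has_vector_derivative 1) (at s)"
      by (auto intro!: derivative_eq_intros simp: has_real_derivative_iff_has_vector_derivative[symmetric])
    from vector_diff_chain_at[OF this eflow_has_vector_derivative[OF A]]
    show ?thesis by (simp add: o_def)
  qed
  have y: "(y has_vector_derivative A (y s)) (at s)" for s
    unfolding y_def Adiff by (intro has_vector_derivative_diff shift eflow_has_vector_derivative A)
  have y0: "y 0 = 0" by (simp add: y_def eflow_0[OF A])
  have "y s = 0"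
  proof (cases "s \<ge> 0")
    case True
    then show ?thesis by (rule gronwall_zero[OF y a(2) y0])
  next
    case False
    have y': "((\<lambda>s. y (- s)) has_vector_derivative - A (y (- s))) (at s)" for s
    proof -
      have "((\<lambda>s. - s) has_vector_derivative - 1) (at s)"
        by (auto intro!: derivative_eq_intros simp: has_real_derivative_iff_has_vector_derivative[symmetric])
      from vector_diff_chain_at[OF this y]
      show ?thesis by (simp add: o_def)
    qed
    have "y (- (- s)) = 0"
      by (rule gronwall_zero[where y = "\<lambda>s. y (- s)" and y' = "\<lambda>s. - A (y (- s))" and a = a, OF y'])
         (use False a y0 in auto)
    then show ?thesis by simp
  qed
  then show ?thesis by (simp add: y_def)
qed

section \<open>Automorphisms of complex n-space\<close>

lemma Aut_spaceI:
  assumes "holomorphic_map_on \<Phi> UNIV" "holomorphic_map_on \<Psi> UNIV"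
    "\<And>z. \<Psi> (\<Phi> z) = z" "\<And>z. \<Phi> (\<Psi> z) = z"
  shows "\<Phi> \<in> Aut_space"
proof -
  have "bij \<Phi>" by (rule o_bij[of \<Psi>]) (auto simp: fun_eq_iff assms)
  moreover have "inv \<Phi> = \<Psi>" by (rule inv_equality) (rule assms)+
  ultimately show ?thesis using assms by (simp add: Aut_space_def biholomorphism_def)
qed

lemma Aut_spaceE:
  assumes "\<Phi> \<in> Aut_space"
  obtains \<Psi> where "holomorphic_map_on \<Phi> UNIV" "holomorphic_map_on \<Psi> UNIV"
    "\<And>z. \<Psi> (\<Phi> z) = z" "\<And>z. \<Phi> (\<Psi> z) = z" "\<Psi> \<in> Aut_space"
proof -
  have b: "bij \<Phi>" "holomorphic_map_on \<Phi> UNIV" "holomorphic_map_on (inv \<Phi>) UNIV"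
    using assms by (auto simp: Aut_space_def biholomorphism_def)
  then have "inv \<Phi> (\<Phi> z) = z" "\<Phi> (inv \<Phi> z) = z" for z
    by (auto simp: bij_is_inj bij_is_surj surj_f_inv_f)
  with b show ?thesis using that[of "inv \<Phi>"] Aut_spaceI[of "inv \<Phi>" \<Phi>] by blast
qed

lemma Aut_space_compose:
  assumes "\<Phi> \<in> Aut_space" "\<Psi> \<in> Aut_space"
  shows "(\<lambda>z. \<Phi> (\<Psi> z)) \<in> Aut_space"
proof -
  obtain \<Phi>' where 1: "holomorphic_map_on \<Phi> UNIV" "holomorphic_map_on \<Phi>' UNIV"
    "\<And>z. \<Phi>' (\<Phi> z) = z" "\<And>z. \<Phi> (\<Phi>' z) = z" using Aut_spaceE[OF assms(1)] by metis
  obtain \<Psi>' where 2: "holomorphic_map_on \<Psi> UNIV" "holomorphic_map_on \<Psi>' UNIV"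
    "\<And>z. \<Psi>' (\<Psi> z) = z" "\<And>z. \<Psi> (\<Psi>' z) = z" using Aut_spaceE[OF assms(2)] by metis
  show ?thesis
    by (rule Aut_spaceI[of _ "\<lambda>z. \<Psi>' (\<Phi>' z)"])
       (use 1 2 hol_map_on_compose(1)[of _ UNIV _ UNIV] in auto)
qed

lemma eflow_Aut:
  assumes "complex_linear A"
  shows "eflow A t \<in> Aut_space"
  by (rule Aut_spaceI[of _ "eflow A (- t)"])
     (auto simp: eflow_eflow[OF assms] eflow_0[OF assms] intro!: hol_map_on_linear eflow_linear assms)

lemma smult_Aut:
  assumes "c \<noteq> 0"
  shows "(\<lambda>z. c *s z) \<in> Aut_space"
  by (rule Aut_spaceI[of _ "\<lambda>z. inverse c *s z"])
     (use assms in \<open>auto simp: vec_eq_iff complex_linear_iff vector_add_ldistrib mult.commute intro!: hol_map_on_linear\<close>)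

subsection \<open>Polynomial fields as sums of shears and overshears\<close>

text \<open>The flow of a shear is a translation by a multiple of \<open>v\<close>, that of an overshear a multiplication
  of the \<open>v\<close>-coordinate; \<open>v $ j = 1\<close> normalises the linear form \<open>z $ j\<close> on the direction \<open>v\<close>.\<close>

inductive shear_span :: "nat \<Rightarrow> (complex^'n \<Rightarrow> complex^'n) \<Rightarrow> bool" where
  shear: "hol_fun_on g UNIV \<Longrightarrow> (\<And>z \<zeta>. g (z + \<zeta> *s v) = g z) \<Longrightarrow> (\<And>c z. g (c *s z) = c ^ k * g z)
    \<Longrightarrow> shear_span k (\<lambda>z. g z *s v)"
| overshear: "hol_fun_on g UNIV \<Longrightarrow> (\<And>z \<zeta>. g (z + \<zeta> *s v) = g z) \<Longrightarrow> (\<And>c z. g (c *s z) = c ^ k * g z)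
    \<Longrightarrow> v $ j = 1 \<Longrightarrow> shear_span (Suc k) (\<lambda>z. (g z * z $ j) *s v)"
| add: "shear_span k X \<Longrightarrow> shear_span k Y \<Longrightarrow> shear_span k (\<lambda>z. X z + Y z)"

lemma shear_span_smult: "shear_span k X \<Longrightarrow> shear_span k (\<lambda>z. c *s X z)"
proof (induction rule: shear_span.induct)
  case (shear g v k)
  have "shear_span k (\<lambda>z. (c * g z) *s v)"
    using shear by (intro shear_span.shear hol_fun_on_mult hol_fun_on_const) auto
  then show ?case by (simp add: vector_smult_assoc)
next
  case (overshear g v k j)
  have "shear_span (Suc k) (\<lambda>z. ((c * g z) * z $ j) *s v)"
    using overshear by (intro shear_span.overshear hol_fun_on_mult hol_fun_on_const) auto
  then show ?case by (simp add: vector_smult_assoc mult.assoc)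
next
  case (add k X Y)
  then show ?case by (simp add: vector_add_ldistrib shear_span.add)
qed

lemma shear_span_zero: "shear_span k (\<lambda>z. 0)"
  using shear_span.shear[of "\<lambda>_. 0" 0 k] hol_fun_on_const[of UNIV 0] by simp

lemma shear_span_sum:
  "finite I \<Longrightarrow> (\<And>i. i \<in> I \<Longrightarrow> shear_span k (X i)) \<Longrightarrow> shear_span k (\<lambda>z. \<Sum>i\<in>I. X i z)"
  by (induction I rule: finite_induct) (auto intro: shear_span_zero shear_span.add)

lemma shear_span_diff: "shear_span k X \<Longrightarrow> shear_span k Y \<Longrightarrow> shear_span k (\<lambda>z. X z - Y z)"
  using shear_span.add[of k X "\<lambda>z. (-1) *s Y z"] shear_span_smult[of k Y "-1"]
  by (simp flip: vector_sneg_minus1)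

text \<open>The top coefficient is eliminated by passing from \<open>p c\<close> to \<open>p (2 c) - 2 ^ d * p c\<close>.\<close>

lemma shear_span_coefficient:
  assumes "\<And>c. shear_span k (\<lambda>z. \<Sum>i\<le>d. c ^ i *s W i z)" "i \<le> d"
  shows "shear_span k (W i)"
  using assms
proof (induction d arbitrary: W i)
  case 0
  from 0(1)[of 1] 0(2) show ?case by simp
next
  case (Suc d)
  let ?p = "\<lambda>c z. \<Sum>i\<le>Suc d. c ^ i *s W i z"
  have low: "shear_span k (W i)" if i: "i \<le> d" for i
  proof -
    have "shear_span k (\<lambda>z. ((2 ^ i - 2 ^ Suc d) :: complex) *s W i z)"
    proof (rule Suc.IH[OF _ i])
      fix c :: complex
      have "?p (2 * c) z - 2 ^ Suc d *s ?p c z = (\<Sum>i\<le>d. c ^ i *s ((2 ^ i - 2 ^ Suc d) *s W i z))" for z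
        by (simp add: vector_add_ldistrib power_mult_distrib vec_eq_iff sum_distrib_left sum_subtractf[symmetric] algebra_simps)
      then show "shear_span k (\<lambda>z. \<Sum>i\<le>d. c ^ i *s ((2 ^ i - 2 ^ Suc d) *s W i z))"
        using shear_span_diff[OF Suc.prems(1)[of "2 * c"] shear_span_smult[OF Suc.prems(1)[of c], of "2 ^ Suc d"]]
        by simp
    qed
    moreover have "(2 ^ i - 2 ^ Suc d :: complex) \<noteq> 0"
    proof
      assume "(2 ^ i - 2 ^ Suc d :: complex) = 0"
      then have "(of_nat (2 ^ i) :: complex) = of_nat (2 ^ Suc d)" by simp
      then have "(2 :: nat) ^ i = 2 ^ Suc d" by (simp only: of_nat_eq_iff)
      then show False using i power_inject_exp[of "2::nat" i "Suc d"] by simp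
    qed
    moreover have "shear_span k (W i)" if "shear_span k (\<lambda>z. \<gamma> *s W i z)" "\<gamma> \<noteq> 0" for \<gamma> :: complex
      using shear_span_smult[OF that(1), of "inverse \<gamma>"] that(2) by (simp add: vector_smult_assoc)
    ultimately show ?thesis by blast
  qed
  show ?case
  proof (cases "i \<le> d")
    case True
    then show ?thesis by (rule low)
  next
    case False
    have "shear_span k (\<lambda>z. ?p 1 z - (\<Sum>i\<le>d. W i z))"
      by (intro shear_span_diff Suc.prems(1) shear_span_sum low) auto
    moreover have "i = Suc d" using False Suc.prems by simp
    ultimately show ?thesis by simp
  qed
qed

text \<open>Collects powers of \<open>c\<close> after multiplying a polynomial in \<open>c\<close>
  by the direction \<open>e - c *s e'\<close>, which itself depends on \<open>c\<close>: the
  coefficient at \<open>i\<close> mixes \<open>a i\<close> and \<open>a (i - 1)\<close>. The value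
  \<open>a (Suc d) = 0\<close> pads the new top degree.\<close>

lemma sum_power_smult_pair:
  fixes a :: "nat \<Rightarrow> complex"
  assumes "a (Suc d) = 0"
  shows "(\<Sum>i\<le>d. c ^ i * a i) *s (e - c *s e')
       = (\<Sum>i\<le>Suc d. c ^ i *s (a i *s e - (if i = 0 then 0 else a (i - 1)) *s e'))"
proof -
  have "(\<Sum>i\<le>Suc d. c ^ i * a i) = (\<Sum>i\<le>d. c ^ i * a i)" using assms by simp
  moreover have "(\<Sum>i\<le>Suc d. c ^ i * (if i = 0 then 0 else a (i - 1))) = (\<Sum>i\<le>d. c ^ i * a i) * c"
    unfolding sum.atMost_Suc_shift by (simp add: sum_distrib_left sum_distrib_right mult_ac)
  ultimately show ?thesis
    by (simp add: vec_eq_iff right_diff_distrib sum_subtractf sum_distrib_right[symmetric] mult.assoc[symmetric]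
        del: sum.atMost_Suc)
qed

section \<open>Monomial fields\<close>

definition monomial_fun :: "('n \<Rightarrow> nat) \<Rightarrow> complex^'n \<Rightarrow> complex" where
  "monomial_fun \<alpha> z = (\<Prod>i\<in>UNIV. (z $ i) ^ \<alpha> i)"

lemma hol_fun_on_monomial: "hol_fun_on (monomial_fun \<alpha>) UNIV"
  unfolding monomial_fun_def by (intro hol_fun_on_prod hol_fun_on_power hol_fun_on_nth) auto

lemma monomial_fun_smult: "monomial_fun \<alpha> (c *s z) = c ^ (\<Sum>i\<in>UNIV. \<alpha> i) * monomial_fun \<alpha> z"
  by (simp add: monomial_fun_def power_mult_distrib prod.distrib power_sum)

lemma monomial_fun_remove: "monomial_fun \<alpha> z = monomial_fun (\<alpha>(j := 0)) z * (z $ j) ^ \<alpha> j"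
proof -
  have "monomial_fun (\<alpha>(j := 0)) z = (\<Prod>i\<in>UNIV - {j}. (z $ i) ^ \<alpha> i)"
    unfolding monomial_fun_def prod.remove[of UNIV j, simplified] by (auto intro!: prod.cong)
  then show ?thesis
    unfolding monomial_fun_def[of \<alpha>] prod.remove[of UNIV j, simplified] by (simp add: mult.commute)
qed

lemma monomial_fun_Suc: "monomial_fun (\<alpha>(j := Suc (\<alpha> j))) z = monomial_fun \<alpha> z * z $ j"
  using monomial_fun_remove[of "\<alpha>(j := Suc (\<alpha> j))" z j] monomial_fun_remove[of \<alpha> z j] by simp

lemma sum_remove_exponent: "(\<Sum>i\<in>UNIV. (\<alpha>(j := 0)) i) + \<alpha> j = (\<Sum>i\<in>UNIV. \<alpha> i :: nat)"
  for \<alpha> :: "'n::finite \<Rightarrow> nat"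
proof -
  have "(\<Sum>i\<in>UNIV. (\<alpha>(j := 0)) i) = (\<Sum>i\<in>UNIV - {j}. \<alpha> i)"
    unfolding sum.remove[of UNIV j, simplified] by (auto intro!: sum.cong)
  then show ?thesis unfolding sum.remove[of UNIV j, simplified] by simp
qed

lemma monomial_fun_cong: "(\<And>i. \<alpha> i \<noteq> 0 \<Longrightarrow> z $ i = w $ i) \<Longrightarrow> monomial_fun \<alpha> z = monomial_fun \<alpha> w"
  unfolding monomial_fun_def by (intro prod.cong refl) (metis power_0)

text \<open>With \<open>b = e - p - 1\<close>, the ratios of consecutive binomial coefficients are
  \<open>(b + 1) / (p + 1)\<close> and \<open>b / (p + 2)\<close>, so the claim reduces to
  \<open>(p + 1) * b < (p + 2) * (b + 1)\<close>.\<close>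

lemma binomial_log_concave:
  fixes e p :: nat
  assumes "p + 1 \<le> e"
  shows "(e choose p) * (e choose (p + 2)) < (e choose (p + 1)) ^ 2"
proof -
  obtain b where e: "e = p + 1 + b" using le_Suc_ex[OF assms] by blast
  have *: "Suc k * (e choose Suc k) = (e - k) * (e choose k)" for k
    using binomial_absorb_comp[of e k] binomial_absorption[of k e] by simp
  have 1: "(p + 1) * (e choose (p + 1)) = (b + 1) * (e choose p)"
    using *[of p] by (simp add: e)
  have 2: "(p + 2) * (e choose (p + 2)) = b * (e choose (p + 1))"
    using *[of "p + 1"] by (simp add: e)
  have pos: "(e choose (p + 1)) > 0" using assms by (simp add: zero_less_binomial)
  have "((p + 2) * (b + 1)) * ((e choose p) * (e choose (p + 2))) = ((b + 1) * (e choose p)) * ((p + 2) * (e choose (p + 2)))"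
    by (simp only: mult_ac)
  also have "\<dots> = ((p + 1) * b) * (e choose (p + 1)) ^ 2"
    unfolding 1[symmetric] 2 by (simp only: power2_eq_square mult_ac)
  also have "\<dots> < ((p + 2) * (b + 1)) * (e choose (p + 1)) ^ 2"
    using pos by (intro mult_strict_right_mono) auto
  finally show ?thesis by (rule mult_left_less_imp_less) simp
qed

text \<open>For exponents of \<open>z\<^sub>j\<close> above \<open>1\<close>: the shear and the overshear along \<open>e\<^sub>j - c e\<^sub>l\<close> are polynomials
  in \<open>c\<close>; one coefficient of each involves the same two fields, and strict log-concavity of the
  binomial coefficients makes the resulting linear system regular.\<close>

lemma shear_span_monomial:
  fixes j :: "'n::finite" and \<alpha> :: "'n \<Rightarrow> nat"
  assumes card: "CARD('n) \<ge> 2"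
  shows "shear_span (\<Sum>i\<in>UNIV. \<alpha> i) (\<lambda>z. monomial_fun \<alpha> z *s axis j 1)"
proof -
  consider "\<alpha> j = 0" | "\<alpha> j = 1" | p where "\<alpha> j = p + 2"
    by (metis One_nat_def add_2_eq_Suc' old.nat.exhaust)
  then show ?thesis
  proof cases
    case 1
    show ?thesis
      by (rule shear_span.shear[OF hol_fun_on_monomial _ monomial_fun_smult], rule monomial_fun_cong)
         (use 1 in \<open>auto simp: axis_def\<close>)
  next
    case 2
    have "shear_span (Suc (\<Sum>i\<in>UNIV. (\<alpha>(j := 0)) i)) (\<lambda>z. (monomial_fun (\<alpha>(j := 0)) z * z $ j) *s axis j 1)"
    proof (rule shear_span.overshear[OF hol_fun_on_monomial _ monomial_fun_smult])
      show "monomial_fun (\<alpha>(j := 0)) (z + \<zeta> *s axis j 1) = monomial_fun (\<alpha>(j := 0)) z" for z \<zeta>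
        by (rule monomial_fun_cong) (auto simp: axis_def split: if_splits)
    qed (simp add: axis_def)
    moreover have "Suc (\<Sum>i\<in>UNIV. (\<alpha>(j := 0)) i) = (\<Sum>i\<in>UNIV. \<alpha> i)"
      using sum_remove_exponent[of \<alpha> j] 2 by simp
    ultimately show ?thesis
      using monomial_fun_remove[of \<alpha> _ j] 2 by simp
  next
    case (3 p)
    \<comment> \<open>The second coordinate exists because \<open>n \<ge> 2\<close>.\<close>
    obtain l where l: "l \<noteq> j"
    proof -
      have "\<not> (UNIV :: 'n set) \<subseteq> {j}"
        using card card_mono[of "{j}" "UNIV :: 'n set"] by auto
      then show ?thesis using that by blast
    qed
    define b where "b = \<alpha> l"
    \<comment> \<open>The exponents of \<open>z $ j\<close> and \<open>z $ l\<close> add up to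
      \<open>p + 2 + b = Suc e\<close>, the degree that shear and overshear must have apart from the
      factor \<open>M\<close>.\<close>
    define e where "e = p + 1 + b"
    define \<beta> where "\<beta> = \<alpha>(j := 0, l := 0)"
    define M where "M = monomial_fun \<beta>"
    define m where "m = (\<Sum>i\<in>UNIV. \<beta> i)"
    have K: "(\<Sum>i\<in>UNIV. \<alpha> i) = m + Suc e"
      using sum_remove_exponent[of \<alpha> j] sum_remove_exponent[of "\<alpha>(j := 0)" l] l 3
      by (simp add: m_def \<beta>_def b_def e_def)
    have mono: "monomial_fun \<alpha> z = M z * (z $ j) ^ (p + 2) * (z $ l) ^ b" for z
      using monomial_fun_remove[of \<alpha> z j] monomial_fun_remove[of "\<alpha>(j := 0)" z l] l 3
      by (simp add: M_def \<beta>_def b_def mult_ac)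
    define v where "v c = axis j 1 - c *s axis l (1::complex)" for c
    \<comment> \<open>A linear form vanishing on the direction \<open>v c\<close>; since
      \<open>M\<close> contains neither \<open>z $ j\<close> nor \<open>z $ l\<close>, products of
      \<open>M\<close> with powers of \<open>y c\<close> are invariant along
      \<open>v c\<close>.\<close>
    define y where "y c z = z $ l + c * z $ j" for c and z :: "complex^'n"
    have vj: "v c $ j = 1" for c using l by (simp add: v_def axis_def)
    have y: "hol_fun_on (y c) UNIV" "y c (z + \<zeta> *s v c) = y c z" "y c (d *s z) = d * y c z" for c d z \<zeta>
      unfolding y_def using l
      by (auto intro!: hol_fun_on_add hol_fun_on_mult hol_fun_on_const hol_fun_on_nth simp: v_def axis_def algebra_simps)
    have M: "hol_fun_on M UNIV" "M (z + \<zeta> *s v c) = M z" "M (d *s z) = d ^ m * M z" for c d z \<zeta>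
    proof -
      show "hol_fun_on M UNIV" unfolding M_def by (rule hol_fun_on_monomial)
      show "M (d *s z) = d ^ m * M z" unfolding M_def m_def by (rule monomial_fun_smult)
      show "M (z + \<zeta> *s v c) = M z"
        unfolding M_def by (rule monomial_fun_cong) (auto simp: v_def \<beta>_def axis_def split: if_splits)
    qed
    have S: "shear_span (m + Suc e) (\<lambda>z. (M z * y c z ^ Suc e) *s v c)" for c
      by (rule shear_span.shear)
         (auto intro!: hol_fun_on_mult hol_fun_on_power M y simp: M(2,3) y(2,3) power_add power_mult_distrib mult_ac)
    have O: "shear_span (Suc (m + e)) (\<lambda>z. ((M z * y c z ^ e) * z $ j) *s v c)" for c
      by (rule shear_span.overshear[OF _ _ _ vj])
         (auto intro!: hol_fun_on_mult hol_fun_on_power M y simp: M(2,3) y(2,3) power_add power_mult_distrib)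
    have yexp: "y c z ^ d = (\<Sum>i\<le>d. c ^ i * (of_nat (d choose i) * (z $ j) ^ i * (z $ l) ^ (d - i)))" for c d z
      unfolding y_def add.commute[of "z $ l"] binomial_ring by (simp add: power_mult_distrib mult_ac)
    define aS where "aS z i = M z * (of_nat (Suc e choose i) * (z $ j) ^ i * (z $ l) ^ (Suc e - i))" for z i
    define aO where "aO z i = M z * z $ j * (of_nat (e choose i) * (z $ j) ^ i * (z $ l) ^ (e - i))" for z i
    have "shear_span (m + Suc e) (\<lambda>z. \<Sum>i\<le>Suc (Suc e). c ^ i *s (aS z i *s axis j 1 - (if i = 0 then 0 else aS z (i - 1)) *s axis l 1))" for c
    proof -
      have "(M z * y c z ^ Suc e) *s v c = (\<Sum>i\<le>Suc (Suc e). c ^ i *s (aS z i *s axis j 1 - (if i = 0 then 0 else aS z (i - 1)) *s axis l 1))" for z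
      proof -
        have "M z * y c z ^ Suc e = (\<Sum>i\<le>Suc e. c ^ i * aS z i)"
          unfolding yexp aS_def sum_distrib_left by (intro sum.cong refl) (simp only: mult_ac)
        then show ?thesis unfolding v_def by (simp only:, intro sum_power_smult_pair) (simp add: aS_def binomial_eq_0 del: binomial_Suc_Suc)
      qed
      then show ?thesis using S[of c] by (simp only:)
    qed
    \<comment> \<open>This coefficient of the shear, and the coefficient \<open>p + 1\<close> of the
      overshear below, combine the same two fields: the wanted
      \<open>monomial_fun \<alpha> z *s axis j 1\<close>, and \<open>axis l 1\<close> times the
      monomial in which one factor \<open>z $ j\<close> is traded for \<open>z $ l\<close>.\<close>
    from shear_span_coefficient[OF this, of "p + 2"]
    have Sp: "shear_span (m + Suc e) (\<lambda>z. aS z (p + 2) *s axis j 1 - aS z (p + 1) *s axis l 1)"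
      by (simp add: e_def)
    have "shear_span (m + Suc e) (\<lambda>z. \<Sum>i\<le>Suc e. c ^ i *s (aO z i *s axis j 1 - (if i = 0 then 0 else aO z (i - 1)) *s axis l 1))" for c
    proof -
      have "(M z * y c z ^ e * z $ j) *s v c = (\<Sum>i\<le>Suc e. c ^ i *s (aO z i *s axis j 1 - (if i = 0 then 0 else aO z (i - 1)) *s axis l 1))" for z
      proof -
        have "M z * y c z ^ e * z $ j = (\<Sum>i\<le>e. c ^ i * aO z i)"
          unfolding yexp aO_def sum_distrib_left sum_distrib_right by (intro sum.cong refl) (simp only: mult_ac)
        then show ?thesis unfolding v_def by (simp only:, intro sum_power_smult_pair) (simp add: aO_def binomial_eq_0)
      qed
      then show ?thesis using O[of c] by (simp only: add_Suc_right)
    qed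
    from shear_span_coefficient[OF this, of "p + 1"]
    have Op: "shear_span (m + Suc e) (\<lambda>z. aO z (p + 1) *s axis j 1 - aO z p *s axis l 1)"
      by (simp add: e_def)
    define C where "C i = (of_nat (e choose i) :: complex)" for i
    define D where "D i = (of_nat (Suc e choose i) :: complex)" for i
    \<comment> \<open>The determinant of the two equations; Pascal's rule rewrites it as the
      log-concavity defect of row \<open>e\<close>.\<close>
    define \<kappa> where "\<kappa> = D (p + 1) * C (p + 1) - C p * D (p + 2)"
    have "D (p + 1) = C p + C (p + 1)" "D (p + 2) = C (p + 1) + C (p + 2)"
      by (simp_all add: C_def D_def)
    then have "\<kappa> = C (p + 1) ^ 2 - C p * C (p + 2)"
      by (simp add: \<kappa>_def power2_eq_square algebra_simps)
    also have "\<dots> \<noteq> 0"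
    proof
      assume "C (p + 1) ^ 2 - C p * C (p + 2) = 0"
      then have "(of_nat ((e choose (p + 1)) ^ 2) :: complex) = of_nat ((e choose p) * (e choose (p + 2)))"
        by (simp add: C_def)
      then have "(e choose (p + 1)) ^ 2 = (e choose p) * (e choose (p + 2))"
        by (simp only: of_nat_eq_iff)
      then show False using binomial_log_concave[of p e] by (simp add: e_def)
    qed
    finally have \<kappa>: "\<kappa> \<noteq> 0" .
    have aS: "aS z (p + 2) = D (p + 2) * monomial_fun \<alpha> z" "aS z (p + 1) = D (p + 1) * (M z * (z $ j) ^ (p + 1) * (z $ l) ^ (b + 1))" for z
      by (simp_all add: aS_def D_def mono e_def mult_ac)
    have aO: "aO z (p + 1) = C (p + 1) * monomial_fun \<alpha> z" "aO z p = C p * (M z * (z $ j) ^ (p + 1) * (z $ l) ^ (b + 1))" for z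
      by (simp_all add: aO_def C_def mono e_def mult_ac)
    \<comment> \<open>Cramer's rule: these multipliers cancel the fields in direction
      \<open>axis l 1\<close>.\<close>
    have "shear_span (m + Suc e) (\<lambda>z. inverse \<kappa> *s (D (p + 1) *s (aO z (p + 1) *s axis j 1 - aO z p *s axis l 1)
        - C p *s (aS z (p + 2) *s axis j 1 - aS z (p + 1) *s axis l 1)))"
      by (intro shear_span_smult shear_span_diff Sp Op)
    moreover have "inverse \<kappa> *s (D (p + 1) *s (aO z (p + 1) *s axis j 1 - aO z p *s axis l 1)
        - C p *s (aS z (p + 2) *s axis j 1 - aS z (p + 1) *s axis l 1)) = monomial_fun \<alpha> z *s axis j 1" for z
    proof -
      have "D (p + 1) *s (aO z (p + 1) *s axis j 1 - aO z p *s axis l 1)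
        - C p *s (aS z (p + 2) *s axis j 1 - aS z (p + 1) *s axis l 1) = (\<kappa> * monomial_fun \<alpha> z) *s axis j 1"
        unfolding aS aO \<kappa>_def vec_eq_iff by (simp add: algebra_simps)
      then show ?thesis using \<kappa> by (simp add: vector_smult_assoc mult.assoc[symmetric])
    qed
    ultimately show ?thesis unfolding K by simp
  qed
qed

text \<open>The additional factor \<open>monomial_fun \<beta>\<close> collects the coordinates that
  the recursion of \<open>hom_poly\<close> splits off, so that every branch ends in a single
  monomial.\<close>

lemma shear_span_hom_poly_axis:
  fixes j :: "'n::finite" and p :: "complex^'n \<Rightarrow> complex"
  assumes card: "CARD('n) \<ge> 2" and p: "hom_poly k p"
  shows "shear_span (k + (\<Sum>i\<in>UNIV. \<beta> i)) (\<lambda>z. (monomial_fun \<beta> z * p z) *s axis j 1)"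
  using p
proof (induction arbitrary: \<beta> rule: hom_poly.induct)
  case (hom_poly_const c)
  have "shear_span (\<Sum>i\<in>UNIV. \<beta> i) (\<lambda>z. c *s (monomial_fun \<beta> z *s axis j 1))"
    by (intro shear_span_smult shear_span_monomial card)
  then show ?case by (simp add: vector_smult_assoc mult.commute)
next
  case (hom_poly_step k q)
  have "shear_span (k + (\<Sum>i\<in>UNIV. (\<beta>(l := Suc (\<beta> l))) i)) (\<lambda>z. (monomial_fun (\<beta>(l := Suc (\<beta> l))) z * q l z) *s axis j 1)" for l
    by (rule hom_poly_step)
  moreover have "k + (\<Sum>i\<in>UNIV. (\<beta>(l := Suc (\<beta> l))) i) = Suc k + (\<Sum>i\<in>UNIV. \<beta> i)" for l
    using sum_remove_exponent[of \<beta> l] sum_remove_exponent[of "\<beta>(l := Suc (\<beta> l))" l] by simp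
  ultimately have "shear_span (Suc k + (\<Sum>i\<in>UNIV. \<beta> i)) (\<lambda>z. \<Sum>l\<in>UNIV. (monomial_fun (\<beta>(l := Suc (\<beta> l))) z * q l z) *s axis j 1)"
    by (intro shear_span_sum) auto
  moreover have "(\<Sum>l\<in>UNIV. (monomial_fun (\<beta>(l := Suc (\<beta> l))) z * q l z) *s axis j 1)
      = (monomial_fun \<beta> z * (\<Sum>l\<in>UNIV. z $ l * q l z)) *s axis j 1" for z
    by (simp add: monomial_fun_Suc vec_eq_iff sum_distrib_left sum_distrib_right mult_ac)
  ultimately show ?case by (simp only:)
qed

lemma shear_span_hom_poly:
  fixes X :: "complex^'n \<Rightarrow> complex^'n"
  assumes card: "CARD('n) \<ge> 2" and X: "\<And>j. hom_poly k (\<lambda>z. X z $ j)"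
  shows "shear_span k X"
proof -
  have "shear_span k (\<lambda>z. (X z $ j) *s axis j 1)" for j
    using shear_span_hom_poly_axis[OF card X[of j], of "\<lambda>_. 0" j] by (simp add: monomial_fun_def)
  then have "shear_span k (\<lambda>z. \<Sum>j\<in>UNIV. (X z $ j) *s axis j 1)"
    by (intro shear_span_sum) auto
  then show ?thesis using vec_eq_sum_axis[of "X _"] by simp
qed

subsection \<open>Prescribing jets by automorphisms\<close>

text \<open>Dividing by \<open>norm w\<close> moves \<open>w\<close> to the unit sphere and, since
  \<open>norm w' \<le> 2 * norm w\<close>, moves \<open>w'\<close> into the ball of radius 2; there
  a Lipschitz constant exists, and homogeneity scales it back.\<close>

lemma homogeneous_bounds:
  fixes X :: "complex^'n \<Rightarrow> complex^'n"
  assumes X: "holomorphic_map_on X UNIV" and hom: "\<And>c z. X (c *s z) = c ^ k *s X z" and k: "k \<ge> 1"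
  obtains M where "M > 0" "\<And>w. norm (X w) \<le> M * norm w ^ k"
    "\<And>w w'. norm w' \<le> 2 * norm w \<Longrightarrow> norm (X w' - X w) \<le> M * norm w ^ (k - 1) * norm (w' - w)"
proof -
  obtain L where L: "L > 0" "\<And>x y. x \<in> cball 0 2 \<Longrightarrow> y \<in> cball 0 2 \<Longrightarrow> norm (X x - X y) \<le> L * norm (x - y)"
    using entire_lipschitz[OF X] by blast
  have X0: "X 0 = 0" using hom[of 0 0] k by (simp add: power_0_left)
  have lip: "norm (X w' - X w) \<le> L * norm w ^ (k - 1) * norm (w' - w)" if w': "norm w' \<le> 2 * norm w" for w w'
  proof (cases "w = 0")
    case True
    then show ?thesis using w' by simp
  next
    case False
    let ?c = "complex_of_real (norm w)" and ?d = "complex_of_real (1 / norm w)"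
    have c: "?c * ?d = 1" using False by simp
    have sc: "?c *s (?d *s x) = x" for x :: "complex^'n"
      unfolding vector_smult_assoc c by simp
    have "X x = ?c ^ k *s X (?d *s x)" for x
      using hom[of ?c "?d *s x"] unfolding sc .
    then have "X w' - X w = ?c ^ k *s (X (?d *s w') - X (?d *s w))"
      by (metis vector_ssub_ldistrib)
    then have "norm (X w' - X w) = norm w ^ k * norm (X (?d *s w') - X (?d *s w))"
      by (simp only: norm_smult norm_power norm_of_real abs_norm_cancel)
    also have "\<dots> \<le> norm w ^ k * (L * norm (?d *s w' - ?d *s w))"
      using False w' by (intro mult_left_mono L) (auto simp: norm_divide divide_le_eq)
    also have "?d *s w' - ?d *s w = ?d *s (w' - w)" by (simp add: vector_ssub_ldistrib)
    also have "norm w ^ k * (L * norm (?d *s (w' - w))) = L * (norm w ^ k / norm w) * norm (w' - w)"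
      by (simp only: norm_smult norm_of_real) simp
    also have "norm w ^ k / norm w = norm w ^ (k - 1)"
      using k False by (simp add: power_diff)
    finally show ?thesis .
  qed
  have "norm (X w) \<le> L * norm w ^ k" for w
    using lip[of 0 w] X0 k by (cases k) (auto simp: mult_ac)
  with L(1) lip show ?thesis using that by blast
qed

text \<open>The time-one map of a shear field: \<open>g\<close> does not change under the
  translation, so subtracting the same multiple of \<open>v\<close> inverts it.\<close>

lemma translation_along_invariant_Aut:
  fixes g :: "complex^'n \<Rightarrow> complex"
  assumes g: "hol_fun_on g UNIV" and inv: "\<And>z \<zeta>. g (z + \<zeta> *s v) = g z"
  shows "(\<lambda>z. z + g z *s v) \<in> Aut_space"
proof (rule Aut_spaceI[of _ "\<lambda>z. z + (- g z) *s v"])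
  show "holomorphic_map_on (\<lambda>z. z + g z *s v) UNIV"
    by (intro hol_map_on_add hol_map_on_id hol_map_on_smult hol_map_on_const g) auto
  have "hol_fun_on (\<lambda>z. (-1) * g z) UNIV" by (intro hol_fun_on_mult hol_fun_on_const g) auto
  then have "hol_fun_on (\<lambda>z. - g z) UNIV" by simp
  then show "holomorphic_map_on (\<lambda>z. z + (- g z) *s v) UNIV"
    by (intro hol_map_on_add hol_map_on_id hol_map_on_smult hol_map_on_const) auto
  show "z + g z *s v + (- g (z + g z *s v)) *s v = z" for z
    unfolding inv by (simp add: vec_eq_iff)
  show "z + (- g z) *s v + g (z + (- g z) *s v) *s v = z" for z
    unfolding inv by (simp add: vec_eq_iff)
qed

text \<open>The time-one map of the field \<open>(g z * z $ j) *s v\<close>: as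
  \<open>v $ j = 1\<close>, it multiplies the coordinate \<open>z $ j\<close> by
  \<open>exp (g z)\<close> and leaves \<open>g\<close> unchanged, so replacing \<open>g\<close> by
  \<open>- g\<close> inverts it.\<close>

lemma overshear_Aut:
  fixes g :: "complex^'n \<Rightarrow> complex" and v :: "complex^'n"
  assumes g: "hol_fun_on g UNIV" and inv: "\<And>z \<zeta>. g (z + \<zeta> *s v) = g z" and v: "v $ j = 1"
  shows "(\<lambda>z. z + ((exp (g z) - 1) * z $ j) *s v) \<in> Aut_space"
proof (rule Aut_spaceI[of _ "\<lambda>z. z + ((exp (- g z) - 1) * z $ j) *s v"])
  have *: "holomorphic_map_on (\<lambda>z. z + ((exp (g z) - 1) * z $ j) *s v) UNIV" if "hol_fun_on g UNIV" for g
    by (intro hol_map_on_add hol_map_on_id hol_map_on_smult hol_map_on_const hol_fun_on_mult hol_fun_on_nth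
        hol_fun_on_diff(1) hol_fun_on_exp hol_fun_on_const that) auto
  show "holomorphic_map_on (\<lambda>z. z + ((exp (g z) - 1) * z $ j) *s v) UNIV"
    by (rule *[OF g])
  have "hol_fun_on (\<lambda>z. (-1) * g z) UNIV" by (intro hol_fun_on_mult hol_fun_on_const g) auto
  then have "hol_fun_on (\<lambda>z. - g z) UNIV" by simp
  then show "holomorphic_map_on (\<lambda>z. z + ((exp (- g z) - 1) * z $ j) *s v) UNIV"
    by (rule *)
  have **: "z + ((exp a - 1) * z $ j) *s v + ((exp (- a) - 1) * (z + ((exp a - 1) * z $ j) *s v) $ j) *s v = z" for a z
    by (simp only: vec_eq_iff vector_add_component vector_smult_component v) (simp add: exp_minus field_simps)
  show "z + ((exp (g z) - 1) * z $ j) *s v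
      + ((exp (- g (z + ((exp (g z) - 1) * z $ j) *s v)) - 1) * (z + ((exp (g z) - 1) * z $ j) *s v) $ j) *s v = z" for z
    unfolding inv by (rule **)
  show "z + ((exp (- g z) - 1) * z $ j) *s v
      + ((exp (g (z + ((exp (- g z) - 1) * z $ j) *s v)) - 1) * (z + ((exp (- g z) - 1) * z $ j) *s v) $ j) *s v = z" for z
    unfolding inv using **[of z "- g z"] by simp
qed

text \<open>Meant for \<open>X\<close> homogeneous of degree \<open>k\<close>: an automorphism with
  jet \<open>id + X\<close> and an error of the next order. After a dilation it also supplies Euler
  steps, so one notion serves both the prescription of jets and the approximation of flows.\<close>

definition jet_realizable :: "nat \<Rightarrow> (complex^'n \<Rightarrow> complex^'n) \<Rightarrow> bool" where
  "jet_realizable k X \<longleftrightarrow> (\<exists>\<Psi>\<in>Aut_space. \<exists>C \<rho>. \<rho> > 0 \<and>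
     (\<forall>w. norm w \<le> \<rho> \<longrightarrow> norm (\<Psi> w - w - X w) \<le> C * norm w ^ Suc k))"

text \<open>The error \<open>exp g - 1 - g\<close> is of order \<open>2 * k\<close>; with the factor
  \<open>w $ j\<close> it becomes \<open>2 * k + 1\<close>, which is at least \<open>k + 2\<close>
  because \<open>k \<ge> 1\<close>.\<close>

lemma jet_realizable_overshear:
  fixes g :: "complex^'n \<Rightarrow> complex" and v :: "complex^'n"
  assumes g: "hol_fun_on g UNIV" and inv: "\<And>z \<zeta>. g (z + \<zeta> *s v) = g z"
    and hom: "\<And>c z. g (c *s z) = c ^ k * g z" and v: "v $ j = 1" and k: "k \<ge> 1"
  shows "jet_realizable (Suc k) (\<lambda>z. (g z * z $ j) *s v)"
proof -
  have "holomorphic_map_on (\<lambda>z. g z *s v) UNIV"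
    using g by (intro hol_map_on_smult hol_map_on_const) auto
  from homogeneous_bounds[OF this _ k]
  obtain M where M: "M > 0" "\<And>w. norm (g w *s v) \<le> M * norm w ^ k"
    by (metis hom vector_smult_assoc)
  have "norm (v $ j) \<le> norm v" by (rule Finite_Cartesian_Product.norm_nth_le)
  then have nv: "norm v \<ge> 1" by (simp add: v)
  have gM: "norm (g w) \<le> M * norm w ^ k" for w
    using M(2)[of w] mult_left_mono[OF nv norm_ge_zero[of "g w"]] by simp
  \<comment> \<open>For \<open>norm w \<le> \<rho>\<close> this gives
    \<open>norm (g w) \<le> 1\<close>, so the exponential in the Taylor remainder is at most
    3.\<close>
  define \<rho> where "\<rho> = min 1 (1 / M)"
  have \<rho>: "\<rho> > 0" "\<rho> \<le> 1" "M * \<rho> \<le> 1" using M(1) by (auto simp: \<rho>_def min_def field_simps)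
  show ?thesis
    unfolding jet_realizable_def
  proof (rule bexI[of _ "\<lambda>z. z + ((exp (g z) - 1) * z $ j) *s v"], rule exI[of _ "3 * M\<^sup>2 * norm v"],
      rule exI[of _ \<rho>], intro conjI \<rho>(1) allI impI)
    fix w :: "complex^'n" assume w: "norm w \<le> \<rho>"
    have w1: "norm w \<le> 1" using w \<rho> by simp
    have "norm w ^ k \<le> norm w ^ 1" by (rule power_decreasing[OF k]) (use w1 in auto)
    then have "M * norm w ^ k \<le> M * \<rho>" using M(1) w by (intro mult_left_mono) auto
    then have g1: "norm (g w) \<le> 1" using gM[of w] \<rho> by linarith
    have "norm (exp (g w) - (\<Sum>i\<le>1. g w ^ i / fact i)) \<le> exp (norm (g w)) * (norm (g w) ^ Suc 1) / fact 1"
      by (rule Taylor_exp_field)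
    then have "norm (exp (g w) - 1 - g w) \<le> exp (norm (g w)) * norm (g w) ^ 2"
      by (simp add: algebra_simps numeral_2_eq_2)
    also have "\<dots> \<le> 3 * norm (g w) ^ 2"
    proof (intro mult_right_mono)
      have "exp (norm (g w)) \<le> exp 1" using g1 by simp
      also have "\<dots> \<le> (3 :: real)" by (rule exp_le)
      finally show "exp (norm (g w)) \<le> 3" .
    qed simp
    also have "norm (g w) ^ 2 \<le> (M * norm w ^ k) ^ 2"
      by (intro power_mono gM) auto
    finally have e: "norm (exp (g w) - 1 - g w) \<le> 3 * (M * norm w ^ k)\<^sup>2" by simp
    have "w + ((exp (g w) - 1) * w $ j) *s v - w - (g w * w $ j) *s v = ((exp (g w) - 1 - g w) * w $ j) *s v"
      by (simp add: vec_eq_iff algebra_simps)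
    then have "norm (w + ((exp (g w) - 1) * w $ j) *s v - w - (g w * w $ j) *s v)
        = norm (exp (g w) - 1 - g w) * norm (w $ j) * norm v" by (simp add: norm_mult)
    also have "\<dots> \<le> 3 * (M * norm w ^ k)\<^sup>2 * norm w * norm v"
      by (intro mult_right_mono mult_mono e Finite_Cartesian_Product.norm_nth_le) auto
    also have "\<dots> = 3 * M\<^sup>2 * norm v * norm w ^ (2 * k + 1)"
      by (simp add: power_mult_distrib power_mult[symmetric] mult_ac)
    also have "\<dots> \<le> 3 * M\<^sup>2 * norm v * norm w ^ Suc (Suc k)"
      using k w1 by (intro mult_left_mono power_decreasing) auto
    finally show "norm (w + ((exp (g w) - 1) * w $ j) *s v - w - (g w * w $ j) *s v)
        \<le> 3 * M\<^sup>2 * norm v * norm w ^ Suc (Suc k)" .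
  qed (rule overshear_Aut[OF g inv v])
qed

text \<open>The composition works: \<open>\<Psi>\<close> moves \<open>w\<close> by order
  \<open>k\<close> and \<open>X\<close> has local Lipschitz constant of order \<open>k - 1\<close>,
  so the mixed error has order \<open>2 * k - 1\<close>, which is at least \<open>k + 1\<close>
  because \<open>k \<ge> 2\<close>.\<close>

lemma jet_realizable_add:
  fixes X Y :: "complex^'n \<Rightarrow> complex^'n"
  assumes X: "holomorphic_map_on X UNIV" "\<And>c z. X (c *s z) = c ^ k *s X z" "jet_realizable k X"
    and Y: "holomorphic_map_on Y UNIV" "\<And>c z. Y (c *s z) = c ^ k *s Y z" "jet_realizable k Y"
    and k: "k \<ge> 2"
  shows "jet_realizable k (\<lambda>z. X z + Y z)"
proof -
  obtain \<Phi> C1 \<rho>1 where \<Phi>: "\<Phi> \<in> Aut_space" "\<rho>1 > 0"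
    "\<And>w. norm w \<le> \<rho>1 \<Longrightarrow> norm (\<Phi> w - w - X w) \<le> C1 * norm w ^ Suc k"
    using X(3) unfolding jet_realizable_def by blast
  obtain \<Psi> C2 \<rho>2 where \<Psi>: "\<Psi> \<in> Aut_space" "\<rho>2 > 0"
    "\<And>w. norm w \<le> \<rho>2 \<Longrightarrow> norm (\<Psi> w - w - Y w) \<le> C2 * norm w ^ Suc k"
    using Y(3) unfolding jet_realizable_def by blast
  have k1: "k \<ge> 1" using k by simp
  obtain M where M: "M > 0" "\<And>w w'. norm w' \<le> 2 * norm w \<Longrightarrow> norm (X w' - X w) \<le> M * norm w ^ (k - 1) * norm (w' - w)"
    using homogeneous_bounds[OF X(1,2) k1] by metis
  obtain N where N: "N > 0" "\<And>w. norm (Y w) \<le> N * norm w ^ k"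
    using homogeneous_bounds[OF Y(1,2) k1] by metis
  define D where "D = N + \<bar>C2\<bar>"
  have D: "D > 0" using N by (simp add: D_def)
  \<comment> \<open>\<open>1 / D\<close> makes the displacement by \<open>\<Psi>\<close> at most
    \<open>norm w\<close>; then \<open>norm w' \<le> 2 * norm w\<close>, and
    \<open>\<rho>1 / 2\<close> keeps \<open>w'\<close> where \<open>\<Phi>\<close> is
    controlled.\<close>
  define \<rho> where "\<rho> = Min {1, \<rho>1 / 2, \<rho>2, 1 / D}"
  have \<rho>: "\<rho> > 0" "\<rho> \<le> 1" "\<rho> \<le> \<rho>1 / 2" "\<rho> \<le> \<rho>2" "\<rho> \<le> 1 / D"
    using \<Phi>(2) \<Psi>(2) D by (auto simp: \<rho>_def)
  show ?thesis
    unfolding jet_realizable_def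
  proof (rule bexI[of _ "\<lambda>z. \<Phi> (\<Psi> z)"], rule exI[of _ "\<bar>C1\<bar> * 2 ^ Suc k + M * D + \<bar>C2\<bar>"],
      rule exI[of _ \<rho>], intro conjI \<rho>(1) allI impI)
    fix w :: "complex^'n" assume w: "norm w \<le> \<rho>"
    define w' where "w' = \<Psi> w"
    have w1: "norm w \<le> 1" using w \<rho> by simp
    have e2: "norm (w' - w - Y w) \<le> \<bar>C2\<bar> * norm w ^ Suc k"
    proof -
      have "norm (w' - w - Y w) \<le> C2 * norm w ^ Suc k" unfolding w'_def using w \<rho> by (intro \<Psi>(3)) simp
      also have "\<dots> \<le> \<bar>C2\<bar> * norm w ^ Suc k" by (intro mult_right_mono) auto
      finally show ?thesis .
    qed
    have "norm (w' - w) \<le> norm (w' - w - Y w) + norm (Y w)"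
      using norm_triangle_ineq[of "w' - w - Y w" "Y w"] by simp
    also have "\<dots> \<le> \<bar>C2\<bar> * norm w ^ Suc k + N * norm w ^ k"
      using e2 N(2)[of w] by linarith
    also have "\<bar>C2\<bar> * norm w ^ Suc k \<le> \<bar>C2\<bar> * norm w ^ k"
      using w1 by (intro mult_left_mono power_decreasing) auto
    finally have d: "norm (w' - w) \<le> D * norm w ^ k" by (simp add: D_def algebra_simps)
    have "D * norm w ^ k \<le> D * norm w ^ 2"
      using w1 D k by (intro mult_left_mono power_decreasing) auto
    also have "\<dots> = (D * norm w) * norm w" by (simp add: power2_eq_square)
    also have "\<dots> \<le> 1 * norm w"
    proof (intro mult_right_mono)
      have "norm w \<le> 1 / D" using w \<rho> by simp
      then show "D * norm w \<le> 1" using D by (simp add: field_simps)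
    qed simp
    finally have "norm (w' - w) \<le> norm w" using d by simp
    then have w'2: "norm w' \<le> 2 * norm w" using norm_triangle_ineq[of "w' - w" w] by simp
    have e1: "norm (\<Phi> w' - w' - X w') \<le> \<bar>C1\<bar> * 2 ^ Suc k * norm w ^ Suc k"
    proof -
      have "norm (\<Phi> w' - w' - X w') \<le> C1 * norm w' ^ Suc k" using w w'2 \<rho> by (intro \<Phi>(3)) simp
      also have "\<dots> \<le> \<bar>C1\<bar> * norm w' ^ Suc k" by (intro mult_right_mono) auto
      also have "\<dots> \<le> \<bar>C1\<bar> * (2 * norm w) ^ Suc k" using w'2 by (intro mult_left_mono power_mono) auto
      finally show ?thesis by (simp only: power_mult_distrib mult.assoc)
    qed
    have "norm (X w' - X w) \<le> M * norm w ^ (k - 1) * norm (w' - w)" by (rule M(2)[OF w'2])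
    also have "\<dots> \<le> M * norm w ^ (k - 1) * (D * norm w ^ k)"
      using M by (intro mult_left_mono d) auto
    also have "\<dots> = M * D * norm w ^ (k - 1 + k)" by (simp add: power_add mult_ac)
    also have "\<dots> \<le> M * D * norm w ^ Suc k"
      using M D w1 k by (intro mult_left_mono power_decreasing) auto
    finally have e3: "norm (X w' - X w) \<le> M * D * norm w ^ Suc k" .
    have "\<Phi> (\<Psi> w) - w - (X w + Y w) = (\<Phi> w' - w' - X w') + (X w' - X w) + (w' - w - Y w)"
      by (simp add: w'_def)
    then have "norm (\<Phi> (\<Psi> w) - w - (X w + Y w)) = norm ((\<Phi> w' - w' - X w') + (X w' - X w) + (w' - w - Y w))"
      by (simp only:)
    also have "\<dots> \<le> norm (\<Phi> w' - w' - X w') + norm (X w' - X w) + norm (w' - w - Y w)"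
      using norm_triangle_ineq[of "(\<Phi> w' - w' - X w') + (X w' - X w)" "w' - w - Y w"]
        norm_triangle_ineq[of "\<Phi> w' - w' - X w'" "X w' - X w"] by linarith
    also have "\<dots> \<le> (\<bar>C1\<bar> * 2 ^ Suc k + M * D + \<bar>C2\<bar>) * norm w ^ Suc k"
      using e1 e2 e3 by (simp add: distrib_right del: power_Suc)
    finally show "norm (\<Phi> (\<Psi> w) - w - (X w + Y w)) \<le> (\<bar>C1\<bar> * 2 ^ Suc k + M * D + \<bar>C2\<bar>) * norm w ^ Suc k" .
  qed (rule Aut_space_compose[OF \<Phi>(1) \<Psi>(1)])
qed

text \<open>Holomorphy and homogeneity are carried along because \<open>jet_realizable_add\<close>
  needs them of both summands. Shears realise their jet without error; for overshears
  \<open>k \<ge> 2\<close> leaves degree at least 1 for the factor \<open>g\<close>.\<close>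

lemma jet_realizable_shear_span:
  assumes "shear_span k X" "k \<ge> 2"
  shows "holomorphic_map_on X UNIV \<and> (\<forall>c z. X (c *s z) = c ^ k *s X z) \<and> jet_realizable k X"
  using assms
proof (induction rule: shear_span.induct)
  case (shear g v k)
  have "jet_realizable k (\<lambda>z. g z *s v)"
    unfolding jet_realizable_def
    by (rule bexI[OF _ translation_along_invariant_Aut[OF shear(1,2)]]) (auto intro!: exI[of _ 0] exI[of _ 1])
  then show ?case
    using shear by (auto simp: vector_smult_assoc intro!: hol_map_on_smult hol_map_on_const)
next
  case (overshear g v k j)
  then have "jet_realizable (Suc k) (\<lambda>z. (g z * z $ j) *s v)"
    by (intro jet_realizable_overshear) auto
  then show ?case
    using overshear
    by (auto simp: vector_smult_assoc mult_ac intro!: hol_map_on_smult hol_map_on_const hol_fun_on_mult hol_fun_on_nth)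
next
  case (add k X Y)
  then show ?case
    by (auto simp: vector_add_ldistrib intro!: hol_map_on_add jet_realizable_add)
qed

section \<open>Taylor parts of mappings and correction of jets\<close>

definition hpart_map :: "(complex^'n \<Rightarrow> complex^'n) \<Rightarrow> nat \<Rightarrow> complex^'n \<Rightarrow> complex^'n" where
  "hpart_map f k z = (\<chi> i. hpart (\<lambda>z. f z $ i) k z)"

lemma hpart_map_simps:
  fixes f :: "complex^'n \<Rightarrow> complex^'n"
  assumes f: "holomorphic_map_on f S" "0 \<in> S"
  shows "hom_poly k (\<lambda>z. hpart_map f k z $ i)"
    and "hpart_map f 0 z = f 0"
    and "hpart_map f 1 z = fd f 0 z"
proof -
  have fi: "hol_fun_on (\<lambda>z. f z $ i) S" for i using f hol_map_on_componentwise by blast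
  show "hom_poly k (\<lambda>z. hpart_map f k z $ i)" using hom_poly_hpart[OF fi f(2)] by (simp add: hpart_map_def)
  show "hpart_map f 0 z = f 0" by (simp add: hpart_map_def hpart_0 vec_eq_iff)
  show "hpart_map f 1 z = fd f 0 z"
    using hpart_1[OF fi f(2)] hol_map_on_fd_nth[OF f] by (simp add: hpart_map_def vec_eq_iff)
qed

lemma norm_vec_le_component:
  fixes x :: "complex^'n"
  assumes "\<And>i. norm (x $ i) \<le> B"
  shows "norm x \<le> real CARD('n) * B"
proof -
  have "norm x \<le> (\<Sum>i\<in>UNIV. norm (x $ i))" by (simp add: norm_vec_def L2_set_le_sum)
  also have "\<dots> \<le> real CARD('n) * B" using assms by (intro sum_bounded_above) auto
  finally show ?thesis .
qed

lemma taylor_remainder_map: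
  fixes f :: "complex^'n \<Rightarrow> complex^'n"
  assumes f: "holomorphic_map_on f S" "cball 0 \<rho> \<subseteq> S" and M: "\<And>z. z \<in> cball 0 \<rho> \<Longrightarrow> norm (f z) \<le> M"
    and r: "r > 1" "r * norm u \<le> \<rho>"
  shows "norm (f u - (\<Sum>k<K. hpart_map f k u)) \<le> real CARD('n) * (M * (1 / r) ^ K / (1 - 1 / r))"
proof (rule norm_vec_le_component)
  fix i
  have fi: "hol_fun_on (\<lambda>z. f z $ i) S" using f(1) hol_map_on_componentwise by blast
  have "norm (f z $ i) \<le> M" if "z \<in> cball 0 \<rho>" for z
    using M[OF that] Finite_Cartesian_Product.norm_nth_le[of "f z" i] by linarith
  from taylor_remainder[OF fi f(2) this r]
  show "norm ((f u - (\<Sum>k<K. hpart_map f k u)) $ i) \<le> M * (1 / r) ^ K / (1 - 1 / r)"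
    by (simp add: hpart_map_def)
qed

lemma taylor_remainder2_map:
  fixes f :: "complex^'n \<Rightarrow> complex^'n"
  assumes f: "holomorphic_map_on f S" "cball 0 \<rho> \<subseteq> S" and M: "\<And>z. z \<in> cball 0 \<rho> \<Longrightarrow> norm (f z) \<le> M"
    and u: "norm u \<le> \<rho> / 2" and \<rho>: "\<rho> > 0"
  shows "norm (f u - (\<Sum>k<K. hpart_map f k u)) \<le> real CARD('n) * (2 * M * (norm u / \<rho>) ^ K)"
proof (rule norm_vec_le_component)
  fix i
  have fi: "hol_fun_on (\<lambda>z. f z $ i) S" using f(1) hol_map_on_componentwise by blast
  have "norm (f z $ i) \<le> M" if "z \<in> cball 0 \<rho>" for z
    using M[OF that] Finite_Cartesian_Product.norm_nth_le[of "f z" i] by linarith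
  from taylor_remainder2[OF fi f(2) this u \<rho>]
  show "norm ((f u - (\<Sum>k<K. hpart_map f k u)) $ i) \<le> 2 * M * (norm u / \<rho>) ^ K"
    by (simp add: hpart_map_def)
qed

lemma nonpos_if_le_linear:
  fixes x :: real
  assumes "\<rho> > 0" "B \<ge> 0" "\<And>s. 0 < s \<Longrightarrow> s \<le> \<rho> \<Longrightarrow> x \<le> B * s"
  shows "x \<le> 0"
proof (rule field_le_epsilon)
  fix e :: real assume e: "e > 0"
  define s where "s = min \<rho> (e / (B + 1))"
  have s: "0 < s" "s \<le> \<rho>" "s \<le> e / (B + 1)" using assms(1,2) e by (auto simp: s_def)
  have "x \<le> B * s" by (rule assms(3)[OF s(1,2)])
  also have "\<dots> \<le> (B + 1) * s" using s by simp
  also have "\<dots> \<le> e" using s(3) assms(2) by (simp add: field_simps)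
  finally show "x \<le> 0 + e" by simp
qed

text \<open>Cauchy's inequality on the circle of radius \<open>s / norm u\<close> bounds the part of
  degree \<open>k\<close> by a multiple of \<open>s ^ (K - k)\<close>, and \<open>s\<close> is
  arbitrarily small.\<close>

lemma hpart_vanish:
  assumes f: "hol_fun_on f S" "cball 0 \<rho> \<subseteq> S" "\<rho> > 0"
    and C: "\<And>w. norm w \<le> \<rho> \<Longrightarrow> norm (f w) \<le> C * norm w ^ K" and k: "k < K"
  shows "hpart f k u = 0"
proof (cases "u = 0")
  case True
  then show ?thesis using C[of 0] f(3) k by (auto simp: hpart_at_0 power_0_left)
next
  case False
  have "norm (hpart f k u) \<le> (\<bar>C\<bar> * norm u ^ k) * s" if s: "0 < s" "s \<le> min 1 \<rho>" for s
  proof -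
    have sub: "cball 0 s \<subseteq> S" using f(2) s by (auto simp: subset_iff)
    have "norm (hpart f k u) \<le> (\<bar>C\<bar> * s ^ K) / (s / norm u) ^ k"
    proof (rule hpart_bound[OF f(1) sub])
      fix z :: "complex^'a" assume z: "z \<in> cball 0 s"
      then have "norm (f z) \<le> C * norm z ^ K" using s by (intro C) simp
      also have "\<dots> \<le> \<bar>C\<bar> * norm z ^ K" by (intro mult_right_mono) auto
      also have "\<dots> \<le> \<bar>C\<bar> * s ^ K" using z by (intro mult_left_mono power_mono) auto
      finally show "norm (f z) \<le> \<bar>C\<bar> * s ^ K" .
    qed (use s False in auto)
    also have "\<dots> = (\<bar>C\<bar> * norm u ^ k) * s ^ (K - k)"
      using k s by (simp add: power_divide power_diff field_simps)
    also have "\<dots> \<le> (\<bar>C\<bar> * norm u ^ k) * s ^ 1"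
      using k s by (intro mult_left_mono power_decreasing) auto
    finally show ?thesis by simp
  qed
  then have "norm (hpart f k u) \<le> 0"
    using f(3) by (intro nonpos_if_le_linear[of "min 1 \<rho>" "\<bar>C\<bar> * norm u ^ k"]) auto
  then show ?thesis by simp
qed

text \<open>Induction on the order of contact, measured by how close \<open>F' \<circ> f\<close> is
  to the identity. Its lowest nontrivial part \<open>X\<close> has degree \<open>K\<close>; a
  realisation \<open>\<Psi>\<close> of \<open>id + X\<close> is composed to \<open>F\<close> on the
  inside and removes that part.\<close>

lemma jet_approximation:
  fixes f :: "complex^'n \<Rightarrow> complex^'n"
  assumes card: "CARD('n) \<ge> 2" and f: "holomorphic_map_on f S" "0 \<in> S" "f 0 = 0" "\<And>v. fd f 0 v = v"
    and K: "K \<ge> 2"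
  shows "\<exists>F F' C \<rho>. F \<in> Aut_space \<and> holomorphic_map_on F' UNIV \<and> (\<forall>z. F' (F z) = z) \<and> (\<forall>z. F (F' z) = z)
    \<and> \<rho> > 0 \<and> C \<ge> 0 \<and> cball 0 \<rho> \<subseteq> S \<and> (\<forall>w. norm w \<le> \<rho> \<longrightarrow> norm (F' (f w) - w) \<le> C * norm w ^ K)"
  using K
proof (induction K rule: nat_induct_at_least)
  case base
  obtain \<rho> where \<rho>: "\<rho> > 0" "cball 0 \<rho> \<subseteq> S"
    using f(2) hol_map_on_open[OF f(1)] open_contains_cball by blast
  obtain M where M: "M > 0" "\<And>w. norm w \<le> \<rho> \<Longrightarrow> norm (f w) \<le> M"
    using hol_map_on_bounded_cball[OF f(1) \<rho>(2)] by metis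
  have "norm (f w - w) \<le> (2 * M / \<rho>\<^sup>2) * norm w ^ 2" if "norm w \<le> \<rho> / 2" for w
    using second_order_bound_map[OF f(1) \<rho>(2) _ that \<rho>(1), of M] M(2) f(3,4) by (simp add: power_divide)
  moreover have "(\<lambda>z. z) \<in> Aut_space"
    by (rule Aut_spaceI[of _ "\<lambda>z. z"]) (auto intro: hol_map_on_id)
  moreover have "cball 0 (\<rho> / 2) \<subseteq> S" using \<rho> by (auto simp: subset_iff)
  ultimately show ?case
    using \<rho>(1) M(1)
    by (rule_tac exI[of _ "\<lambda>z. z"], rule_tac exI[of _ "\<lambda>z. z"], rule_tac exI[of _ "2 * M / \<rho>\<^sup>2"],
        rule_tac exI[of _ "\<rho> / 2"]) (auto intro: hol_map_on_id)
next
  case (Suc K)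
  then obtain F F' C \<rho> where F: "F \<in> Aut_space" "holomorphic_map_on F' UNIV" "\<And>z. F' (F z) = z" "\<And>z. F (F' z) = z"
    and \<rho>: "\<rho> > 0" "C \<ge> 0" "cball 0 \<rho> \<subseteq> S" "\<And>w. norm w \<le> \<rho> \<Longrightarrow> norm (F' (f w) - w) \<le> C * norm w ^ K"
    by blast
  define G where "G w = F' (f w)" for w
  define D where "D w = G w - w" for w
  have G: "holomorphic_map_on G S"
    unfolding G_def by (rule hol_map_on_compose(1)[OF F(2) f(1)]) auto
  have D: "holomorphic_map_on D S"
    unfolding D_def by (intro hol_map_on_diff G hol_map_on_id hol_map_on_open[OF G])
  have DC: "norm (D w) \<le> C * norm w ^ K" if "norm w \<le> \<rho>" for w
    using \<rho>(4)[OF that] by (simp add: D_def G_def)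
  define X where "X = hpart_map D K"
  \<comment> \<open>Contact of order \<open>K\<close> kills all lower parts, so the Taylor
    polynomial of \<open>D\<close> of degree \<open>K\<close> is \<open>X\<close> alone.\<close>
  have "hpart_map D k w = 0" if "k < K" for k w
  proof -
    have "hpart (\<lambda>z. D z $ i) k w = 0" for i
    proof (rule hpart_vanish[OF _ \<rho>(3,1) _ that])
      show "hol_fun_on (\<lambda>z. D z $ i) S" using D hol_map_on_componentwise by blast
      show "norm (D w $ i) \<le> C * norm w ^ K" if "norm w \<le> \<rho>" for w
        using DC[OF that] Finite_Cartesian_Product.norm_nth_le[of "D w" i] by linarith
    qed
    then show ?thesis by (simp add: hpart_map_def vec_eq_iff)
  qed
  then have sumX: "(\<Sum>k<Suc K. hpart_map D k w) = X w" for w by (simp add: X_def)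
  define B where "B = real CARD('n) * (2 * (C * \<rho> ^ K) / \<rho> ^ Suc K)"
  have B0: "B \<ge> 0" unfolding B_def using \<rho> by simp
  have DX: "norm (D w - X w) \<le> B * norm w ^ Suc K" if w: "norm w \<le> \<rho> / 2" for w
  proof -
    have "norm (D z) \<le> C * \<rho> ^ K" if "z \<in> cball 0 \<rho>" for z
    proof -
      have "norm (D z) \<le> C * norm z ^ K" using that by (intro DC) simp
      also have "\<dots> \<le> C * \<rho> ^ K" using that \<rho>(2) by (intro mult_left_mono power_mono) auto
      finally show ?thesis .
    qed
    from taylor_remainder2_map[OF D \<rho>(3) this w \<rho>(1), of "Suc K"]
    show ?thesis unfolding sumX B_def by (simp add: power_divide del: power_Suc)
  qed
  have "0 \<in> S" by (rule f(2))
  then have "shear_span K X"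
    unfolding X_def by (intro shear_span_hom_poly card hpart_map_simps(1)[OF D])
  then have "jet_realizable K X" using jet_realizable_shear_span Suc.hyps by blast
  then obtain \<Psi> C' \<rho>' where \<Psi>: "\<Psi> \<in> Aut_space" "\<rho>' > 0"
    "\<And>w. norm w \<le> \<rho>' \<Longrightarrow> norm (\<Psi> w - w - X w) \<le> C' * norm w ^ Suc K"
    unfolding jet_realizable_def by blast
  obtain \<Psi>' where \<Psi>': "holomorphic_map_on \<Psi> UNIV" "holomorphic_map_on \<Psi>' UNIV" "\<And>z. \<Psi>' (\<Psi> z) = z" "\<And>z. \<Psi> (\<Psi>' z) = z"
    using Aut_spaceE[OF \<Psi>(1)] by metis
  \<comment> \<open>A ball containing the images under both \<open>G\<close> and
    \<open>\<Psi>\<close>: on it \<open>\<Psi>'\<close> is Lipschitz, and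
    \<open>\<Psi>' (G w) - w\<close> is the difference of \<open>\<Psi>'\<close> at
    \<open>G w\<close> and at \<open>\<Psi> w\<close>.\<close>
  have "compact (G ` cball 0 \<rho> \<union> \<Psi> ` cball 0 \<rho>)"
    using hol_map_on_continuous[OF G] hol_map_on_continuous[OF \<Psi>'(1)] \<rho>(3)
    by (intro compact_Un compact_continuous_image compact_cball) (auto intro: continuous_on_subset)
  then obtain R where R: "\<And>x. x \<in> G ` cball 0 \<rho> \<union> \<Psi> ` cball 0 \<rho> \<Longrightarrow> norm x \<le> R"
    by (metis bounded_pos compact_imp_bounded)
  obtain L where L: "L > 0" "\<And>x y. x \<in> cball 0 R \<Longrightarrow> y \<in> cball 0 R \<Longrightarrow> norm (\<Psi>' x - \<Psi>' y) \<le> L * norm (x - y)"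
    using entire_lipschitz[OF \<Psi>'(2)] by blast
  define \<rho>'' where "\<rho>'' = min (\<rho> / 2) \<rho>'"
  have \<rho>'': "\<rho>'' > 0" "\<rho>'' \<le> \<rho> / 2" "\<rho>'' \<le> \<rho>'" using \<rho>(1) \<Psi>(2) by (auto simp: \<rho>''_def)
  have "norm (\<Psi>' (F' (f w)) - w) \<le> (L * (B + \<bar>C'\<bar>)) * norm w ^ Suc K" if w: "norm w \<le> \<rho>''" for w
  proof -
    have w\<rho>: "w \<in> cball 0 \<rho>" using w \<rho>''(2) \<rho>(1) by simp
    have "norm (\<Psi>' (G w) - \<Psi>' (\<Psi> w)) \<le> L * norm (G w - \<Psi> w)"
      using R w\<rho> by (intro L(2)) auto
    also have "norm (G w - \<Psi> w) \<le> norm (D w - X w) + norm (\<Psi> w - w - X w)"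
      using norm_triangle_ineq4[of "D w - X w" "\<Psi> w - w - X w"] by (simp add: D_def algebra_simps)
    also have "norm (D w - X w) \<le> B * norm w ^ Suc K"
      using w \<rho>'' by (intro DX) simp
    also have "norm (\<Psi> w - w - X w) \<le> C' * norm w ^ Suc K"
      using w \<rho>'' by (intro \<Psi>(3)) simp
    also have "C' * norm w ^ Suc K \<le> \<bar>C'\<bar> * norm w ^ Suc K" by (intro mult_right_mono) auto
    finally show ?thesis
      using L(1) by (simp add: \<Psi>'(3) G_def algebra_simps del: power_Suc)
  qed
  moreover have "cball 0 \<rho>'' \<subseteq> S" using \<rho>(3) \<rho>''(2) \<rho>(1) by (auto simp: subset_iff)
  moreover have "(\<lambda>z. F (\<Psi> z)) \<in> Aut_space" by (rule Aut_space_compose[OF F(1) \<Psi>(1)])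
  moreover have "holomorphic_map_on (\<lambda>z. \<Psi>' (F' z)) UNIV"
    by (rule hol_map_on_compose(1)[OF \<Psi>'(2) F(2)]) auto
  ultimately show ?case
    using \<rho>''(1) L(1) B0 F \<Psi>'
    by (rule_tac exI[of _ "\<lambda>z. F (\<Psi> z)"], rule_tac exI[of _ "\<lambda>z. \<Psi>' (F' z)"],
        rule_tac exI[of _ "L * (B + \<bar>C'\<bar>)"], rule_tac exI[of _ \<rho>'']) auto
qed

subsection \<open>Euler steps by automorphisms\<close>

text \<open>Unlike completeness, realising Euler steps by automorphisms up to \<open>o(s)\<close> is stable under sums.\<close>

definition euler_good :: "(complex^'n \<Rightarrow> complex^'n) \<Rightarrow> real \<Rightarrow> bool" where
  "euler_good X R \<longleftrightarrow> (\<forall>\<delta>>0. \<exists>s0>0. \<forall>s. 0 < s \<and> s < s0 \<longrightarrow>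
     (\<exists>\<Phi>\<in>Aut_space. \<forall>z. norm z \<le> R \<longrightarrow> norm (\<Phi> z - z - s *\<^sub>R X z) \<le> \<delta> * s))"

lemma euler_goodE:
  assumes "euler_good X R" "\<delta> > 0"
  obtains s0 where "s0 > 0"
    "\<And>s. 0 < s \<Longrightarrow> s < s0 \<Longrightarrow> \<exists>\<Phi>\<in>Aut_space. \<forall>z. norm z \<le> R \<longrightarrow> norm (\<Phi> z - z - s *\<^sub>R X z) \<le> \<delta> * s"
proof -
  have "\<exists>s0>0. \<forall>s. 0 < s \<and> s < s0 \<longrightarrow>
     (\<exists>\<Phi>\<in>Aut_space. \<forall>z. norm z \<le> R \<longrightarrow> norm (\<Phi> z - z - s *\<^sub>R X z) \<le> \<delta> * s)"
    using assms unfolding euler_good_def by simp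
  then show ?thesis by (elim exE conjE) (rule that, assumption, blast)
qed

text \<open>Steps for \<open>Y\<close> and \<open>X\<close> are composed. The intermediate point has
  moved by at most \<open>Q * s\<close>, so evaluating \<open>X\<close> there instead of at
  \<open>z\<close> costs \<open>O(s\<^sup>2)\<close>. The assumption on all radii pays for the
  slightly larger ball.\<close>

lemma euler_good_add:
  fixes X Y :: "complex^'n \<Rightarrow> complex^'n"
  assumes X: "holomorphic_map_on X UNIV" "\<And>R. euler_good X R" and Y: "holomorphic_map_on Y UNIV" "\<And>R. euler_good Y R"
  shows "euler_good (\<lambda>z. X z + Y z) R"
  unfolding euler_good_def
proof (intro allI impI)
  fix \<delta> :: real assume \<delta>: "\<delta> > 0"
  obtain L where L: "L > 0" "\<And>x y. x \<in> cball 0 (R + 1) \<Longrightarrow> y \<in> cball 0 (R + 1) \<Longrightarrow> norm (X x - X y) \<le> L * norm (x - y)"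
    using entire_lipschitz[OF X(1)] by blast
  obtain N where N: "N > 0" "\<And>w. norm w \<le> R \<Longrightarrow> norm (Y w) \<le> N"
    using hol_map_on_bounded_cball[OF Y(1), of R] by auto
  have \<delta>3: "\<delta> / 3 > 0" using \<delta> by simp
  obtain s1 where s1: "s1 > 0" "\<And>s. 0 < s \<Longrightarrow> s < s1 \<Longrightarrow> \<exists>\<Phi>\<in>Aut_space. \<forall>z. norm z \<le> R + 1 \<longrightarrow> norm (\<Phi> z - z - s *\<^sub>R X z) \<le> \<delta> / 3 * s"
    using euler_goodE[OF X(2)[of "R + 1"] \<delta>3] by blast
  obtain s2 where s2: "s2 > 0" "\<And>s. 0 < s \<Longrightarrow> s < s2 \<Longrightarrow> \<exists>\<Phi>\<in>Aut_space. \<forall>z. norm z \<le> R \<longrightarrow> norm (\<Phi> z - z - s *\<^sub>R Y z) \<le> \<delta> / 3 * s"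
    using euler_goodE[OF Y(2)[of R] \<delta>3] by blast
  define Q where "Q = N + \<delta> / 3"
  have Q: "Q > 0" using N \<delta> by (simp add: Q_def)
  \<comment> \<open>\<open>1 / Q\<close> keeps the intermediate point in the ball of radius
    \<open>R + 1\<close>; \<open>\<delta> / (3 * L * Q)\<close> makes the mixed error at most a
    third of the allowance.\<close>
  define s0 where "s0 = Min {s1, s2, 1 / Q, \<delta> / (3 * L * Q)}"
  have s0: "s0 > 0" "s0 \<le> s1" "s0 \<le> s2" "s0 \<le> 1 / Q" "s0 \<le> \<delta> / (3 * L * Q)"
    using s1 s2 Q \<delta> L by (auto simp: s0_def)
  show "\<exists>s0>0. \<forall>s. 0 < s \<and> s < s0 \<longrightarrow>
     (\<exists>\<Phi>\<in>Aut_space. \<forall>z. norm z \<le> R \<longrightarrow> norm (\<Phi> z - z - s *\<^sub>R (X z + Y z)) \<le> \<delta> * s)"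
  proof (intro exI[of _ s0] conjI s0(1) allI impI)
    fix s assume s: "0 < s \<and> s < s0"
    obtain \<Phi> where \<Phi>: "\<Phi> \<in> Aut_space" "\<And>z. norm z \<le> R + 1 \<Longrightarrow> norm (\<Phi> z - z - s *\<^sub>R X z) \<le> \<delta> / 3 * s"
      using s1(2)[of s] s s0 by auto
    obtain \<Psi> where \<Psi>: "\<Psi> \<in> Aut_space" "\<And>z. norm z \<le> R \<Longrightarrow> norm (\<Psi> z - z - s *\<^sub>R Y z) \<le> \<delta> / 3 * s"
      using s2(2)[of s] s s0 by auto
    have "norm (\<Phi> (\<Psi> z) - z - s *\<^sub>R (X z + Y z)) \<le> \<delta> * s" if z: "norm z \<le> R" for z
    proof -
      define w where "w = \<Psi> z"
      have e2: "norm (w - z - s *\<^sub>R Y z) \<le> \<delta> / 3 * s" using \<Psi>(2)[OF z] by (simp add: w_def)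
      have "norm (w - z) \<le> norm (w - z - s *\<^sub>R Y z) + norm (s *\<^sub>R Y z)"
        using norm_triangle_ineq[of "w - z - s *\<^sub>R Y z" "s *\<^sub>R Y z"] by simp
      also have "\<dots> \<le> \<delta> / 3 * s + s * N"
      proof -
        have "norm (s *\<^sub>R Y z) \<le> s * N" using s N(2)[OF z] by (simp add: mult_left_mono)
        then show ?thesis using e2 by linarith
      qed
      finally have d: "norm (w - z) \<le> Q * s" by (simp add: Q_def algebra_simps)
      have "s \<le> 1 / Q" using s s0 by simp
      then have "Q * s \<le> 1" using Q by (simp add: field_simps)
      then have "norm w \<le> R + 1" using d z norm_triangle_sub[of w z] by linarith
      then have e1: "norm (\<Phi> w - w - s *\<^sub>R X w) \<le> \<delta> / 3 * s"
        and "norm (X w - X z) \<le> L * norm (w - z)"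
        using \<Phi>(2) L(2) z by auto
      then have "norm (X w - X z) \<le> L * (Q * s)"
        using mult_left_mono[OF d, of L] L(1) by linarith
      also have "\<dots> \<le> L * (Q * (\<delta> / (3 * L * Q)))"
        using L(1) Q s s0 by (intro mult_left_mono) auto
      also have "\<dots> = \<delta> / 3" using L(1) Q by simp
      finally have "norm (s *\<^sub>R (X w - X z)) \<le> \<delta> / 3 * s"
        using s by (simp add: mult.commute)
      moreover have "\<Phi> (\<Psi> z) - z - s *\<^sub>R (X z + Y z) = (\<Phi> w - w - s *\<^sub>R X w) + s *\<^sub>R (X w - X z) + (w - z - s *\<^sub>R Y z)"
        by (simp add: w_def scaleR_right_diff_distrib scaleR_right_distrib)
      then have "norm (\<Phi> (\<Psi> z) - z - s *\<^sub>R (X z + Y z)) = norm ((\<Phi> w - w - s *\<^sub>R X w) + s *\<^sub>R (X w - X z) + (w - z - s *\<^sub>R Y z))"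
        by (simp only:)
      moreover have "\<dots> \<le> norm (\<Phi> w - w - s *\<^sub>R X w) + norm (s *\<^sub>R (X w - X z)) + norm (w - z - s *\<^sub>R Y z)"
        using norm_triangle_ineq[of "(\<Phi> w - w - s *\<^sub>R X w) + s *\<^sub>R (X w - X z)" "w - z - s *\<^sub>R Y z"]
          norm_triangle_ineq[of "\<Phi> w - w - s *\<^sub>R X w" "s *\<^sub>R (X w - X z)"] by linarith
      ultimately show ?thesis using e1 e2 by linarith
    qed
    then show "\<exists>\<Phi>\<in>Aut_space. \<forall>z. norm z \<le> R \<longrightarrow> norm (\<Phi> z - z - s *\<^sub>R (X z + Y z)) \<le> \<delta> * s"
      using Aut_space_compose[OF \<Phi>(1) \<Psi>(1)] by (intro bexI[of _ "\<lambda>z. \<Phi> (\<Psi> z)"]) auto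
  qed
qed

lemma euler_good_linear:
  fixes X :: "complex^'n \<Rightarrow> complex^'n"
  assumes X: "complex_linear X"
  shows "euler_good X R"
  unfolding euler_good_def
proof (intro allI impI)
  fix \<delta> :: real assume \<delta>: "\<delta> > 0"
  obtain a where a: "a > 0" "\<And>z. norm (X z) \<le> a * norm z" using complex_linear_bound[OF X] by blast
  define C where "C = a\<^sup>2 * exp a * \<bar>R\<bar>"
  have C: "C \<ge> 0" by (simp add: C_def)
  define s0 where "s0 = min 1 (\<delta> / (C + 1))"
  have s0: "s0 > 0" using \<delta> C by (simp add: s0_def)
  show "\<exists>s0>0. \<forall>s. 0 < s \<and> s < s0 \<longrightarrow>
     (\<exists>\<Phi>\<in>Aut_space. \<forall>z. norm z \<le> R \<longrightarrow> norm (\<Phi> z - z - s *\<^sub>R X z) \<le> \<delta> * s)"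
  proof (intro exI[of _ s0] conjI s0 allI impI bexI[OF _ eflow_Aut[OF X]])
    fix s and z :: "complex^'n" assume s: "0 < s \<and> s < s0" and z: "norm z \<le> R"
    have s1: "s \<le> 1" "s \<le> \<delta> / (C + 1)" using s by (auto simp: s0_def)
    have "norm (eflow X s z - z - s *\<^sub>R X z) \<le> (a * s)\<^sup>2 * exp (a * \<bar>s\<bar>) * norm z"
      using a by (intro eflow_bounds(2)[OF X]) auto
    also have "\<dots> \<le> (a * s)\<^sup>2 * exp a * \<bar>R\<bar>"
      using s s1 a(1) z by (intro mult_mono mult_left_mono) auto
    also have "\<dots> = (C * s) * s" by (simp add: C_def power_mult_distrib power2_eq_square)
    also have "\<dots> \<le> \<delta> * s"
    proof (intro mult_right_mono)
      have "C * s \<le> (C + 1) * s" using s by simp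
      also have "\<dots> \<le> \<delta>" using s1 C by (simp add: field_simps)
      finally show "C * s \<le> \<delta>" .
    qed (use s in simp)
    finally show "norm (eflow X s z - z - s *\<^sub>R X z) \<le> \<delta> * s" .
  qed
qed

text \<open>Conjugation with a dilation: \<open>\<Psi> (l z) / l\<close> equals
  \<open>z + l ^ (k - 1) X z\<close> up to \<open>O(l ^ k)\<close>. With
  \<open>l ^ (k - 1) = s\<close> this is an Euler step with error \<open>O(l * s)\<close>, and
  \<open>l\<close> tends to 0 with \<open>s\<close> because \<open>k \<ge> 2\<close>.\<close>

lemma euler_good_jet:
  fixes X :: "complex^'n \<Rightarrow> complex^'n"
  assumes hom: "\<And>c z. X (c *s z) = c ^ k *s X z" and jet: "jet_realizable k X" and k: "k \<ge> 2"
  shows "euler_good X R"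
  unfolding euler_good_def
proof (intro allI impI)
  fix \<delta> :: real assume \<delta>: "\<delta> > 0"
  obtain \<Psi> C \<rho> where \<Psi>: "\<Psi> \<in> Aut_space" "\<rho> > 0"
    "\<And>w. norm w \<le> \<rho> \<Longrightarrow> norm (\<Psi> w - w - X w) \<le> C * norm w ^ Suc k"
    using jet unfolding jet_realizable_def by blast
  define B where "B = \<bar>C\<bar> * (\<bar>R\<bar> + 1) ^ Suc k"
  have B: "B \<ge> 0" by (simp add: B_def)
  \<comment> \<open>An upper bound for \<open>l\<close>: it keeps \<open>l z\<close> within radius
    \<open>\<rho>\<close> when \<open>norm z \<le> R\<close>, and makes the relative error
    \<open>B * l\<close> at most \<open>\<delta>\<close>.\<close>
  define \<mu> where "\<mu> = min (\<rho> / (\<bar>R\<bar> + 1)) (\<delta> / (B + 1))"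
  have \<mu>: "\<mu> > 0" "\<mu> * (\<bar>R\<bar> + 1) \<le> \<rho>" "\<mu> * (B + 1) \<le> \<delta>"
  proof -
    show "\<mu> > 0" using \<Psi>(2) \<delta> B by (simp add: \<mu>_def add_nonneg_pos)
    have "\<mu> \<le> \<rho> / (\<bar>R\<bar> + 1)" by (simp add: \<mu>_def)
    then show "\<mu> * (\<bar>R\<bar> + 1) \<le> \<rho>" by (simp add: pos_le_divide_eq add_nonneg_pos)
    have "\<mu> \<le> \<delta> / (B + 1)" by (simp add: \<mu>_def)
    then show "\<mu> * (B + 1) \<le> \<delta>" using B by (simp add: pos_le_divide_eq add_nonneg_pos)
  qed
  show "\<exists>s0>0. \<forall>s. 0 < s \<and> s < s0 \<longrightarrow>
     (\<exists>\<Phi>\<in>Aut_space. \<forall>z. norm z \<le> R \<longrightarrow> norm (\<Phi> z - z - s *\<^sub>R X z) \<le> \<delta> * s)"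
  proof (intro exI[of _ "\<mu> ^ (k - 1)"] conjI allI impI)
    show "\<mu> ^ (k - 1) > 0" using \<mu> by simp
    fix s assume s: "0 < s \<and> s < \<mu> ^ (k - 1)"
    define l where "l = root (k - 1) s"
    have l: "l > 0" "l ^ (k - 1) = s"
      using s k by (auto simp: l_def real_root_gt_zero real_root_pow_pos)
    have l\<mu>: "l < \<mu>" using l s \<mu>(1) power_less_imp_less_base[of l "k - 1" \<mu>] by simp
    let ?c = "complex_of_real l" and ?d = "complex_of_real (1 / l)"
    have cd: "?c \<noteq> 0" "?d \<noteq> 0" "?d * ?c = 1" using l by auto
    define \<Phi> where "\<Phi> z = ?d *s \<Psi> (?c *s z)" for z
    have \<Phi>A: "\<Phi> \<in> Aut_space"
      unfolding \<Phi>_def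
      using Aut_space_compose[OF smult_Aut[OF cd(2)] Aut_space_compose[OF \<Psi>(1) smult_Aut[OF cd(1)]]] by simp
    have "norm (\<Phi> z - z - s *\<^sub>R X z) \<le> \<delta> * s" if z: "norm z \<le> R" for z
    proof -
      have "s *\<^sub>R X z = (?d * ?c ^ k) *s X z"
      proof -
        have "l ^ k = l * l ^ (k - 1)" using k by (cases k) auto
        then have "(1 / l) * l ^ k = s" using l by simp
        then have "?d * ?c ^ k = complex_of_real s" by (metis of_real_mult of_real_power)
        then show ?thesis by (simp only: scaleR_eq_smult)
      qed
      also have "\<dots> = ?d *s X (?c *s z)" by (simp only: hom vector_smult_assoc)
      finally have "\<Phi> z - z - s *\<^sub>R X z = ?d *s (\<Psi> (?c *s z) - ?c *s z - X (?c *s z))"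
        unfolding vector_ssub_ldistrib vector_smult_assoc cd(3) by (simp add: \<Phi>_def)
      then have "norm (\<Phi> z - z - s *\<^sub>R X z) = (1 / l) * norm (\<Psi> (?c *s z) - ?c *s z - X (?c *s z))"
        using l(1) by (simp only: norm_smult norm_of_real) simp
      also have "\<dots> \<le> (1 / l) * (C * norm (?c *s z) ^ Suc k)"
      proof (intro mult_left_mono \<Psi>(3))
        have "l * norm z \<le> \<mu> * (\<bar>R\<bar> + 1)" using l l\<mu> z by (intro mult_mono) auto
        then show "norm (?c *s z) \<le> \<rho>" using \<mu>(2) l(1) by simp
      qed (use l in simp)
      also have "\<dots> \<le> (1 / l) * (\<bar>C\<bar> * (l * (\<bar>R\<bar> + 1)) ^ Suc k)"
        using l z by (intro mult_left_mono mult_mono power_mono) auto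
      also have "\<dots> = B * l ^ k"
        using l(1) by (simp add: B_def power_mult_distrib)
      also have "\<dots> = (B * l) * s"
        using k l(2) by (cases k) auto
      also have "\<dots> \<le> \<delta> * s"
      proof (intro mult_right_mono)
        have "B * l \<le> (B + 1) * \<mu>" using B l l\<mu> by (intro mult_mono) auto
        then show "B * l \<le> \<delta>" using \<mu>(3) by (simp add: mult.commute)
      qed (use s in simp)
      finally show ?thesis .
    qed
    then show "\<exists>\<Phi>\<in>Aut_space. \<forall>z. norm z \<le> R \<longrightarrow> norm (\<Phi> z - z - s *\<^sub>R X z) \<le> \<delta> * s"
      using \<Phi>A by blast
  qed
qed

text \<open>A Taylor polynomial is uniformly within \<open>\<delta> / 2\<close> of \<open>X\<close>
  on the smaller ball. Its part of degree 0 vanishes with \<open>X 0\<close>, degree 1 is a linear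
  field with its exact flow, and higher degrees are sums of shears and overshears.\<close>

lemma euler_good_holomorphic:
  fixes X :: "complex^'n \<Rightarrow> complex^'n"
  assumes card: "CARD('n) \<ge> 2" and X: "holomorphic_map_on X (ball 0 1)" "X 0 = 0" and r: "0 < r" "r < 1"
  shows "euler_good X r"
  unfolding euler_good_def
proof (intro allI impI)
  fix \<delta> :: real assume \<delta>: "\<delta> > 0"
  define \<rho> where "\<rho> = (1 + r) / 2"
  have \<rho>: "r < \<rho>" "\<rho> < 1" using r by (auto simp: \<rho>_def)
  have sub: "cball 0 \<rho> \<subseteq> ball (0 :: complex^'n) 1" using \<rho> by auto
  obtain M where M: "M > 0" "\<And>w. norm w \<le> \<rho> \<Longrightarrow> norm (X w) \<le> M"
    using hol_map_on_bounded_cball[OF X(1) sub] by metis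
  define q where "q = \<rho> / r"
  have q: "q > 1" using \<rho> r by (simp add: q_def)
  have "(\<lambda>K. real CARD('n) * (M * (1 / q) ^ K / (1 - 1 / q))) \<longlonglongrightarrow> real CARD('n) * (M * 0 / (1 - 1 / q))"
    using q by (intro tendsto_intros LIMSEQ_realpow_zero) auto
  then have "\<forall>\<^sub>F K in sequentially. real CARD('n) * (M * (1 / q) ^ K / (1 - 1 / q)) < \<delta> / 2"
    by (rule order_tendstoD(2)) (use \<delta> in simp)
  then obtain K where K: "real CARD('n) * (M * (1 / q) ^ K / (1 - 1 / q)) < \<delta> / 2"
    by (auto simp: eventually_sequentially)
  define P where "P K z = (\<Sum>k<K. hpart_map X k z)" for K z
  have err: "norm (X z - P K z) \<le> \<delta> / 2" if z: "norm z \<le> r" for z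
  proof -
    have "q * norm z \<le> \<rho>" using z r \<rho> by (simp add: q_def divide_le_eq mult_left_mono)
    then have "norm (X z - P K z) \<le> real CARD('n) * (M * (1 / q) ^ K / (1 - 1 / q))"
      unfolding P_def by (intro taylor_remainder_map[OF X(1) sub _ q]) (use M(2) in simp)
    then show ?thesis using K by linarith
  qed
  have part: "holomorphic_map_on (hpart_map X k) UNIV \<and> (\<forall>R. euler_good (hpart_map X k) R)" for k
  proof -
    have z0: "(0 :: complex^'n) \<in> ball 0 1" by simp
    consider "k = 0" | "k = 1" | "k \<ge> 2" by linarith
    then show ?thesis
    proof cases
      case 1
      then have "hpart_map X k = (\<lambda>_. 0)" using hpart_map_simps(2)[OF X(1) z0] X(2) by (simp add: fun_eq_iff)
      moreover have "complex_linear (\<lambda>_ :: complex^'n. 0)" by (simp add: complex_linear_iff)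
      ultimately show ?thesis using euler_good_linear hol_map_on_const[OF open_UNIV] by metis
    next
      case 2
      then have "hpart_map X k = fd X 0" using hpart_map_simps(3)[OF X(1) z0] by (simp add: fun_eq_iff)
      moreover have "complex_linear (fd X 0)" by (rule hol_map_on_fd(2)[OF X(1) z0])
      ultimately show ?thesis using euler_good_linear hol_map_on_linear[OF _ open_UNIV] by metis
    next
      case 3
      have "shear_span k (hpart_map X k)"
        by (intro shear_span_hom_poly card hpart_map_simps(1)[OF X(1) z0])
      then show ?thesis using jet_realizable_shear_span[OF _ 3] euler_good_jet[OF _ _ 3] by blast
    qed
  qed
  have "holomorphic_map_on (P K) UNIV \<and> (\<forall>R. euler_good (P K) R)"
  proof (induction K)
    case 0
    have "complex_linear (\<lambda>_ :: complex^'n. 0)" by (simp add: complex_linear_iff)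
    moreover have "P 0 = (\<lambda>_. 0)" by (simp add: P_def fun_eq_iff)
    ultimately show ?case using euler_good_linear hol_map_on_const[OF open_UNIV] by metis
  next
    case (Suc K)
    have "P (Suc K) = (\<lambda>z. P K z + hpart_map X K z)" by (simp add: P_def fun_eq_iff)
    then show ?case using Suc part[of K] by (simp add: hol_map_on_add euler_good_add)
  qed
  then have P: "euler_good (P K) r" by blast
  have \<delta>2: "\<delta> / 2 > 0" using \<delta> by simp
  obtain s0 where s0: "s0 > 0" "\<And>s. 0 < s \<Longrightarrow> s < s0 \<Longrightarrow> \<exists>\<Phi>\<in>Aut_space. \<forall>z. norm z \<le> r \<longrightarrow> norm (\<Phi> z - z - s *\<^sub>R P K z) \<le> \<delta> / 2 * s"
    using euler_goodE[OF P \<delta>2] by blast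
  show "\<exists>s0>0. \<forall>s. 0 < s \<and> s < s0 \<longrightarrow>
     (\<exists>\<Phi>\<in>Aut_space. \<forall>z. norm z \<le> r \<longrightarrow> norm (\<Phi> z - z - s *\<^sub>R X z) \<le> \<delta> * s)"
  proof (intro exI[of _ s0] conjI s0(1) allI impI)
    fix s assume s: "0 < s \<and> s < s0"
    then obtain \<Phi> where \<Phi>: "\<Phi> \<in> Aut_space" "\<And>z. norm z \<le> r \<Longrightarrow> norm (\<Phi> z - z - s *\<^sub>R P K z) \<le> \<delta> / 2 * s"
      using s0(2) by blast
    have "norm (\<Phi> z - z - s *\<^sub>R X z) \<le> \<delta> * s" if z: "norm z \<le> r" for z
    proof -
      have "\<Phi> z - z - s *\<^sub>R X z = (\<Phi> z - z - s *\<^sub>R P K z) - s *\<^sub>R (X z - P K z)"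
        by (simp add: scaleR_right_diff_distrib)
      then have "norm (\<Phi> z - z - s *\<^sub>R X z) \<le> norm (\<Phi> z - z - s *\<^sub>R P K z) + norm (s *\<^sub>R (X z - P K z))"
        by (metis norm_triangle_ineq4)
      also have "norm (s *\<^sub>R (X z - P K z)) \<le> s * (\<delta> / 2)"
        using mult_left_mono[OF err[OF z], of s] s by simp
      finally show ?thesis using \<Phi>(2)[OF z] by (simp add: algebra_simps)
    qed
    then show "\<exists>\<Phi>\<in>Aut_space. \<forall>z. norm z \<le> r \<longrightarrow> norm (\<Phi> z - z - s *\<^sub>R X z) \<le> \<delta> * s"
      using \<Phi>(1) by blast
  qed
qed

subsection \<open>The semigroup of a spirallike mapping\<close>

lemma fd_inverse:
  fixes f g :: "complex^'n \<Rightarrow> complex^'n"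
  assumes f: "holomorphic_map_on f S" and g: "holomorphic_map_on g (f ` S)" and inv: "\<And>z. z \<in> S \<Longrightarrow> g (f z) = z"
    and z: "z \<in> S"
  shows "fd g (f z) (fd f z u) = u" and "fd f z (fd g (f z) u) = u"
proof -
  have id: "fd h x v = v" if "open T" "x \<in> T" "\<And>y. y \<in> T \<Longrightarrow> h y = y" for h :: "complex^'n \<Rightarrow> complex^'n" and T x v
  proof -
    have "(h has_derivative (\<lambda>v. v)) (at x)"
      by (rule has_derivative_transform_within_open[OF has_derivative_ident that(1,2)]) (simp add: that(3))
    then show ?thesis using fd_eqI by metis
  qed
  have "fd (\<lambda>z. g (f z)) z u = u"
    by (rule id[OF hol_map_on_open[OF f] z inv])
  then show "fd g (f z) (fd f z u) = u"
    using hol_map_on_compose(2)[OF g f _ z] by simp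
  have "fd (\<lambda>w. f (g w)) (f z) u = u"
    by (rule id[OF hol_map_on_open[OF g]]) (use z inv in auto)
  moreover have "g ` f ` S \<subseteq> S" using inv by auto
  ultimately show "fd f z (fd g (f z) u) = u"
    using hol_map_on_compose(2)[OF f g, of "f z" u] z inv by simp
qed

text \<open>Here \<open>\<bullet>\<close> is the real part of the Hermitian product, so
  \<open>m\<close> is a lower bound for the numerical range of \<open>A\<close>, and
  \<open>g\<close> is an inverse of \<open>f\<close> on its image.\<close>

locale spirallike_map =
  fixes A f g :: "complex^'n \<Rightarrow> complex^'n" and m :: real
  assumes A: "complex_linear A" and m: "m > 0" "\<And>z. m * (norm z)\<^sup>2 \<le> A z \<bullet> z"
    and f: "holomorphic_map_on f (ball 0 1)" and g: "holomorphic_map_on g (f ` ball 0 1)"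
    and gf: "\<And>z. norm z < 1 \<Longrightarrow> g (f z) = z" and f0: "f 0 = 0" and df0: "\<And>u. fd f 0 u = u"
    and spiral: "\<And>t. t \<ge> 0 \<Longrightarrow> eflow A (- t) ` f ` ball 0 1 \<subseteq> f ` ball 0 1"
begin

text \<open>\<open>v\<close> is the semigroup of self-maps of the ball that \<open>f\<close> conjugates to the linear flow, and
  \<open>- h\<close> is its infinitesimal generator.\<close>

definition v :: "real \<Rightarrow> complex^'n \<Rightarrow> complex^'n" where
  "v t z = g (eflow A (- t) (f z))"

definition h :: "complex^'n \<Rightarrow> complex^'n" where
  "h z = fd g (f z) (A (f z))"

lemma g_image: "w \<in> f ` ball 0 1 \<Longrightarrow> norm (g w) < 1 \<and> f (g w) = w"
  using gf by auto

lemma eflow_in_image: "t \<ge> 0 \<Longrightarrow> norm z < 1 \<Longrightarrow> eflow A (- t) (f z) \<in> f ` ball 0 1"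
  by (rule subsetD[OF spiral]) auto

lemma v_ball: "t \<ge> 0 \<Longrightarrow> norm z < 1 \<Longrightarrow> norm (v t z) < 1"
  and f_v: "t \<ge> 0 \<Longrightarrow> norm z < 1 \<Longrightarrow> f (v t z) = eflow A (- t) (f z)"
  unfolding v_def using g_image[OF eflow_in_image] by auto

lemma v_hol: "t \<ge> 0 \<Longrightarrow> holomorphic_map_on (v t) (ball 0 1)"
  unfolding v_def
  by (intro hol_map_on_compose(1)[OF g] hol_map_on_compose(1)[OF hol_map_on_linear[OF eflow_linear[OF A] open_UNIV] f])
     (use eflow_in_image in auto)

lemma v_at_0: "v t 0 = 0"
  using gf[of 0] eflow_smult[OF A, of "- t" 0 0] by (simp add: v_def f0)

lemma v_0: "norm z < 1 \<Longrightarrow> v 0 z = z"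
  by (simp add: v_def eflow_0[OF A] gf)

lemma v_add:
  assumes "s \<ge> 0" "t \<ge> 0" "norm z < 1"
  shows "v (s + t) z = v s (v t z)"
  using f_v[OF assms(2,3)] by (simp add: v_def eflow_eflow[OF A])

lemma v_norm_le: "t \<ge> 0 \<Longrightarrow> norm z < 1 \<Longrightarrow> norm (v t z) \<le> norm z"
  by (rule schwarz_map[OF v_hol]) (use v_ball v_at_0 in auto)

text \<open>The differentials of \<open>f\<close> and of its inverse at 0 are the identity, so
  conjugation leaves the linear flow unchanged to first order.\<close>

lemma fd_v_0:
  assumes "t \<ge> 0"
  shows "fd (v t) 0 u = eflow A (- t) u"
proof -
  let ?e = "eflow A (- t)"
  have e: "holomorphic_map_on ?e UNIV" by (rule hol_map_on_linear[OF eflow_linear[OF A] open_UNIV])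
  have z: "(0 :: complex^'n) \<in> ball 0 1" by simp
  have ef: "holomorphic_map_on (\<lambda>z. ?e (f z)) (ball 0 1)" by (rule hol_map_on_compose(1)[OF e f]) auto
  have sub: "(\<lambda>z. ?e (f z)) ` ball 0 1 \<subseteq> f ` ball 0 1" using eflow_in_image[OF assms] by auto
  have e0: "?e 0 = 0" using eflow_smult[OF A, of "- t" 0 0] by simp
  have "(?e has_derivative ?e) (at 0)"
    by (intro bounded_linear_imp_has_derivative complex_linear_bounded_linear eflow_linear A)
  then have fde: "fd ?e 0 u = ?e u" for u using fd_eqI by metis
  have "fd g (f 0) (fd f 0 w) = w" for w
    by (rule fd_inverse(1)[OF f g _ z]) (simp add: gf)
  then have fdg: "fd g 0 w = w" for w by (simp add: f0 df0)
  have "fd (v t) 0 u = fd g (?e (f 0)) (fd (\<lambda>z. ?e (f z)) 0 u)"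
    unfolding v_def by (rule hol_map_on_compose(2)[OF g ef sub z])
  also have "fd (\<lambda>z. ?e (f z)) 0 u = fd ?e (f 0) (fd f 0 u)"
    by (rule hol_map_on_compose(2)[OF e f _ z]) simp
  finally show ?thesis by (simp add: f0 df0 e0 fde fdg)
qed

text \<open>\<open>g\<close> is expanded to second order at \<open>f z\<close> along the
  displacement \<open>\<eta>\<close> of the linear flow. Uniformity in \<open>z\<close> comes from
  compactness of the image of \<open>cball 0 r\<close>: a collar of fixed width
  \<open>\<rho>\<close> lies in the image of the ball, and there \<open>g\<close> is bounded by
  1.\<close>

lemma v_expansion:
  assumes r: "r < 1"
  obtains C s0 where "C > 0" "s0 > 0"
    "\<And>s z. 0 \<le> s \<Longrightarrow> s \<le> s0 \<Longrightarrow> norm z \<le> r \<Longrightarrow> norm (v s z - z + s *\<^sub>R h z) \<le> C * s\<^sup>2"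
proof -
  let ?K = "f ` cball 0 r"
  have sub: "cball 0 r \<subseteq> ball (0 :: complex^'n) 1" using r by auto
  have K: "compact ?K"
    using hol_map_on_continuous[OF f] by (intro compact_continuous_image compact_cball) (rule continuous_on_subset[OF _ sub])
  obtain \<rho> where \<rho>: "\<rho> > 0" "(\<Union>w\<in>?K. cball w \<rho>) \<subseteq> f ` ball 0 1"
    by (rule compact_subset_open_imp_cball_epsilon_subset[OF K hol_map_on_open[OF g] image_mono[OF sub]])
  obtain W where W: "W > 0" "\<And>z. norm z \<le> r \<Longrightarrow> norm (f z) \<le> W"
    using hol_map_on_bounded_cball[OF f sub] by metis
  obtain a where a: "a > 0" "\<And>z. norm (A z) \<le> a * norm z" using complex_linear_bound[OF A] by blast
  define C1 where "C1 = a\<^sup>2 * exp a * W"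
  define C2 where "C2 = a * W + C1"
  have C: "C1 > 0" "C2 > 0" using a W by (auto simp: C1_def C2_def add_pos_pos)
  \<comment> \<open>Keeps \<open>\<eta>\<close>, of norm at most \<open>C2 * s\<close>, within
    \<open>\<rho> / 2\<close> as the second-order bound for \<open>g\<close> requires;
    \<open>s \<le> 1\<close> bounds the exponential.\<close>
  define s0 where "s0 = min 1 (\<rho> / (2 * C2))"
  have s0: "s0 > 0" "s0 \<le> 1" "s0 \<le> \<rho> / (2 * C2)" using C \<rho> by (auto simp: s0_def)
  define C' where "C' = 2 * (C2 / \<rho>)\<^sup>2 + C1 / \<rho>"
  show ?thesis
  proof (rule that[of C' s0])
    show "C' > 0" unfolding C'_def using C \<rho> by (simp add: add_pos_pos)
    fix s and z :: "complex^'n" assume s: "0 \<le> s" "s \<le> s0" and z: "norm z \<le> r"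
    define w where "w = f z"
    define \<eta> where "\<eta> = eflow A (- s) w - w"
    have "w \<in> ?K" using z by (simp add: w_def)
    then have "cball w \<rho> \<subseteq> (\<Union>w\<in>?K. cball w \<rho>)" by (rule UN_upper)
    then have cb: "cball w \<rho> \<subseteq> f ` ball 0 1" using \<rho>(2) by (rule order_trans)
    have w: "w \<in> f ` ball 0 1" using cb \<rho>(1) by auto
    have gM: "norm (g y) \<le> 1" if "y \<in> cball w \<rho>" for y
      using g_image[of y] that cb by (meson less_imp_le subsetD)
    have "norm (\<eta> - (- s) *\<^sub>R A w) \<le> (a * (- s))\<^sup>2 * exp (a * \<bar>- s\<bar>) * norm w"
      unfolding \<eta>_def using a by (intro eflow_bounds(2)[OF A]) auto
    then have "norm (\<eta> + s *\<^sub>R A w) \<le> (a * s)\<^sup>2 * exp (a * s) * norm w"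
      using s by simp
    also have "\<dots> \<le> (a * s)\<^sup>2 * exp a * W"
      using s s0 a W(2)[OF z] by (intro mult_mono mult_left_mono) (auto simp: w_def)
    also have "\<dots> = C1 * s\<^sup>2" by (simp add: C1_def power_mult_distrib)
    finally have e1: "norm (\<eta> + s *\<^sub>R A w) \<le> C1 * s\<^sup>2" .
    have "s\<^sup>2 \<le> s" using s s0 by (simp add: power2_eq_square mult_left_le)
    have "norm \<eta> \<le> norm (\<eta> + s *\<^sub>R A w) + norm (s *\<^sub>R A w)"
      using norm_triangle_ineq4[of "\<eta> + s *\<^sub>R A w" "s *\<^sub>R A w"] by simp
    also have "norm (s *\<^sub>R A w) \<le> s * (a * W)"
    proof -
      have "norm (A w) \<le> a * W"
        using a(2)[of w] mult_left_mono[OF W(2)[OF z] less_imp_le[OF a(1)]] unfolding w_def by linarith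
      then show ?thesis using s by (simp add: mult_left_mono)
    qed
    also have "norm (\<eta> + s *\<^sub>R A w) \<le> C1 * s"
      using e1 mult_left_mono[OF \<open>s\<^sup>2 \<le> s\<close>, of C1] C by linarith
    finally have e2: "norm \<eta> \<le> C2 * s" by (simp add: C2_def algebra_simps)
    have "C2 * s \<le> C2 * (\<rho> / (2 * C2))" using C s s0 by (intro mult_left_mono) auto
    then have \<eta>2: "norm \<eta> \<le> \<rho> / 2" using e2 C by simp
    have "norm (g (w + \<eta>) - g w - fd g w \<eta>) \<le> 2 * 1 * (norm \<eta> / \<rho>)\<^sup>2"
      by (rule second_order_bound_map[OF g cb gM \<eta>2 \<rho>(1)])
    also have "\<dots> \<le> 2 * 1 * (C2 * s / \<rho>)\<^sup>2"
      using e2 \<rho> by (intro mult_left_mono power_mono divide_right_mono) auto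
    finally have e3: "norm (g (w + \<eta>) - g w - fd g w \<eta>) \<le> 2 * (C2 / \<rho>)\<^sup>2 * s\<^sup>2"
      by (simp add: power_mult_distrib power_divide)
    have "norm (fd g w (\<eta> + s *\<^sub>R A w)) \<le> 1 * norm (\<eta> + s *\<^sub>R A w) / \<rho>"
      by (rule cauchy_fd_bound_map[OF g cb gM \<rho>(1)])
    also have "\<dots> \<le> C1 * s\<^sup>2 / \<rho>" using e1 \<rho> by (simp add: divide_right_mono)
    finally have e4: "norm (fd g w (\<eta> + s *\<^sub>R A w)) \<le> C1 / \<rho> * s\<^sup>2" by simp
    have lin: "linear (fd g w)" using hol_map_on_fd(1)[OF g w] has_derivative_linear by blast
    have "fd g w (\<eta> + s *\<^sub>R A w) = fd g w \<eta> + s *\<^sub>R h z"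
      using linear_add[OF lin] linear_scale[OF lin] by (simp add: h_def w_def)
    moreover have "w + \<eta> = eflow A (- s) w" by (simp add: \<eta>_def)
    moreover have "norm z < 1" using z r by simp
    ultimately have "v s z - z + s *\<^sub>R h z = (g (w + \<eta>) - g w - fd g w \<eta>) + fd g w (\<eta> + s *\<^sub>R A w)"
      using gf[of z] by (simp add: v_def w_def)
    then show "norm (v s z - z + s *\<^sub>R h z) \<le> C' * s\<^sup>2"
      using norm_triangle_le[OF add_mono[OF e3 e4]] by (simp add: C'_def distrib_right)
  qed (rule s0(1))
qed

text \<open>By \<open>v_expansion\<close>, \<open>h\<close> is the locally uniform limit of the
  holomorphic quotients \<open>(z - v s z) / s\<close> with \<open>s = 1 / (n + 1)\<close>.\<close>

lemma h_hol: "holomorphic_map_on h (ball 0 1)"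
proof (rule weierstrass_hol_map(1)[where f = "\<lambda>n z. complex_of_real (real (Suc n)) *s (z - v (1 / real (Suc n)) z)"])
  show "holomorphic_map_on (\<lambda>z. complex_of_real (real (Suc n)) *s (z - v (1 / real (Suc n)) z)) (ball 0 1)" for n
    by (intro hol_map_on_smult hol_fun_on_const hol_map_on_diff hol_map_on_id v_hol) auto
  have ul: "uniform_limit (cball 0 r) (\<lambda>n z. complex_of_real (real (Suc n)) *s (z - v (1 / real (Suc n)) z)) h sequentially"
    if r: "r < 1" for r
  proof (rule uniform_limitI)
    fix e :: real assume e: "e > 0"
    obtain C s0 where C: "C > 0" "s0 > 0"
      "\<And>s z. 0 \<le> s \<Longrightarrow> s \<le> s0 \<Longrightarrow> norm z \<le> r \<Longrightarrow> norm (v s z - z + s *\<^sub>R h z) \<le> C * s\<^sup>2"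
      using v_expansion[OF r] by blast
    have "(\<lambda>n. 1 / real (Suc n)) \<longlonglongrightarrow> 0" by (intro LIMSEQ_Suc lim_const_over_n)
    moreover have "min s0 (e / C) > 0" using C e by simp
    ultimately have "\<forall>\<^sub>F n in sequentially. 1 / real (Suc n) < min s0 (e / C)"
      by (rule order_tendstoD(2))
    then show "\<forall>\<^sub>F n in sequentially. \<forall>x\<in>cball 0 r. dist (complex_of_real (real (Suc n)) *s (x - v (1 / real (Suc n)) x)) (h x) < e"
    proof (rule eventually_mono, intro ballI)
      fix n and x :: "complex^'n" assume n: "1 / real (Suc n) < min s0 (e / C)" and x: "x \<in> cball 0 r"
      define s where "s = 1 / real (Suc n)"
      have s: "s > 0" "s \<le> s0" "s < e / C" "real (Suc n) = 1 / s" using n by (auto simp: s_def)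
      have "norm (v s x - x + s *\<^sub>R h x) \<le> C * s\<^sup>2" using C(3)[of s x] s x by simp
      moreover have "(1 / s) *\<^sub>R (x - v s x) - h x = (- 1 / s) *\<^sub>R (v s x - x + s *\<^sub>R h x)"
        using s(1) by (simp add: algebra_simps)
      ultimately have "norm ((1 / s) *\<^sub>R (x - v s x) - h x) \<le> (1 / s) * (C * s\<^sup>2)"
        using s(1) by (simp add: divide_right_mono)
      also have "\<dots> = C * s" using s(1) by (simp add: power2_eq_square)
      also have "\<dots> < e" using s(3) C(1) by (simp add: field_simps)
      finally show "dist (complex_of_real (real (Suc n)) *s (x - v (1 / real (Suc n)) x)) (h x) < e"
        unfolding dist_norm scaleR_eq_smult[symmetric] s(4) by simp
    qed
  qed
  show "\<exists>\<rho>>0. cball z \<rho> \<subseteq> ball 0 1 \<and>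
      uniform_limit (cball z \<rho>) (\<lambda>n z. complex_of_real (real (Suc n)) *s (z - v (1 / real (Suc n)) z)) h sequentially"
    if "z \<in> ball 0 1" for z
    by (rule local_uniform_limit_ball[OF ul that])
qed simp

lemma h_0: "h 0 = 0"
proof -
  have "0 \<in> f ` ball 0 1" using f0 by (metis centre_in_ball imageI zero_less_one)
  then have "linear (fd g 0)" using hol_map_on_fd(1)[OF g] has_derivative_linear by blast
  moreover have "A 0 = 0" by (rule linear_0[OF complex_linear_imp_linear[OF A]])
  ultimately show ?thesis by (simp add: h_def f0 linear_0)
qed

text \<open>\<open>harnack_map\<close> for \<open>v s\<close>, whose linear part is the flow of
  \<open>- A\<close>, divided by \<open>s\<close>: in the limit the displacement of
  \<open>v s\<close> becomes \<open>h z\<close> and that of the linear part becomes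
  \<open>A z\<close>.\<close>

lemma h_lower_bound:
  assumes z: "norm z < 1"
  shows "m * ((1 - norm z) / (1 + norm z)) * (norm z)\<^sup>2 \<le> h z \<bullet> z"
proof -
  define \<kappa> where "\<kappa> = (1 - norm z) / (1 + norm z)"
  have \<kappa>: "\<kappa> \<ge> 0" "\<kappa> \<le> 1" using z norm_ge_zero[of z] divide_le_eq_1_pos[of "1 + norm z" "1 - norm z"]
    by (simp_all add: \<kappa>_def del: norm_ge_zero)
  obtain C s0 where C: "C > 0" "s0 > 0"
    "\<And>s y. 0 \<le> s \<Longrightarrow> s \<le> s0 \<Longrightarrow> norm y \<le> norm z \<Longrightarrow> norm (v s y - y + s *\<^sub>R h y) \<le> C * s\<^sup>2"
    using v_expansion[OF z] by blast
  obtain a where a: "a > 0" "\<And>z. norm (A z) \<le> a * norm z" using complex_linear_bound[OF A] by blast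
  define C1 where "C1 = a\<^sup>2 * exp a"
  have C1: "C1 > 0" using a by (simp add: C1_def)
  have "\<kappa> * (A z \<bullet> z) - h z \<bullet> z \<le> (C1 + C) * s" if s: "0 < s" "s \<le> min 1 s0" for s
  proof -
    let ?e = "eflow A (- s) z"
    have hn: "((norm z)\<^sup>2 - ?e \<bullet> z) * \<kappa> \<le> (norm z)\<^sup>2 - v s z \<bullet> z"
      using harnack_map[OF v_hol _ v_at_0 z, of s] fd_v_0[of s z] v_ball[of s] s
      by (simp add: \<kappa>_def image_subset_iff)
    have "norm (?e - z - (- s) *\<^sub>R A z) \<le> (a * (- s))\<^sup>2 * exp (a * \<bar>- s\<bar>) * norm z"
      using a by (intro eflow_bounds(2)[OF A]) auto
    also have "\<dots> \<le> (a * (- s))\<^sup>2 * exp a * 1"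
      using s a z by (intro mult_mono mult_left_mono) auto
    also have "\<dots> = C1 * s\<^sup>2" by (simp add: C1_def power_mult_distrib)
    finally have "norm (?e - z + s *\<^sub>R A z) \<le> C1 * s\<^sup>2" by simp
    moreover have inner_le: "x \<bullet> z \<le> B" "- (x \<bullet> z) \<le> B" if "norm x \<le> B" for x B
    proof -
      have "\<bar>x \<bullet> z\<bar> \<le> norm x * norm z" by (rule Cauchy_Schwarz_ineq2)
      also have "\<dots> \<le> norm x * 1" using z by (intro mult_left_mono) auto
      finally show "x \<bullet> z \<le> B" "- (x \<bullet> z) \<le> B" using that by auto
    qed
    ultimately have "(?e - z + s *\<^sub>R A z) \<bullet> z \<le> C1 * s\<^sup>2" by blast
    then have 1: "s * (A z \<bullet> z) - C1 * s\<^sup>2 \<le> (norm z)\<^sup>2 - ?e \<bullet> z"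
      by (simp add: inner_add_left inner_diff_left power2_norm_eq_inner)
    have "- ((v s z - z + s *\<^sub>R h z) \<bullet> z) \<le> C * s\<^sup>2"
      using inner_le(2) C(3)[of s z] s by auto
    then have 2: "(norm z)\<^sup>2 - v s z \<bullet> z \<le> s * (h z \<bullet> z) + C * s\<^sup>2"
      by (simp add: inner_add_left inner_diff_left power2_norm_eq_inner)
    have "(s * (A z \<bullet> z) - C1 * s\<^sup>2) * \<kappa> \<le> s * (h z \<bullet> z) + C * s\<^sup>2"
      using mult_right_mono[OF 1 \<kappa>(1)] hn 2 by linarith
    moreover have "C1 * s\<^sup>2 * \<kappa> \<le> C1 * s\<^sup>2 * 1" using C1 \<kappa> by (intro mult_left_mono) auto
    ultimately have "s * (\<kappa> * (A z \<bullet> z) - h z \<bullet> z) \<le> s * ((C1 + C) * s)"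
      by (simp add: algebra_simps power2_eq_square)
    then show ?thesis using s by simp
  qed
  then have "\<kappa> * (A z \<bullet> z) - h z \<bullet> z \<le> 0"
    using C C1 by (intro nonpos_if_le_linear[of "min 1 s0" "C1 + C"]) auto
  moreover have "\<kappa> * (m * (norm z)\<^sup>2) \<le> \<kappa> * (A z \<bullet> z)" by (intro mult_left_mono m \<kappa>)
  ultimately show ?thesis by (simp add: \<kappa>_def mult_ac)
qed

text \<open>The derivative is two-sided even at \<open>t = 0\<close>, because \<open>g\<close> is
  differentiable on an open set containing the trajectory.\<close>

lemma v_vector_derivative:
  assumes t: "t \<ge> 0" and z: "norm z < 1"
  shows "((\<lambda>t. v t z) has_vector_derivative - h (v t z)) (at t)"
proof -
  let ?w = "eflow A (- t) (f z)"
  have w: "?w \<in> f ` ball 0 1" by (rule eflow_in_image[OF t z])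
  have "((\<lambda>t. - t) has_vector_derivative - 1) (at t)"
    by (auto intro!: derivative_eq_intros simp: has_real_derivative_iff_has_vector_derivative[symmetric])
  from vector_diff_chain_at[OF this eflow_has_vector_derivative[OF A]]
  have "((\<lambda>t. eflow A (- t) (f z)) has_vector_derivative - A ?w) (at t)"
    by (simp add: o_def)
  from vector_derivative_diff_chain_within[OF this has_derivative_at_withinI[OF hol_map_on_fd(1)[OF g w]]]
  have "((\<lambda>t. g (eflow A (- t) (f z))) has_vector_derivative fd g ?w (- A ?w)) (at t)"
    by (simp add: o_def)
  moreover have "linear (fd g ?w)" using hol_map_on_fd(1)[OF g w] has_derivative_linear by blast
  then have "fd g ?w (- A ?w) = - h (v t z)"
    by (simp add: linear_neg h_def f_v[OF t z])
  ultimately show ?thesis by (simp add: v_def)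
qed

text \<open>With \<open>c = m * ((1 - r) / (1 + r))\<close>, the quantity
  \<open>exp (2 * c * t) * (norm (v t z))\<^sup>2\<close> is nonincreasing: trajectories never leave
  the ball of radius \<open>r\<close>, so Harnack's factor at \<open>r\<close> is a lower bound
  along all of them.\<close>

lemma v_decay:
  assumes r: "r < 1" and z: "norm z \<le> r" and t: "t \<ge> 0"
  shows "norm (v t z) \<le> exp (- (m * ((1 - r) / (1 + r))) * t) * norm z"
proof -
  have r0: "r \<ge> 0" using z norm_ge_zero[of z] by linarith
  define c where "c = m * ((1 - r) / (1 + r))"
  have z1: "norm z < 1" using z r by simp
  have "exp (2 * c * t) * (norm (v t z))\<^sup>2 \<le> exp (2 * c * 0) * (norm (v 0 z))\<^sup>2"
  proof (rule DERIV_nonpos_imp_nonincreasing[OF t])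
    fix s :: real assume s: "0 \<le> s" "s \<le> t"
    let ?y = "v s z"
    let ?d = "exp (2 * c * s) * (2 * (?y \<bullet> - h ?y)) + exp (2 * c * s) * (2 * c) * (norm ?y)\<^sup>2"
    have "((\<lambda>s. exp (2 * c * s)) has_real_derivative exp (2 * c * s) * (2 * c)) (at s)"
      by (auto intro!: derivative_eq_intros)
    from DERIV_mult[OF this DERIV_norm_square[OF v_vector_derivative[OF s(1) z1]]]
    have "((\<lambda>s. exp (2 * c * s) * (norm (v s z))\<^sup>2) has_real_derivative ?d) (at s)"
      by (rule DERIV_cong) (simp add: mult_ac)
    moreover have y: "norm ?y < 1" "norm ?y \<le> r"
      using v_ball[OF s(1) z1] v_norm_le[OF s(1) z1] z by auto
    have "(1 - r) / (1 + r) \<le> (1 - norm ?y) / (1 + norm ?y)"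
      using y r r0 by (intro frac_le add_pos_nonneg) auto
    then have "c * (norm ?y)\<^sup>2 \<le> m * ((1 - norm ?y) / (1 + norm ?y)) * (norm ?y)\<^sup>2"
      unfolding c_def using m(1) by (intro mult_right_mono mult_left_mono) auto
    then have "c * (norm ?y)\<^sup>2 \<le> ?y \<bullet> h ?y"
      using h_lower_bound[OF y(1)] by (simp add: inner_commute)
    then have "exp (2 * c * s) * (2 * c * (norm ?y)\<^sup>2 - 2 * (?y \<bullet> h ?y)) \<le> 0"
      by (intro mult_nonneg_nonpos) auto
    then have "?d \<le> 0" by (simp add: algebra_simps)
    ultimately show "\<exists>d. ((\<lambda>s. exp (2 * c * s) * (norm (v s z))\<^sup>2) has_real_derivative d) (at s) \<and> d \<le> 0"
      by blast
  qed
  then have "(exp (c * t) * norm (v t z))\<^sup>2 \<le> (norm z)\<^sup>2"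
    using z1 by (simp add: v_0 power_mult_distrib mult_ac flip: exp_double)
  then have "exp (c * t) * norm (v t z) \<le> norm z" by (rule power2_le_imp_le) simp
  then show ?thesis
    by (simp add: c_def exp_minus field_simps)
qed

end

section \<open>Approximation of the semigroup and of the mapping by automorphisms\<close>

context spirallike_map
begin

text \<open>Convergence of a one-step method: the interval is cut into \<open>N\<close> steps,
  \<open>v s\<close> is replaced in each by one Euler automorphism \<open>\<Phi>\<close>, and the
  local errors add up with a Gronwall factor. The approximant is the \<open>N\<close>-fold iterate
  of \<open>\<Phi>\<close>.\<close>

lemma v_approx_Aut:
  assumes card: "CARD('n) \<ge> 2" and r: "0 < r" "r < 1" and t: "t \<ge> 0" and \<epsilon>: "\<epsilon> > 0"
  shows "\<exists>\<Phi>\<in>Aut_space. \<forall>z. norm z \<le> r \<longrightarrow> norm (\<Phi> z - v t z) \<le> \<epsilon>"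
proof (cases "t = 0")
  case True
  have "(\<lambda>z. z) \<in> Aut_space"
    by (rule Aut_spaceI[of _ "\<lambda>z. z"]) (auto intro: hol_map_on_id)
  then show ?thesis
    using True \<epsilon> r v_0 by (intro bexI[of _ "\<lambda>z. z"]) auto
next
  case False
  then have t: "t > 0" using t by simp
  \<comment> \<open>Iterates of \<open>\<Phi>\<close> are only near the trajectory, so they are
    followed in the larger ball of radius \<open>r'\<close>; \<open>r''\<close> leaves room for a
    Cauchy estimate on that ball.\<close>
  define r' where "r' = (1 + r) / 2"
  define r'' where "r'' = (1 + r') / 2"
  have r': "r < r'" "r' < r''" "r'' < 1" "0 < r'" "r' < 1" using r by (auto simp: r'_def r''_def)
  have sub: "cball 0 r'' \<subseteq> ball (0 :: complex^'n) 1" using r' by auto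
  obtain C s1 where C: "C > 0" "s1 > 0"
    "\<And>s z. 0 \<le> s \<Longrightarrow> s \<le> s1 \<Longrightarrow> norm z \<le> r'' \<Longrightarrow> norm (v s z - z + s *\<^sub>R h z) \<le> C * s\<^sup>2"
    using v_expansion[OF r'(3)] by blast
  obtain H where H: "H > 0" "\<And>z. norm z \<le> r'' \<Longrightarrow> norm (h z) \<le> H"
    using hol_map_on_bounded_cball[OF h_hol sub] by metis
  define L where "L = (C + H) / (r'' - r')"
  have L: "L > 0" using C H r' by (simp add: L_def)
  \<comment> \<open>A factor close to 1 is essential, since it is raised to powers up to
    \<open>N\<close>. It results from applying Cauchy's estimate to \<open>v s z - z\<close>, which
    has size \<open>(C + H) * s\<close>, rather than to \<open>v s z\<close>.\<close>
  have v_lip: "norm (v s x - v s y) \<le> (1 + L * s) * norm (x - y)"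
    if s: "0 \<le> s" "s \<le> min 1 s1" and xy: "norm x \<le> r'" "norm y \<le> r'" for s x y
  proof -
    have hol: "holomorphic_map_on (\<lambda>z. v s z - z) (ball 0 1)"
      by (intro hol_map_on_diff v_hol hol_map_on_id s) auto
    have "norm (v s z - z) \<le> (C + H) * s" if z: "z \<in> cball 0 r''" for z
    proof -
      have "norm (v s z - z) \<le> norm (v s z - z + s *\<^sub>R h z) + norm (s *\<^sub>R h z)"
        using norm_triangle_ineq4[of "v s z - z + s *\<^sub>R h z" "s *\<^sub>R h z"] by simp
      also have "norm (v s z - z + s *\<^sub>R h z) \<le> C * s\<^sup>2" using C(3)[of s z] s z by simp
      also have "C * s\<^sup>2 \<le> C * s"
        using C(1) s by (intro mult_left_mono) (auto simp: power2_eq_square mult_left_le)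
      also have "norm (s *\<^sub>R h z) \<le> s * H" using s H(2)[of z] z by (simp add: mult_left_mono)
      finally show ?thesis by (simp add: algebra_simps)
    qed
    from lipschitz_on_smaller_ball[OF hol sub this r'(2), of x y]
    have "norm ((v s x - x) - (v s y - y)) \<le> L * s * norm (x - y)"
      using xy by (simp add: L_def)
    moreover have "norm (v s x - v s y) \<le> norm ((v s x - x) - (v s y - y)) + norm (x - y)"
      using norm_triangle_ineq[of "(v s x - x) - (v s y - y)" "x - y"] by simp
    ultimately show ?thesis by (simp add: algebra_simps)
  qed
  \<comment> \<open>Besides meeting the tolerance, the accumulated error must not exceed
    \<open>r' - r\<close>, so that the iterates remain in the ball of radius
    \<open>r'\<close>.\<close>
  define e where "e = min \<epsilon> (r' - r)"
  have e: "e > 0" "e \<le> \<epsilon>" "e \<le> r' - r" using \<epsilon> r' by (auto simp: e_def)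
  \<comment> \<open>Each step errs by at most \<open>2 * \<delta> * s\<close> and is amplified by at
    most \<open>exp (L * t)\<close>; as \<open>N * s = t\<close>, the total is at most
    \<open>e\<close>.\<close>
  define \<delta> where "\<delta> = e / (2 * t * exp (L * t))"
  have \<delta>: "\<delta> > 0" "2 * \<delta> * t * exp (L * t) = e" using e t by (auto simp: \<delta>_def)
  define X where "X z = (\<lambda>_. -1) z *s h z" for z
  have X: "holomorphic_map_on X (ball 0 1)"
    unfolding X_def by (intro hol_map_on_smult hol_fun_on_const h_hol) auto
  have Xh: "X z = - h z" for z by (simp add: X_def flip: vector_sneg_minus1)
  have "euler_good X r'"
    by (rule euler_good_holomorphic[OF card X]) (use r' h_0 Xh in auto)
  then obtain s2 where s2: "s2 > 0" "\<And>s. 0 < s \<Longrightarrow> s < s2 \<Longrightarrow> \<exists>\<Phi>\<in>Aut_space. \<forall>z. norm z \<le> r' \<longrightarrow> norm (\<Phi> z - z - s *\<^sub>R X z) \<le> \<delta> * s"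
    using euler_goodE[OF _ \<delta>(1)] by blast
  define s0 where "s0 = Min {1, s1, s2, \<delta> / C}"
  have s0: "s0 > 0" "s0 \<le> 1" "s0 \<le> s1" "s0 \<le> s2" "s0 \<le> \<delta> / C"
    using C s2 \<delta> by (auto simp: s0_def)
  obtain N :: nat where N: "N > 0" "t / real N < s0"
  proof -
    obtain N :: nat where "t / s0 < real N" using reals_Archimedean2 by blast
    moreover have "t / s0 > 0" using t s0 by simp
    ultimately have "0 < real N" by linarith
    with \<open>t / s0 < real N\<close> have "N > 0" "t / real N < s0"
      using s0 by (auto simp: pos_divide_less_eq mult.commute)
    then show ?thesis using that by blast
  qed
  define s where "s = t / real N"
  have s: "s > 0" "s < s0" "real N * s = t" using N t by (auto simp: s_def)
  obtain \<Phi> where \<Phi>: "\<Phi> \<in> Aut_space" "\<And>z. norm z \<le> r' \<Longrightarrow> norm (\<Phi> z - z - s *\<^sub>R X z) \<le> \<delta> * s"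
    using s2(2)[of s] s s0 by auto
  have \<Phi>v: "norm (\<Phi> z - v s z) \<le> 2 * \<delta> * s" if z: "norm z \<le> r'" for z
  proof -
    have "\<Phi> z - v s z = (\<Phi> z - z - s *\<^sub>R X z) - (v s z - z + s *\<^sub>R h z)" by (simp add: Xh)
    then have "norm (\<Phi> z - v s z) \<le> norm (\<Phi> z - z - s *\<^sub>R X z) + norm (v s z - z + s *\<^sub>R h z)"
      by (metis norm_triangle_ineq4)
    also have "norm (\<Phi> z - z - s *\<^sub>R X z) \<le> \<delta> * s" by (rule \<Phi>(2)[OF z])
    also have "norm (v s z - z + s *\<^sub>R h z) \<le> C * s\<^sup>2" using C(3)[of s z] s s0 z r' by simp
    also have "C * s\<^sup>2 \<le> \<delta> * s"
    proof -
      have "s \<le> \<delta> / C" using s s0 by simp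
      then have "C * s \<le> \<delta>" using C(1) by (simp add: field_simps)
      then show ?thesis using s(1) by (simp add: power2_eq_square mult.assoc[symmetric])
    qed
    finally show ?thesis by simp
  qed
  have pow: "(1 + L * s) ^ k \<le> exp (L * t)" if "k \<le> N" for k
  proof -
    have "(1 + L * s) ^ k \<le> exp (L * s) ^ k"
      using L s by (intro power_mono) auto
    also have "\<dots> = exp (real k * (L * s))" by (simp add: exp_of_nat_mult)
    also have "\<dots> \<le> exp (L * t)"
    proof -
      have "real k * s \<le> real N * s" using that s by (intro mult_right_mono) auto
      then have "L * (real k * s) \<le> L * t" using L s by (intro mult_left_mono) auto
      then show ?thesis by (simp add: mult_ac)
    qed
    finally show ?thesis .
  qed
  have err_le: "real k * (2 * \<delta> * s) * (1 + L * s) ^ k \<le> e" if "k \<le> N" for k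
  proof -
    have "real k * (2 * \<delta> * s) * (1 + L * s) ^ k \<le> real N * (2 * \<delta> * s) * exp (L * t)"
      using that \<delta> s L by (intro mult_mono pow mult_right_mono) auto
    also have "\<dots> = 2 * \<delta> * (real N * s) * exp (L * t)" by (simp only: mult_ac)
    also have "\<dots> = e" using \<delta>(2) s(3) by simp
    finally show ?thesis .
  qed
  have iter: "norm ((\<Phi> ^^ k) z - v (real k * s) z) \<le> real k * (2 * \<delta> * s) * (1 + L * s) ^ k"
    if z: "norm z \<le> r" and "k \<le> N" for k z
    using \<open>k \<le> N\<close>
  proof (induction k)
    case 0
    then show ?case using z r by (simp add: v_0)
  next
    case (Suc k)
    define x where "x = (\<Phi> ^^ k) z"
    define y where "y = v (real k * s) z"
    have z1: "norm z < 1" using z r by simp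
    have ks: "real k * s \<ge> 0" using s by simp
    have IH: "norm (x - y) \<le> real k * (2 * \<delta> * s) * (1 + L * s) ^ k"
      using Suc by (simp add: x_def y_def)
    have y: "norm y \<le> r" using v_norm_le[OF ks z1] z by (simp add: y_def)
    have "norm (x - y) \<le> r' - r" using IH err_le[of k] Suc.prems e by simp
    then have x: "norm x \<le> r'" using y norm_triangle_sub[of x y] by linarith
    have "norm (\<Phi> x - v s y) \<le> norm (\<Phi> x - v s x) + norm (v s x - v s y)"
      using norm_triangle_ineq[of "\<Phi> x - v s x" "v s x - v s y"] by simp
    also have "norm (v s x - v s y) \<le> (1 + L * s) * norm (x - y)"
      using x y r' s s0 by (intro v_lip) auto
    also have "(1 + L * s) * norm (x - y) \<le> (1 + L * s) * (real k * (2 * \<delta> * s) * (1 + L * s) ^ k)"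
      using L s by (intro mult_left_mono IH) auto
    also have "norm (\<Phi> x - v s x) \<le> (2 * \<delta> * s) * 1" using \<Phi>v[OF x] by simp
    also have "(2 * \<delta> * s) * 1 \<le> (2 * \<delta> * s) * (1 + L * s) ^ Suc k"
      using \<delta> s L by (intro mult_left_mono one_le_power) auto
    finally have "norm (\<Phi> x - v s y) \<le> real (Suc k) * (2 * \<delta> * s) * (1 + L * s) ^ Suc k"
      by (simp add: algebra_simps)
    moreover have "v (real (Suc k) * s) z = v s y"
      using v_add[of s "real k * s" z] s ks z1 by (simp add: y_def algebra_simps)
    ultimately show ?case by (simp add: x_def del: power_Suc of_nat_Suc)
  qed
  have "\<Phi> ^^ k \<in> Aut_space" for k
  proof (induction k)
    case 0
    show ?case by (rule Aut_spaceI[of _ "\<lambda>z. z"]) (auto intro: hol_map_on_id simp: id_def)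
  next
    case (Suc k)
    then show ?case using Aut_space_compose[OF \<Phi>(1) Suc] by (simp add: o_def)
  qed
  moreover have "norm ((\<Phi> ^^ N) z - v t z) \<le> \<epsilon>" if "norm z \<le> r" for z
    using iter[OF that, of N] err_le[of N] e s(3) by simp
  ultimately show ?thesis by blast
qed

text \<open>The approximant is \<open>eflow A t \<circ> F \<circ> \<Phi>\<close>, where
  \<open>F\<close> has contact of order \<open>K\<close> with \<open>f\<close> at 0 and
  \<open>\<Phi>\<close> is close to \<open>v t\<close>. Replacing \<open>f\<close> by
  \<open>F\<close> costs at most \<open>L * C * exp (a * t) * exp (- c * K * t)\<close>, which tends
  to 0; replacing \<open>v t\<close> by \<open>\<Phi>\<close> is harmless once \<open>t\<close> is
  fixed.\<close>

lemma f_approx_Aut: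
  assumes card: "CARD('n) \<ge> 2" and r: "0 < r" "r < 1" and \<epsilon>: "\<epsilon> > 0"
  shows "\<exists>\<Psi>\<in>Aut_space. \<forall>z. norm z \<le> r \<longrightarrow> norm (\<Psi> z - f z) \<le> \<epsilon>"
proof -
  obtain a where a: "a > 0" "\<And>z. norm (A z) \<le> a * norm z" using complex_linear_bound[OF A] by blast
  define c where "c = m * ((1 - r) / (1 + r))"
  have c: "c > 0" using m r by (simp add: c_def)
  obtain K0 :: nat where K0: "a / c < real K0" using reals_Archimedean2 by blast
  \<comment> \<open>\<open>K0\<close> exceeds the ratio of the growth rate \<open>a\<close> to the
    decay rate \<open>c\<close>; the summand 2 is there because jets are prescribed from order 2
    on.\<close>
  define K where "K = K0 + 2"
  have K: "K \<ge> 2" "a - c * real K < 0"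
    using K0 c by (auto simp: K_def field_simps)
  have z0: "(0 :: complex^'n) \<in> ball 0 1" by simp
  obtain F F' C \<rho> where F: "F \<in> Aut_space" "holomorphic_map_on F' UNIV" "\<And>z. F' (F z) = z" "\<And>z. F (F' z) = z"
    and \<rho>: "\<rho> > 0" "C \<ge> 0" "\<And>w. norm w \<le> \<rho> \<Longrightarrow> norm (F' (f w) - w) \<le> C * norm w ^ K"
    using jet_approximation[OF card f z0 f0 df0 K(1)] by blast
  have Fhol: "holomorphic_map_on F UNIV" using F(1) Aut_spaceE by metis
  define R where "R = \<rho> + C * \<rho> ^ K + 1"
  obtain L where L: "L > 0" "\<And>x y. x \<in> cball 0 R \<Longrightarrow> y \<in> cball 0 R \<Longrightarrow> norm (F x - F y) \<le> L * norm (x - y)"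
    using entire_lipschitz[OF Fhol] by blast
  have fF: "norm (f w - F w) \<le> L * C * norm w ^ K" if w: "norm w \<le> \<rho>" for w
  proof -
    have d: "norm (F' (f w) - w) \<le> C * norm w ^ K" by (rule \<rho>(3)[OF w])
    also have "\<dots> \<le> C * \<rho> ^ K" using \<rho> w by (intro mult_left_mono power_mono) auto
    finally have "norm (F' (f w)) \<le> R"
      using w norm_triangle_sub[of "F' (f w)" w] by (simp add: R_def)
    moreover have "0 \<le> C * \<rho> ^ K" using \<rho>(1,2) by simp
    then have "norm w \<le> R" using w by (simp add: R_def)
    ultimately have "norm (F (F' (f w)) - F w) \<le> L * norm (F' (f w) - w)" by (intro L(2)) auto
    also have "\<dots> \<le> L * (C * norm w ^ K)" using L(1) by (intro mult_left_mono d) auto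
    finally show ?thesis by (simp add: F(4) mult_ac)
  qed
  have "((\<lambda>t. exp (- c * t)) \<longlongrightarrow> 0) at_top" using c by real_asymp
  then have ev1: "\<forall>\<^sub>F t in at_top. exp (- c * t) < \<rho>" by (rule order_tendstoD(2)) (rule \<rho>(1))
  define q where "q = c * real K - a"
  have q: "q > 0" using K by (simp add: q_def)
  have "((\<lambda>t. L * C * exp (- q * t)) \<longlongrightarrow> 0) at_top" using q by real_asymp
  then have ev2: "\<forall>\<^sub>F t in at_top. L * C * exp (- q * t) < \<epsilon> / 2"
    by (rule order_tendstoD(2)) (use \<epsilon> in simp)
  obtain t where t: "t \<ge> 0" "exp (- c * t) < \<rho>" "L * C * exp (- q * t) < \<epsilon> / 2"
    using eventually_happens[OF eventually_conj[OF eventually_ge_at_top[of 0] eventually_conj[OF ev1 ev2]]] by auto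
  define E where "E w = eflow A t (F w)" for w
  have Ehol: "holomorphic_map_on E UNIV"
    unfolding E_def by (rule hol_map_on_compose(1)[OF hol_map_on_linear[OF eflow_linear[OF A] open_UNIV] Fhol]) auto
  have EA: "E \<in> Aut_space" unfolding E_def by (rule Aut_space_compose[OF eflow_Aut[OF A] F(1)])
  have step1: "norm (E (v t z) - f z) \<le> \<epsilon> / 2" if z: "norm z \<le> r" for z
  proof -
    have z1: "norm z < 1" using z r by simp
    have "norm (v t z) \<le> exp (- c * t) * norm z" using v_decay[OF r(2) z t(1)] by (simp add: c_def)
    also have "\<dots> \<le> exp (- c * t) * 1" using z1 by (intro mult_left_mono) auto
    finally have vt: "norm (v t z) \<le> exp (- c * t)" by simp
    have "f z = eflow A t (f (v t z))"
      unfolding f_v[OF t(1) z1] eflow_eflow[OF A] by (simp add: eflow_0[OF A])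
    then have "E (v t z) - f z = eflow A t (F (v t z) - f (v t z))"
      unfolding E_def using linear_diff[OF complex_linear_imp_linear[OF eflow_linear[OF A]]] by metis
    then have "norm (E (v t z) - f z) \<le> exp (a * \<bar>t\<bar>) * norm (F (v t z) - f (v t z))"
      using eflow_bounds(1)[OF A _ a(2)] a(1) by simp
    also have "\<dots> \<le> exp (a * \<bar>t\<bar>) * (L * C * norm (v t z) ^ K)"
      using fF[of "v t z"] vt t by (intro mult_left_mono) (auto simp: norm_minus_commute)
    also have "\<dots> \<le> exp (a * \<bar>t\<bar>) * (L * C * exp (- c * t) ^ K)"
      using L \<rho> vt by (intro mult_left_mono power_mono) auto
    also have "\<dots> = L * C * (exp (a * t) * exp (real K * (- c * t)))"
      using t(1) unfolding exp_of_nat_mult by simp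
    also have "exp (a * t) * exp (real K * (- c * t)) = exp (- q * t)"
      unfolding exp_add[symmetric] q_def by (simp add: algebra_simps)
    finally show ?thesis using t(3) by simp
  qed
  \<comment> \<open>\<open>v t z\<close> lies in the unit ball and \<open>\<Phi> z\<close> within
    distance 1 of it, so both lie in \<open>cball 0 2\<close>.\<close>
  obtain L' where L': "L' > 0" "\<And>x y. x \<in> cball 0 2 \<Longrightarrow> y \<in> cball 0 2 \<Longrightarrow> norm (E x - E y) \<le> L' * norm (x - y)"
    using entire_lipschitz[OF Ehol] by blast
  define \<epsilon>' where "\<epsilon>' = min 1 (\<epsilon> / (2 * L'))"
  have \<epsilon>': "\<epsilon>' > 0" "\<epsilon>' \<le> 1" "\<epsilon>' \<le> \<epsilon> / (2 * L')" using \<epsilon> L' by (auto simp: \<epsilon>'_def)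
  obtain \<Phi> where \<Phi>: "\<Phi> \<in> Aut_space" "\<And>z. norm z \<le> r \<Longrightarrow> norm (\<Phi> z - v t z) \<le> \<epsilon>'"
    using v_approx_Aut[OF card r t(1) \<epsilon>'(1)] by blast
  have "norm (E (\<Phi> z) - f z) \<le> \<epsilon>" if z: "norm z \<le> r" for z
  proof -
    have "norm (v t z) < 1" using v_ball[OF t(1)] z r by simp
    moreover have "norm (\<Phi> z) \<le> norm (v t z) + norm (\<Phi> z - v t z)" by (rule norm_triangle_sub)
    ultimately have "norm (E (\<Phi> z) - E (v t z)) \<le> L' * norm (\<Phi> z - v t z)"
      using \<Phi>(2)[OF z] \<epsilon>' by (intro L'(2)) auto
    also have "\<dots> \<le> L' * (\<epsilon> / (2 * L'))"
      using L'(1) \<Phi>(2)[OF z] \<epsilon>' by (intro mult_left_mono) auto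
    also have "\<dots> = \<epsilon> / 2" using L'(1) by simp
    finally have "norm (E (\<Phi> z) - E (v t z)) \<le> \<epsilon> / 2" .
    then show ?thesis
      using step1[OF z] norm_triangle_ineq[of "E (\<Phi> z) - E (v t z)" "E (v t z) - f z"] by simp
  qed
  then show ?thesis
    by (intro bexI[OF _ Aut_space_compose[OF EA \<Phi>(1)]] allI impI)
qed

end

subsection \<open>Spirallike approximants\<close>

context spirallike_map
begin

text \<open>A close automorphism is translated and composed with the inverse of its differential at
  0. By Cauchy's estimate that differential is close to the identity, so the correction is
  small.\<close>

lemma f_approx_normalized_Aut:
  assumes card: "CARD('n) \<ge> 2" and r: "0 < r" "r < 1" and \<epsilon>: "\<epsilon> > 0"
  shows "\<exists>\<Psi>\<in>Aut_space. \<Psi> 0 = 0 \<and> (\<forall>u. fd \<Psi> 0 u = u) \<and> (\<forall>z. norm z \<le> r \<longrightarrow> norm (\<Psi> z - f z) \<le> \<epsilon>)"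
proof -
  have sub: "cball 0 r \<subseteq> ball (0 :: complex^'n) 1" using r by auto
  obtain M where M: "M > 0" "\<And>z. norm z \<le> r \<Longrightarrow> norm (f z) \<le> M"
    using hol_map_on_bounded_cball[OF f sub] by metis
  \<comment> \<open>The first bound gives \<open>norm (D u - u) \<le> norm u / 2\<close>, so the
    inverse of \<open>D\<close> at most doubles norms. The second bounds twice the sum of the three
    errors: at \<open>z\<close>, at 0, and from \<open>D\<close> on vectors of norm at most
    \<open>M\<close>.\<close>
  define \<epsilon>1 where "\<epsilon>1 = min (r / 2) (\<epsilon> / (2 * (2 + M / r)))"
  have Mr: "2 + M / r > 0" using M r by (simp add: add_pos_pos)
  have \<epsilon>1: "\<epsilon>1 > 0" "\<epsilon>1 \<le> r / 2" "\<epsilon>1 \<le> \<epsilon> / (2 * (2 + M / r))"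
    unfolding \<epsilon>1_def by (use r \<epsilon> Mr in simp, rule min.cobounded1, rule min.cobounded2)
  have "\<epsilon>1 * (2 * (2 + M / r)) \<le> \<epsilon>"
    by (rule pos_le_divide_eq[THEN iffD1, OF _ \<epsilon>1(3)]) (use Mr in simp)
  then have \<epsilon>1': "2 * (\<epsilon>1 * (2 + M / r)) \<le> \<epsilon>" by (simp only: mult_ac)
  obtain \<Psi>1 where \<Psi>1: "\<Psi>1 \<in> Aut_space" "\<And>z. norm z \<le> r \<Longrightarrow> norm (\<Psi>1 z - f z) \<le> \<epsilon>1"
    using f_approx_Aut[OF card r \<epsilon>1(1)] by blast
  obtain \<Psi>1' where \<Psi>1': "holomorphic_map_on \<Psi>1 UNIV" "holomorphic_map_on \<Psi>1' UNIV" "\<And>z. \<Psi>1' (\<Psi>1 z) = z" "\<And>z. \<Psi>1 (\<Psi>1' z) = z"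
    using Aut_spaceE[OF \<Psi>1(1)] by metis
  have surj: "range \<Psi>1 = UNIV" using \<Psi>1'(4) by (metis surjI)
  define D where "D = fd \<Psi>1 0"
  define D' where "D' = fd \<Psi>1' (\<Psi>1 0)"
  have D'D: "D' (D u) = u" and DD': "D (D' u) = u" for u
    unfolding D_def D'_def
    using fd_inverse[of \<Psi>1 UNIV \<Psi>1' 0 u] \<Psi>1' surj by auto
  have lin: "complex_linear D" "complex_linear D'"
    unfolding D_def D'_def using hol_map_on_fd(2) \<Psi>1' by blast+
  have diff: "holomorphic_map_on (\<lambda>z. \<Psi>1 z - f z) (ball 0 1)"
    by (intro hol_map_on_diff f hol_map_on_subset[OF \<Psi>1'(1)]) auto
  have z0: "(0 :: complex^'n) \<in> ball 0 1" by simp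
  have "((\<lambda>z. \<Psi>1 z - f z) has_derivative (\<lambda>u. D u - u)) (at 0)"
    using has_derivative_diff[OF hol_map_on_fd(1)[OF \<Psi>1'(1), of 0] hol_map_on_fd(1)[OF f z0]]
    by (simp add: D_def df0)
  then have fdd: "fd (\<lambda>z. \<Psi>1 z - f z) 0 = (\<lambda>u. D u - u)" by (rule fd_eqI)
  have "norm (fd (\<lambda>z. \<Psi>1 z - f z) 0 u) \<le> \<epsilon>1 * norm u / r" for u
    by (rule cauchy_fd_bound_map[OF diff sub]) (use \<Psi>1(2) r in auto)
  then have DI: "norm (D u - u) \<le> \<epsilon>1 * norm u / r" for u
    unfolding fdd .
  have "norm u \<le> 2 * norm (D u)" for u
  proof -
    have "\<epsilon>1 * norm u / r \<le> (r / 2) * norm u / r"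
      using \<epsilon>1 r by (intro divide_right_mono mult_right_mono) auto
    also have "(r / 2) * norm u / r = norm u / 2" using r by simp
    finally have "norm (D u - u) \<le> norm u / 2" using DI[of u] by linarith
    then show ?thesis using norm_triangle_sub[of u "D u"] by (simp add: norm_minus_commute)
  qed
  from this[of "D' _"] have D'2: "norm (D' x) \<le> 2 * norm x" for x by (simp add: DD')
  define \<Psi> where "\<Psi> z = D' (\<Psi>1 z + (- \<Psi>1 0))" for z
  have DA: "D' \<in> Aut_space"
    by (rule Aut_spaceI[of _ D]) (auto intro!: hol_map_on_linear lin simp: DD' D'D)
  have TA: "(\<lambda>z. z + c) \<in> Aut_space" for c :: "complex^'n"
    by (rule Aut_spaceI[of _ "\<lambda>z. z + (- c)"]) (intro hol_map_on_add hol_map_on_id hol_map_on_const open_UNIV | simp)+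
  have "\<Psi> \<in> Aut_space"
    unfolding \<Psi>_def by (rule Aut_space_compose[OF DA Aut_space_compose[OF TA \<Psi>1(1)]])
  moreover have D'lin: "linear D'" by (rule complex_linear_imp_linear[OF lin(2)])
  then have "\<Psi> 0 = 0" by (simp add: \<Psi>_def linear_0)
  moreover have "(\<Psi> has_derivative (\<lambda>u. D' (D u))) (at 0)"
  proof -
    have "((\<lambda>z. \<Psi>1 z + (- \<Psi>1 0)) has_derivative (\<lambda>u. D u + 0)) (at 0)"
      unfolding D_def by (intro has_derivative_add hol_map_on_fd(1)[OF \<Psi>1'(1)] has_derivative_const) auto
    from bounded_linear.has_derivative[OF complex_linear_bounded_linear[OF lin(2)] this]
    show ?thesis by (simp add: \<Psi>_def[abs_def])
  qed
  then have "fd \<Psi> 0 u = u" for u by (simp add: fd_eqI D'D)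
  moreover have "norm (\<Psi> z - f z) \<le> \<epsilon>" if z: "norm z \<le> r" for z
  proof -
    have "\<Psi> z - f z = D' ((\<Psi>1 z - f z) - (\<Psi>1 0 - f 0) - (D (f z) - f z))"
      using D'D[of "f z"] by (simp add: \<Psi>_def linear_diff[OF D'lin] linear_add[OF D'lin] linear_neg[OF D'lin] f0)
    then have "norm (\<Psi> z - f z) \<le> 2 * norm ((\<Psi>1 z - f z) - (\<Psi>1 0 - f 0) - (D (f z) - f z))"
      using D'2 by simp
    moreover have "norm ((\<Psi>1 z - f z) - (\<Psi>1 0 - f 0) - (D (f z) - f z)) \<le> norm (\<Psi>1 z - f z) + norm (\<Psi>1 0 - f 0) + norm (D (f z) - f z)"
      using norm_triangle_ineq4[of "(\<Psi>1 z - f z) - (\<Psi>1 0 - f 0)" "D (f z) - f z"]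
        norm_triangle_ineq4[of "\<Psi>1 z - f z" "\<Psi>1 0 - f 0"] by linarith
    moreover have "norm (\<Psi>1 z - f z) \<le> \<epsilon>1" "norm (\<Psi>1 0 - f 0) \<le> \<epsilon>1"
      using \<Psi>1(2)[OF z] \<Psi>1(2)[of 0] r by auto
    moreover have "norm (D (f z) - f z) \<le> \<epsilon>1 * (M / r)"
      using DI[of "f z"] mult_left_mono[OF M(2)[OF z] less_imp_le[OF \<epsilon>1(1)]] r
      by (simp add: divide_right_mono order_trans)
    moreover have "2 * (\<epsilon>1 * (2 + M / r)) = 4 * \<epsilon>1 + 2 * (\<epsilon>1 * (M / r))"
      by (simp add: algebra_simps)
    ultimately have "norm (\<Psi> z - f z) \<le> 2 * (\<epsilon>1 * (2 + M / r))"
      by linarith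
    then show ?thesis using \<epsilon>1' by linarith
  qed
  ultimately show ?thesis by blast
qed

text \<open>With \<open>E\<close> the generator belonging to \<open>\<Psi>\<close>, it suffices that
  \<open>norm (E - h y) \<le> c * norm y\<close>, because \<open>h_lower_bound\<close> provides the
  margin \<open>c * (norm y)\<^sup>2\<close>. Since \<open>\<Psi>\<close> and \<open>f\<close> both
  vanish at 0, closeness in the sup norm on a larger ball yields errors that are linear in
  \<open>norm y\<close>.\<close>

lemma generator_positive_of_close:
  assumes \<rho>: "0 < \<rho>" "\<rho> < 1"
  obtains \<epsilon> where "\<epsilon> > 0" "\<And>\<Psi> \<Psi>' y. \<Psi> \<in> Aut_space \<Longrightarrow> holomorphic_map_on \<Psi>' UNIV \<Longrightarrow> (\<And>z. \<Psi>' (\<Psi> z) = z) \<Longrightarrow> \<Psi> 0 = 0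
     \<Longrightarrow> (\<And>z. norm z \<le> (1 + \<rho>) / 2 \<Longrightarrow> norm (\<Psi> z - f z) \<le> \<epsilon>) \<Longrightarrow> norm y \<le> \<rho>
     \<Longrightarrow> 0 \<le> fd \<Psi>' (\<Psi> y) (A (\<Psi> y)) \<bullet> y"
proof -
  define \<rho>' where "\<rho>' = (1 + \<rho>) / 2"
  have \<rho>': "\<rho> < \<rho>'" "\<rho>' < 1" "0 < \<rho>'" using \<rho> by (auto simp: \<rho>'_def)
  define d where "d = \<rho>' - \<rho>"
  have d: "d > 0" using \<rho>' by (simp add: d_def)
  have sub: "cball 0 \<rho> \<subseteq> ball (0 :: complex^'n) 1" "cball 0 \<rho>' \<subseteq> ball (0 :: complex^'n) 1" using \<rho> \<rho>' by auto
  have K: "compact (f ` cball 0 \<rho>)"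
    using hol_map_on_continuous[OF f] by (intro compact_continuous_image compact_cball) (rule continuous_on_subset[OF _ sub(1)])
  \<comment> \<open>Balls of radius \<open>b\<close> about \<open>f y\<close> lie in the image,
    where \<open>g\<close> is bounded by 1. Cauchy's estimate for \<open>g\<close> therefore shows
    that the differential of \<open>f\<close> expands by at least the factor
    \<open>b\<close>.\<close>
  obtain b where b: "b > 0" "(\<Union>w\<in>f ` cball 0 \<rho>. cball w b) \<subseteq> f ` ball 0 1"
    by (rule compact_subset_open_imp_cball_epsilon_subset[OF K hol_map_on_open[OF g] image_mono[OF sub(1)]])
  have lower: "b * norm u \<le> norm (fd f y u)" if y: "norm y \<le> \<rho>" for y u
  proof -
    have "f y \<in> f ` cball 0 \<rho>" using y by simp
    then have "cball (f y) b \<subseteq> (\<Union>w\<in>f ` cball 0 \<rho>. cball w b)" by (rule UN_upper)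
    then have cb: "cball (f y) b \<subseteq> f ` ball 0 1" using b(2) by (rule order_trans)
    have "norm (fd g (f y) (fd f y u)) \<le> 1 * norm (fd f y u) / b"
    proof (rule cauchy_fd_bound_map[OF g cb _ b(1)])
      fix w assume "w \<in> cball (f y) b"
      then have "norm (g w) < 1" using g_image cb by blast
      then show "norm (g w) \<le> 1" by simp
    qed
    moreover have "fd g (f y) (fd f y u) = u"
      by (rule fd_inverse(1)[OF f g]) (use gf y \<rho> in auto)
    ultimately show ?thesis using b(1) by (simp add: field_simps)
  qed
  obtain a where a: "a > 0" "\<And>z. norm (A z) \<le> a * norm z" using complex_linear_bound[OF A] by blast
  obtain H where H: "H > 0" "\<And>z. norm z \<le> \<rho>' \<Longrightarrow> norm (h z) \<le> H"
    using hol_map_on_bounded_cball[OF h_hol sub(2)] by metis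
  define L where "L = H / d"
  have L: "L > 0" using H d by (simp add: L_def)
  have hL: "norm (h y) \<le> L * norm y" if "norm y \<le> \<rho>" for y
  proof -
    have "norm (h y - h 0) \<le> H / (\<rho>' - \<rho>) * norm (y - 0)"
      by (rule lipschitz_on_smaller_ball[OF h_hol sub(2) _ \<rho>'(1)]) (use H(2) that \<rho> in auto)
    then show ?thesis by (simp add: h_0 L_def d_def)
  qed
  define c where "c = m * ((1 - \<rho>) / (1 + \<rho>))"
  have c: "c > 0" using m \<rho> by (simp add: c_def)
  \<comment> \<open>\<open>b / 2\<close> lets half of the expansion of the differential of
    \<open>f\<close> survive the perturbation; the other bound makes the defect of
    \<open>E - h y\<close> at most \<open>(b / 2) * c * norm y\<close>.\<close>
  define \<theta> where "\<theta> = min (b / 2) (b * c / (2 * (a + L)))"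
  have \<theta>: "\<theta> > 0" "\<theta> \<le> b / 2" "\<theta> \<le> b * c / (2 * (a + L))"
    unfolding \<theta>_def by (use b c a L in simp, rule min.cobounded1, rule min.cobounded2)
  have \<theta>c: "\<theta> * (a + L) \<le> (b / 2) * c"
    using \<theta>(3) a(1) L by (simp add: pos_le_divide_eq mult_ac)
  show ?thesis
  \<comment> \<open>Cauchy's estimate at distance \<open>d\<close> turns closeness
    \<open>\<theta> * d\<close> into \<open>\<theta>\<close> for the differentials.\<close>
  proof (rule that[of "\<theta> * d"])
    show "\<theta> * d > 0" using \<theta> d by simp
    fix \<Psi> \<Psi>' and y :: "complex^'n"
    assume \<Psi>: "\<Psi> \<in> Aut_space" "holomorphic_map_on \<Psi>' UNIV" "\<And>z. \<Psi>' (\<Psi> z) = z" "\<Psi> 0 = 0"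
      and close: "\<And>z. norm z \<le> (1 + \<rho>) / 2 \<Longrightarrow> norm (\<Psi> z - f z) \<le> \<theta> * d"
      and y: "norm y \<le> \<rho>"
    obtain \<Psi>'' where \<Psi>'': "holomorphic_map_on \<Psi> UNIV" "\<And>z. \<Psi> (\<Psi>'' z) = z"
      using Aut_spaceE[OF \<Psi>(1)] by metis
    have surj: "range \<Psi> = UNIV" using \<Psi>''(2) by (metis surjI)
    define D where "D z = \<Psi> z - f z" for z
    have Dhol: "holomorphic_map_on D (ball 0 1)"
      unfolding D_def by (intro hol_map_on_diff f hol_map_on_subset[OF \<Psi>''(1)]) auto
    have Db: "norm (D z) \<le> \<theta> * d" if "z \<in> cball 0 \<rho>'" for z
      using close[of z] that by (simp add: D_def \<rho>'_def)
    have y1: "y \<in> ball 0 1" using y \<rho> by simp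
    have cb: "cball y d \<subseteq> cball 0 \<rho>'"
      by (rule cball_subset_cball_0) (use y in \<open>simp add: d_def\<close>)
    have fdD: "norm (fd D y u) \<le> \<theta> * norm u" for u
    proof -
      have "norm (fd D y u) \<le> (\<theta> * d) * norm u / d"
        by (rule cauchy_fd_bound_map[OF Dhol _ _ d]) (use cb sub(2) Db in auto)
      then show ?thesis using d by simp
    qed
    have Dy: "norm (D y) \<le> \<theta> * norm y"
    proof -
      have "norm (D y - D 0) \<le> (\<theta> * d) / (\<rho>' - \<rho>) * norm (y - 0)"
        by (rule lipschitz_on_smaller_ball[OF Dhol sub(2) Db \<rho>'(1)]) (use y \<rho> in auto)
      then show ?thesis using d by (simp add: D_def \<Psi>(4) f0 d_def)
    qed
    have fd\<Psi>: "fd \<Psi> y u = fd f y u + fd D y u" for u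
    proof -
      have "(D has_derivative (\<lambda>u. fd \<Psi> y u - fd f y u)) (at y)"
        unfolding D_def by (intro has_derivative_diff hol_map_on_fd(1)[OF \<Psi>''(1)] hol_map_on_fd(1)[OF f y1]) auto
      then show ?thesis by (simp add: fd_eqI)
    qed
    define E where "E = fd \<Psi>' (\<Psi> y) (A (\<Psi> y))"
    have lin\<Psi>: "linear (fd \<Psi> y)" using hol_map_on_fd(1)[OF \<Psi>''(1)] has_derivative_linear by blast
    have linA: "linear A" by (rule complex_linear_imp_linear[OF A])
    have "fd \<Psi> y E = A (\<Psi> y)"
      unfolding E_def using fd_inverse(2)[of \<Psi> UNIV \<Psi>' y] \<Psi> \<Psi>'' surj by auto
    moreover have "fd f y (h y) = A (f y)"
      unfolding h_def by (rule fd_inverse(2)[OF f g _ y1]) (simp add: gf)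
    \<comment> \<open>Subtracting the two conjugacy equations and writing
      \<open>\<Psi> = f + D\<close> leaves only terms that contain the error
      \<open>D\<close>.\<close>
    ultimately have "fd \<Psi> y (E - h y) = A (D y) - fd D y (h y)"
      by (simp add: linear_diff[OF lin\<Psi>] fd\<Psi>[of "h y"] D_def linear_diff[OF linA])
    then have "norm (fd \<Psi> y (E - h y)) \<le> norm (A (D y)) + norm (fd D y (h y))"
      by (metis norm_triangle_ineq4)
    moreover have "norm (A (D y)) \<le> a * (\<theta> * norm y)"
      using a(2)[of "D y"] mult_left_mono[OF Dy less_imp_le[OF a(1)]] by linarith
    moreover have "norm (fd D y (h y)) \<le> \<theta> * (L * norm y)"
      using fdD[of "h y"] mult_left_mono[OF hL[OF y] less_imp_le[OF \<theta>(1)]] by linarith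
    ultimately have "norm (fd \<Psi> y (E - h y)) \<le> (\<theta> * (a + L)) * norm y" by (simp add: algebra_simps)
    also have "\<dots> \<le> (b / 2) * c * norm y" by (intro mult_right_mono \<theta>c) auto
    finally have up: "norm (fd \<Psi> y (E - h y)) \<le> (b / 2) * c * norm y" .
    have "b * norm (E - h y) \<le> norm (fd f y (E - h y))" by (rule lower[OF y])
    also have "\<dots> \<le> norm (fd \<Psi> y (E - h y)) + norm (fd D y (E - h y))"
      using norm_triangle_ineq4[of "fd f y (E - h y) + fd D y (E - h y)" "fd D y (E - h y)"] by (simp add: fd\<Psi>)
    also have "norm (fd D y (E - h y)) \<le> (b / 2) * norm (E - h y)"
      using fdD[of "E - h y"] mult_right_mono[OF \<theta>(2) norm_ge_zero[of "E - h y"]] by linarith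
    finally have "(b / 2) * norm (E - h y) \<le> (b / 2) * (c * norm y)" using up by simp
    then have Eh: "norm (E - h y) \<le> c * norm y" using b(1) by simp
    have "c * (norm y)\<^sup>2 \<le> h y \<bullet> y"
    proof -
      have "(1 - \<rho>) / (1 + \<rho>) \<le> (1 - norm y) / (1 + norm y)"
        using y \<rho> by (intro frac_le add_pos_nonneg) auto
      then have "c * (norm y)\<^sup>2 \<le> m * ((1 - norm y) / (1 + norm y)) * (norm y)\<^sup>2"
        unfolding c_def using m(1) by (intro mult_right_mono mult_left_mono) auto
      then show ?thesis using h_lower_bound[of y] y1 by simp
    qed
    moreover have "- ((E - h y) \<bullet> y) \<le> c * norm y * norm y"
      using Cauchy_Schwarz_ineq2[of "E - h y" y] mult_right_mono[OF Eh norm_ge_zero[of y]] by linarith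
    ultimately have "0 \<le> E \<bullet> y" by (simp add: inner_diff_left power2_eq_square)
    then show "0 \<le> fd \<Psi>' (\<Psi> y) (A (\<Psi> y)) \<bullet> y" by (simp add: E_def)
  qed
qed

end

text \<open>First-exit argument: the norm of the trajectory cannot increase while it stays in the ball.\<close>

lemma Aut_image_spiral:
  fixes A \<Psi> \<Psi>' :: "complex^'n \<Rightarrow> complex^'n"
  assumes A: "complex_linear A" and \<Psi>: "holomorphic_map_on \<Psi> UNIV" "holomorphic_map_on \<Psi>' UNIV"
    "\<And>z. \<Psi>' (\<Psi> z) = z" "\<And>z. \<Psi> (\<Psi>' z) = z"
    and pos: "\<And>y. norm y \<le> \<rho> \<Longrightarrow> 0 \<le> fd \<Psi>' (\<Psi> y) (A (\<Psi> y)) \<bullet> y"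
    and t: "t \<ge> 0" and z: "norm z < \<rho>"
  shows "eflow A (- t) (\<Psi> z) \<in> \<Psi> ` ball 0 \<rho>"
proof -
  define y where "y s = \<Psi>' (eflow A (- s) (\<Psi> z))" for s
  have \<Psi>y: "\<Psi> (y s) = eflow A (- s) (\<Psi> z)" for s by (simp add: y_def \<Psi>(4))
  have y': "(y has_vector_derivative - fd \<Psi>' (\<Psi> (y s)) (A (\<Psi> (y s)))) (at s)" for s
  proof -
    let ?w = "eflow A (- s) (\<Psi> z)"
    have "((\<lambda>t. - t) has_vector_derivative - 1) (at s)"
      by (auto intro!: derivative_eq_intros simp: has_real_derivative_iff_has_vector_derivative[symmetric])
    from vector_diff_chain_at[OF this eflow_has_vector_derivative[OF A]]
    have "((\<lambda>t. eflow A (- t) (\<Psi> z)) has_vector_derivative - A ?w) (at s)"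
      by (simp add: o_def)
    from vector_derivative_diff_chain_within[OF this has_derivative_at_withinI[OF hol_map_on_fd(1)[OF \<Psi>(2)]]]
    have "(y has_vector_derivative fd \<Psi>' ?w (- A ?w)) (at s)"
      by (simp add: o_def y_def[abs_def])
    moreover have "linear (fd \<Psi>' ?w)" using hol_map_on_fd(1)[OF \<Psi>(2)] has_derivative_linear by blast
    ultimately show ?thesis by (simp add: linear_neg \<Psi>y)
  qed
  have cont: "continuous_on S (\<lambda>s. norm (y s))" for S
    by (intro continuous_on_norm continuous_at_imp_continuous_on ballI has_vector_derivative_continuous[OF y'])
  have y0: "y 0 = z" by (simp add: y_def eflow_0[OF A] \<Psi>(3))
  have "norm (y t) < \<rho>"
  proof (rule ccontr)
    assume not: "\<not> norm (y t) < \<rho>"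
    \<comment> \<open>A level strictly between the initial norm and \<open>\<rho>\<close>. The first
      time \<open>\<tau>\<close> at which it is attained contradicts monotonicity of the norm on the
      interval from 0 to \<open>\<tau>\<close>.\<close>
    define \<rho>1 where "\<rho>1 = (norm z + \<rho>) / 2"
    have \<rho>1: "norm z < \<rho>1" "\<rho>1 < \<rho>" using z by (auto simp: \<rho>1_def)
    define T where "T = {s \<in> {0..t}. norm (y s) = \<rho>1}"
    have "compact T"
    proof -
      have "closed T" unfolding T_def by (rule continuous_closed_preimage_constant[OF cont]) auto
      then have "compact ({0..t} \<inter> T)" by (intro compact_Int_closed) auto
      moreover have "{0..t} \<inter> T = T" by (auto simp: T_def)
      ultimately show ?thesis by simp
    qed
    moreover have "\<exists>s\<ge>0. s \<le> t \<and> norm (y s) = \<rho>1"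
      by (rule IVT'[OF _ _ t cont]) (use not \<rho>1 y0 in auto)
    then have "T \<noteq> {}" by (auto simp: T_def)
    ultimately have "\<exists>\<tau>\<in>T. \<forall>s\<in>T. \<tau> \<le> s" by (rule compact_attains_inf)
    then obtain \<tau> where \<tau>: "\<tau> \<in> T" "\<And>s. s \<in> T \<Longrightarrow> \<tau> \<le> s" by blast
    have \<tau>0: "0 \<le> \<tau>" "\<tau> \<le> t" "norm (y \<tau>) = \<rho>1" using \<tau>(1) by (auto simp: T_def)
    have below: "norm (y s) \<le> \<rho>1" if s: "0 \<le> s" "s \<le> \<tau>" for s
    proof (rule ccontr)
      assume "\<not> norm (y s) \<le> \<rho>1"
      then have gt: "norm (y s) > \<rho>1" by simp
      have "\<exists>x\<ge>0. x \<le> s \<and> norm (y x) = \<rho>1"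
        by (rule IVT'[OF _ _ s(1) cont]) (use gt \<rho>1 y0 in auto)
      then obtain x where x: "0 \<le> x" "x \<le> s" "norm (y x) = \<rho>1" by blast
      then have "x \<in> T" using s \<tau>0 by (auto simp: T_def)
      then have "\<tau> \<le> x" by (rule \<tau>(2))
      then show False using x s gt by (metis order.antisym order_less_irrefl order_trans)
    qed
    have "(norm (y \<tau>))\<^sup>2 \<le> (norm (y 0))\<^sup>2"
    proof (rule DERIV_nonpos_imp_nonincreasing[OF \<tau>0(1)])
      fix s assume s: "0 \<le> s" "s \<le> \<tau>"
      have "0 \<le> fd \<Psi>' (\<Psi> (y s)) (A (\<Psi> (y s))) \<bullet> y s" using below[OF s] \<rho>1 by (intro pos) simp
      then have "2 * (y s \<bullet> - fd \<Psi>' (\<Psi> (y s)) (A (\<Psi> (y s)))) \<le> 0" by (simp add: inner_commute)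
      then show "\<exists>d. ((\<lambda>s. (norm (y s))\<^sup>2) has_real_derivative d) (at s) \<and> d \<le> 0"
        by (intro exI conjI) (rule DERIV_norm_square[OF y'])
    qed
    then have "norm (y \<tau>) \<le> norm (y 0)" by (rule power2_le_imp_le) simp
    then show False using \<tau>0 \<rho>1 y0 by simp
  qed
  then show ?thesis using \<Psi>y[of t] by (metis imageI mem_ball_0)
qed

subsection \<open>Limits of univalent maps\<close>

lemma biholomorphismI:
  assumes "holomorphic_map_on f S" "holomorphic_map_on g (f ` S)" "\<And>z. z \<in> S \<Longrightarrow> g (f z) = z"
  shows "biholomorphism f S (f ` S)"
proof -
  have inj: "inj_on f S" by (rule inj_on_inverseI[of S g]) (rule assms(3))
  then have "holomorphic_map_on (inv_into S f) (f ` S)"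
    by (intro hol_map_on_cong[OF assms(2)]) (use assms(3) in auto)
  then show ?thesis
    using inj assms(1) by (simp add: biholomorphism_def inj_on_imp_bij_betw)
qed

text \<open>Invariance of domain makes the image open and the inverse function theorem gives the
  real differential of the inverse; this is complex linear as the inverse of a complex linear
  map.\<close>

lemma biholomorphism_if_injective:
  fixes f :: "complex^'n \<Rightarrow> complex^'n"
  assumes f: "holomorphic_map_on f S" and inj: "inj_on f S"
    and fd: "\<And>z u. z \<in> S \<Longrightarrow> fd f z u = 0 \<Longrightarrow> u = 0"
  shows "biholomorphism f S (f ` S)"
proof (rule biholomorphismI[OF f])
  let ?g = "inv_into S f"
  have S: "open S" and cont: "continuous_on S f" using f hol_map_on_open hol_map_on_continuous by auto
  have "open (f ` S)" by (rule invariance_of_domain[OF cont S inj])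
  moreover have "\<exists>D. complex_linear D \<and> (?g has_derivative D) (at (f z))" if z: "z \<in> S" for z
  proof -
    let ?L = "fd f z"
    have L: "complex_linear ?L" by (rule hol_map_on_fd(2)[OF f z])
    then have lin: "linear ?L" by (rule complex_linear_imp_linear)
    have "inj ?L" using fd[OF z] linear_injective_0[OF lin] by blast
    then obtain L' where L': "linear L'" "\<And>x. L' (?L x) = x" "\<And>x. ?L (L' x) = x"
      using linear_injective_isomorphism[OF lin] by blast
    have "L' (c *s x) = c *s L' x" for c x
    proof -
      have "L' (c *s x) = L' (?L (c *s L' x))" using L L'(3) by (simp add: complex_linear_iff)
      then show ?thesis by (simp add: L'(2))
    qed
    then have "complex_linear L'" using L'(1) by (simp add: complex_linear_iff linear_add)
    moreover have "(?g has_derivative L') (at (f z))"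
      by (rule has_derivative_inverse_strong[OF S z cont _ hol_map_on_fd(1)[OF f z]])
         (use inj L' in \<open>auto simp: fun_eq_iff\<close>)
    ultimately show ?thesis by blast
  qed
  ultimately show "holomorphic_map_on ?g (f ` S)" by (auto simp: holomorphic_map_on_def)
qed (use inj in simp)

lemma compact_subset_smaller_cball:
  fixes K :: "'a::real_normed_vector set"
  assumes "compact K" "K \<subseteq> ball 0 1"
  obtains r where "0 < r" "r < 1" "K \<subseteq> cball 0 r"
proof (cases "K = {}")
  case True
  then show ?thesis using that[of "1/2"] by simp
next
  case False
  have "\<exists>x\<in>K. \<forall>y\<in>K. norm y \<le> norm x"
    by (rule continuous_attains_sup[OF assms(1) False]) (intro continuous_intros)
  then obtain x where x: "x \<in> K" "\<And>y. y \<in> K \<Longrightarrow> norm y \<le> norm x" by blast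
  have "norm x < 1" using x assms(2) by auto
  then show ?thesis using x(2)
    by (intro that[of "(1 + norm x) / 2"]) (fastforce simp: add_pos_nonneg)+
qed

text \<open>Brouwer's theorem for the map \<open>z \<mapsto> z - L' (F z - w)\<close>.\<close>

lemma exists_preimage_near_linear:
  fixes F :: "complex^'n \<Rightarrow> complex^'n"
  assumes F: "continuous_on (cball a e) F" and e: "e > 0"
    and L: "linear L" "\<And>x. L' (L x) = x" "linear L'" "\<And>x. norm (L' x) \<le> B * norm x" "\<And>x. L (L' x) = x" "B \<ge> 0"
    and close: "\<And>z. z \<in> cball a e \<Longrightarrow> B * norm (F z - w - L (z - a)) \<le> e"
  shows "w \<in> F ` cball a e"
proof -
  define T where "T z = z - L' (F z - w)" for z
  have "continuous_on (cball a e) T"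
    unfolding T_def
    by (intro continuous_intros F linear_continuous_on_compose[OF _ L(3)])
  moreover have "T z \<in> cball a e" if z: "z \<in> cball a e" for z
  proof -
    have "T z - a = - L' (F z - w - L (z - a))"
      by (simp add: T_def linear_diff[OF L(3)] L(2))
    then have "norm (T z - a) \<le> B * norm (F z - w - L (z - a))" using L(4) by simp
    also have "\<dots> \<le> e" by (rule close[OF z])
    finally show ?thesis by (simp add: dist_norm norm_minus_commute)
  qed
  ultimately obtain x where x: "x \<in> cball a e" "T x = x"
    using brouwer[of "cball a e" T] e by (auto simp: image_subset_iff)
  then have "L' (F x - w) = 0" by (simp add: T_def)
  then have "F x - w = 0" using L(5)[of "F x - w"] linear_0[OF L(1)] by simp
  then show ?thesis using x(1) by (metis eq_iff_diff_eq_0 imageI)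
qed

lemma uniform_limit_prod:
  fixes f :: "'i \<Rightarrow> nat \<Rightarrow> complex \<Rightarrow> complex"
  assumes "finite I" "compact K" "\<And>i. i \<in> I \<Longrightarrow> uniform_limit K (f i) (l i) sequentially"
    "\<And>i. i \<in> I \<Longrightarrow> continuous_on K (l i)"
  shows "uniform_limit K (\<lambda>n z. \<Prod>i\<in>I. f i n z) (\<lambda>z. \<Prod>i\<in>I. l i z) sequentially"
  using assms
proof (induction I rule: finite_induct)
  case (insert i I)
  have "bounded (g ` K)" if "continuous_on K g" for g :: "complex \<Rightarrow> complex"
    using compact_continuous_image[OF that insert.prems(1)] compact_imp_bounded by blast
  then have "uniform_limit K (\<lambda>n z. f i n z * (\<Prod>i\<in>I. f i n z)) (\<lambda>z. l i z * (\<Prod>i\<in>I. l i z)) sequentially"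
    using insert by (intro uniform_lim_mult) (auto intro!: continuous_on_prod)
  then show ?case using insert by simp
qed (simp add: uniform_limit_const)

lemma uniform_limit_sum:
  fixes f :: "'i \<Rightarrow> nat \<Rightarrow> complex \<Rightarrow> complex"
  assumes "finite I" "\<And>i. i \<in> I \<Longrightarrow> uniform_limit K (f i) (l i) sequentially"
  shows "uniform_limit K (\<lambda>n z. \<Sum>i\<in>I. f i n z) (\<lambda>z. \<Sum>i\<in>I. l i z) sequentially"
  using assms by (induction I rule: finite_induct) (auto intro: uniform_limit_const uniform_limit_add)

lemma det_matrix_nonzero_iff:
  fixes L :: "complex^'n \<Rightarrow> complex^'n"
  assumes "complex_linear L"
  shows "det (matrix L) \<noteq> 0 \<longleftrightarrow> (\<forall>u. L u = 0 \<longrightarrow> u = 0)"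
proof -
  have L: "(\<lambda>x. matrix L *v x) = L" using assms by (metis matrix_vector_mul ext)
  have "det (matrix L) \<noteq> 0 \<longleftrightarrow> inj ((*v) (matrix L))"
    by (metis invertible_det_nz invertible_left_inverse matrix_left_invertible_injective)
  also have "\<dots> \<longleftrightarrow> (\<forall>u. L u = 0 \<longrightarrow> u = 0)"
    unfolding L
    by (rule linear_injective_0[OF complex_linear_imp_linear[OF assms]])
  finally show ?thesis .
qed

lemma jacobian_slice_holomorphic:
  assumes G: "holomorphic_map_on G (ball 0 1)" and T: "\<And>\<zeta>. \<zeta> \<in> T \<Longrightarrow> \<zeta> *s a \<in> ball 0 1"
  shows "(\<lambda>\<zeta>. fd G (\<zeta> *s a) (axis j 1) $ i) holomorphic_on T"
proof -
  have Gi: "hol_fun_on (\<lambda>z. G z $ i) (ball 0 1)" using G hol_map_on_componentwise by blast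
  have "(\<lambda>\<zeta>. fd (\<lambda>z. G z $ i) (0 + \<zeta> *s a) (axis j 1)) holomorphic_on T"
    by (rule slice_holomorphic[OF hol_fun_on_directional_derivative[OF Gi]]) (use T in simp)
  then show ?thesis
    by (rule holomorphic_transform) (use T hol_map_on_fd_nth[OF G] in simp)
qed

text \<open>One-variable Hurwitz, applied to the Jacobian determinant on the complex line through \<open>a\<close>.\<close>

lemma locally_uniform_limit_jacobian:
  fixes F :: "nat \<Rightarrow> complex^'n \<Rightarrow> complex^'n"
  assumes F: "\<And>n. holomorphic_map_on (F n) (ball 0 1)" and f: "holomorphic_map_on f (ball 0 1)"
    and lim: "\<And>r. r < 1 \<Longrightarrow> uniform_limit (cball 0 r) F f sequentially"
    and inj: "\<And>n z u. z \<in> ball 0 1 \<Longrightarrow> fd (F n) z u = 0 \<Longrightarrow> u = 0"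
    and f0: "\<And>u. fd f 0 u = u"
    and a: "norm a < 1" and u: "fd f a u = 0"
  shows "u = 0"
proof -
  \<comment> \<open>Any \<open>R > 1\<close> with \<open>R * norm a < 1\<close> would serve: the
    disc contains 1, which corresponds to \<open>a\<close>, and its multiples of \<open>a\<close>
    stay in the ball.\<close>
  define R where "R = 2 / (1 + norm a)"
  define T where "T = ball (0::complex) R"
  have n1: "1 + norm a > 0" using norm_ge_zero[of a] by linarith
  have R: "R > 1" "R * norm a < 1" using a n1 by (auto simp: R_def field_simps)
  have Ta: "\<zeta> *s a \<in> ball 0 1" if "\<zeta> \<in> T" for \<zeta>
  proof -
    have "norm \<zeta> * norm a \<le> R * norm a" using that by (intro mult_right_mono) (auto simp: T_def)
    then show ?thesis using R by simp
  qed
  define J where "J G \<zeta> = det (matrix (fd G (\<zeta> *s a)))" for G :: "complex^'n \<Rightarrow> complex^'n" and \<zeta>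
  have J: "J G \<zeta> = (\<Sum>p\<in>{p. p permutes UNIV}. of_int (sign p) * (\<Prod>i\<in>UNIV. fd G (\<zeta> *s a) (axis (p i) 1) $ i))" for G \<zeta>
    by (simp add: J_def det_def matrix_def)
  have Jhol: "J G holomorphic_on T" if "holomorphic_map_on G (ball 0 1)" for G
    unfolding J[abs_def] by (intro holomorphic_intros jacobian_slice_holomorphic[OF that Ta])
  have Jn: "J (F n) \<zeta> \<noteq> 0" if "\<zeta> \<in> T" for n \<zeta>
    unfolding J_def
    using det_matrix_nonzero_iff[OF hol_map_on_fd(2)[OF F Ta[OF that]]] inj[OF Ta[OF that]] by blast
  have "J f 0 \<noteq> 0"
  proof -
    have z0: "(0 :: complex^'n) \<in> ball 0 1" by simp
    show ?thesis
      unfolding J_def using det_matrix_nonzero_iff[OF hol_map_on_fd(2)[OF f z0]] f0 by simp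
  qed
  \<comment> \<open>Hurwitz's theorem needs a nonconstant limit; a constant one equals its value at
    0, where the differential of \<open>f\<close> is the identity.\<close>
  have "J f 1 \<noteq> 0"
  proof (cases "J f constant_on T")
    case True
    then have "J f 1 = J f 0" using R unfolding constant_on_def T_def by fastforce
    then show ?thesis using \<open>J f 0 \<noteq> 0\<close> by simp
  next
    case False
    show ?thesis
    proof (rule Hurwitz_no_zeros[where \<F> = "\<lambda>n. J (F n)" and S = T and g = "J f" and ?z0.0 = 1])
      show "open T" "connected T" "1 \<in> T" using R by (auto simp: T_def)
      show "uniform_limit K (\<lambda>n. J (F n)) (J f) sequentially" if K: "compact K" "K \<subseteq> T" for K
      proof -
        have "compact ((\<lambda>\<zeta>. \<zeta> *s a) ` K)"
          by (intro compact_continuous_image K linear_continuous_on bounded_linear_smult_left)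
        moreover have "(\<lambda>\<zeta>. \<zeta> *s a) ` K \<subseteq> ball 0 1" using Ta K by blast
        ultimately obtain r where r: "r < 1" "(\<lambda>\<zeta>. \<zeta> *s a) ` K \<subseteq> cball 0 r"
          using compact_subset_smaller_cball by metis
        define d where "d = (1 - r) / 2"
        have d: "d > 0" "r + d < 1" using r by (auto simp: d_def field_simps)
        \<comment> \<open>Uniform convergence on the ball of radius \<open>r + d\<close> passes to
          the differentials on the ball of radius \<open>r\<close> by Cauchy's estimate at distance
          \<open>d\<close>.\<close>
        have entry: "uniform_limit K (\<lambda>n \<zeta>. fd (F n) (\<zeta> *s a) (axis j 1) $ i) (\<lambda>\<zeta>. fd f (\<zeta> *s a) (axis j 1) $ i) sequentially" for i j
        proof (rule uniform_limitI)
          fix e :: real assume e: "e > 0"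
          have "\<forall>\<^sub>F n in sequentially. \<forall>x\<in>cball 0 (r + d). dist (F n x) (f x) < e * d / 2"
            by (rule uniform_limitD[OF lim[OF d(2)]]) (use e d in simp)
          then show "\<forall>\<^sub>F n in sequentially. \<forall>\<zeta>\<in>K. dist (fd (F n) (\<zeta> *s a) (axis j 1) $ i) (fd f (\<zeta> *s a) (axis j 1) $ i) < e"
          proof (rule eventually_mono, intro ballI)
            fix n \<zeta> assume n: "\<forall>x\<in>cball 0 (r + d). dist (F n x) (f x) < e * d / 2" and \<zeta>: "\<zeta> \<in> K"
            let ?z = "\<zeta> *s a"
            have z: "norm ?z \<le> r" using r(2) \<zeta> by auto
            have zb: "?z \<in> ball 0 1" using z r by (simp del: norm_smult)
            have cb: "cball ?z d \<subseteq> cball 0 (r + d)"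
              by (rule cball_subset_cball_0) (use z in simp)
            have cb1: "cball ?z d \<subseteq> ball 0 1" using cb d by fastforce
            have diff: "holomorphic_map_on (\<lambda>z. F n z - f z) (ball 0 1)" by (intro hol_map_on_diff F f)
            have "norm (fd (\<lambda>z. F n z - f z) ?z (axis j 1)) \<le> (e * d / 2) * norm (axis j 1 :: complex^'n) / d"
              by (rule cauchy_fd_bound_map[OF diff cb1 _ d(1)]) (use n cb in \<open>fastforce simp: dist_norm\<close>)
            moreover have "fd (\<lambda>z. F n z - f z) ?z v = fd (F n) ?z v - fd f ?z v" for v
              using fd_eqI[OF has_derivative_diff[OF hol_map_on_fd(1)[OF F zb] hol_map_on_fd(1)[OF f zb]]] by simp
            moreover have "norm (axis j 1 :: complex^'n) = 1" by simp
            ultimately have "norm (fd (F n) ?z (axis j 1) - fd f ?z (axis j 1)) \<le> e / 2" using d by simp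
            then have "norm ((fd (F n) ?z (axis j 1) - fd f ?z (axis j 1)) $ i) \<le> e / 2"
              by (rule order_trans[OF Finite_Cartesian_Product.norm_nth_le])
            then show "dist (fd (F n) ?z (axis j 1) $ i) (fd f ?z (axis j 1) $ i) < e"
              using e by (simp add: dist_norm)
          qed
        qed
        have cont: "continuous_on K (\<lambda>\<zeta>. fd f (\<zeta> *s a) (axis j 1) $ i)" for i j
          using jacobian_slice_holomorphic[OF f Ta] K(2)
          by (meson holomorphic_on_imp_continuous_on continuous_on_subset)
        show ?thesis
          unfolding J[abs_def]
        proof (rule uniform_limit_sum)
          fix p
          have "uniform_limit K (\<lambda>n \<zeta>. \<Prod>i\<in>UNIV. fd (F n) (\<zeta> *s a) (axis (p i) 1) $ i) (\<lambda>\<zeta>. \<Prod>i\<in>UNIV. fd f (\<zeta> *s a) (axis (p i) 1) $ i) sequentially"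
            by (rule uniform_limit_prod[OF _ K(1) entry cont]) auto
          then show "uniform_limit K (\<lambda>n \<zeta>. of_int (sign p) * (\<Prod>i\<in>UNIV. fd (F n) (\<zeta> *s a) (axis (p i) 1) $ i))
            (\<lambda>\<zeta>. of_int (sign p) * (\<Prod>i\<in>UNIV. fd f (\<zeta> *s a) (axis (p i) 1) $ i)) sequentially"
            by (rule bounded_linear.uniform_limit[OF bounded_linear_mult_right])
        qed (simp add: finite_permutations)
      qed
    qed (use Jhol F f Jn False in auto)
  qed
  then show ?thesis
    unfolding J_def using det_matrix_nonzero_iff[OF hol_map_on_fd(2)[OF f]] a u by simp
qed

text \<open>If \<open>f a = f b\<close> with \<open>a \<noteq> b\<close>, then for large
  \<open>n\<close> the map \<open>F n\<close> attains this common value near \<open>a\<close> and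
  near \<open>b\<close>, contradicting its injectivity. Attaining it near a point rests on
  invertibility of the differential of \<open>f\<close> there.\<close>

lemma locally_uniform_limit_injective:
  fixes F :: "nat \<Rightarrow> complex^'n \<Rightarrow> complex^'n"
  assumes F: "\<And>n. holomorphic_map_on (F n) (ball 0 1)" "\<And>n. inj_on (F n) (ball 0 1)" and f: "holomorphic_map_on f (ball 0 1)"
    and lim: "\<And>r. r < 1 \<Longrightarrow> uniform_limit (cball 0 r) F f sequentially"
    and fd: "\<And>z u. z \<in> ball 0 1 \<Longrightarrow> fd f z u = 0 \<Longrightarrow> u = 0"
  shows "inj_on f (ball 0 1)"
proof (rule inj_onI, rule ccontr)
  fix a b assume ab: "a \<in> ball 0 1" "b \<in> ball 0 1" "f a = f b" "a \<noteq> b"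
  have local: "\<exists>d>0. \<forall>e. 0 < e \<and> e < d \<longrightarrow> (\<forall>\<^sub>F n in sequentially. f z \<in> F n ` cball z e)" if z: "z \<in> ball 0 1" for z
  proof -
    let ?L = "fd f z"
    have "complex_linear ?L" by (rule hol_map_on_fd(2)[OF f z])
    then have lin: "linear ?L" by (rule complex_linear_imp_linear)
    have "inj ?L" using fd[OF z] linear_injective_0[OF lin] by blast
    then obtain L' where L': "linear L'" "\<And>x. L' (?L x) = x" "\<And>x. ?L (L' x) = x"
      using linear_injective_isomorphism[OF lin] by blast
    obtain B where B: "B > 0" "\<And>x. norm (L' x) \<le> B * norm x" using linear_bounded_pos[OF L'(1)] by blast
    obtain d where d: "d > 0" "\<And>y. norm (y - z) < d \<Longrightarrow> norm (f y - f z - ?L (y - z)) \<le> 1 / (2 * B) * norm (y - z)"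
    proof -
      have B2: "1 / (2 * B) > 0" using B by simp
      have "\<forall>e>0. \<exists>d>0. \<forall>y. norm (y - z) < d \<longrightarrow> norm (f y - f z - ?L (y - z)) \<le> e * norm (y - z)"
        using hol_map_on_fd(1)[OF f z] unfolding has_derivative_at_alt by (rule conjunct2)
      from this[rule_format, OF B2] show ?thesis by (elim exE conjE) (rule that, assumption, blast)
    qed
    define d' where "d' = min d ((1 - norm z) / 2)"
    have d': "d' > 0" "d' \<le> d" "d' \<le> (1 - norm z) / 2" unfolding d'_def by (use d z in simp, rule min.cobounded1, rule min.cobounded2)
    have "\<forall>\<^sub>F n in sequentially. f z \<in> F n ` cball z e" if e: "0 < e" "e < d'" for e
    proof -
      define r where "r = norm z + e"
      have r: "r < 1" using e d' z by (simp add: r_def)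
      have cb: "cball z e \<subseteq> cball 0 r"
        by (rule cball_subset_cball_0) (simp add: r_def)
      have "\<forall>\<^sub>F n in sequentially. \<forall>x\<in>cball 0 r. dist (F n x) (f x) < e / (2 * B)"
        by (rule uniform_limitD[OF lim[OF r]]) (use e B in simp)
      then show ?thesis
      proof (rule eventually_mono)
        fix n assume n: "\<forall>x\<in>cball 0 r. dist (F n x) (f x) < e / (2 * B)"
        show "f z \<in> F n ` cball z e"
        proof (rule exists_preimage_near_linear[OF _ e(1) lin L'(2,1) B(2) L'(3)])
          have "cball z e \<subseteq> ball 0 1" using cb r by fastforce
          then show "continuous_on (cball z e) (F n)"
            using hol_map_on_continuous[OF F(1)] continuous_on_subset by blast
          fix y assume y: "y \<in> cball z e"
          then have yz: "norm (y - z) \<le> e" "norm (y - z) < d"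
            using e d' by (auto simp: dist_norm norm_minus_commute)
          have "norm (F n y - f z - ?L (y - z)) \<le> norm (F n y - f y) + norm (f y - f z - ?L (y - z))"
            using norm_triangle_ineq[of "F n y - f y" "f y - f z - ?L (y - z)"]
            by (simp only: add_diff_eq diff_add_cancel)
          also have "\<dots> \<le> e / (2 * B) + 1 / (2 * B) * e"
          proof (intro add_mono)
            show "norm (F n y - f y) \<le> e / (2 * B)" using n y cb by (fastforce simp: dist_norm)
            have "norm (f y - f z - ?L (y - z)) \<le> 1 / (2 * B) * norm (y - z)" by (rule d(2)[OF yz(2)])
            also have "\<dots> \<le> 1 / (2 * B) * e" using yz B by (intro mult_left_mono) auto
            finally show "norm (f y - f z - ?L (y - z)) \<le> 1 / (2 * B) * e" .
          qed
          also have "\<dots> = e / B" using B by (simp add: field_simps)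
          finally show "B * norm (F n y - f z - ?L (y - z)) \<le> e"
            using B(1) by (simp add: field_simps)
        qed (use B in simp)
      qed
    qed
    then show ?thesis using d'(1) by blast
  qed
  obtain da where da: "da > 0" "\<And>e. 0 < e \<Longrightarrow> e < da \<Longrightarrow> \<forall>\<^sub>F n in sequentially. f a \<in> F n ` cball a e"
    using local[OF ab(1)] by blast
  obtain db where db: "db > 0" "\<And>e. 0 < e \<Longrightarrow> e < db \<Longrightarrow> \<forall>\<^sub>F n in sequentially. f b \<in> F n ` cball b e"
    using local[OF ab(2)] by blast
  \<comment> \<open>A third of the distance keeps the balls about \<open>a\<close> and
    \<open>b\<close> disjoint; the last two entries keep them inside the unit ball.\<close>
  define e where "e = Min {da / 2, db / 2, dist a b / 3, (1 - norm a) / 2, (1 - norm b) / 2}"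
  have e: "0 < e" "e < da" "e < db" "e \<le> dist a b / 3" "e < 1 - norm a" "e < 1 - norm b"
    using da(1) db(1) ab by (auto simp: e_def min_less_iff_disj)
  obtain n where n: "f a \<in> F n ` cball a e" "f b \<in> F n ` cball b e"
    using eventually_happens[OF eventually_conj[OF da(2)[OF e(1,2)] db(2)[OF e(1,3)]]] by auto
  then obtain x y where xy: "x \<in> cball a e" "y \<in> cball b e" "F n x = F n y" using ab(3) by force
  have "norm x < 1" "norm y < 1"
    using xy e norm_triangle_sub[of x a] norm_triangle_sub[of y b] by (auto simp: dist_norm norm_minus_commute)
  then have "x = y" using F(2)[of n] xy(3) by (auto dest: inj_onD)
  then have "dist a b \<le> e + e" using xy dist_triangle[of a b x] by (auto simp: dist_commute)
  then show False using e ab(4) zero_less_dist_iff[of a b] by linarith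
qed

subsection \<open>The density theorem\<close>

lemma normalized_univalentD:
  assumes "f \<in> normalized_univalent"
  shows "holomorphic_map_on f (ball 0 1)" "holomorphic_map_on (inv_into (ball 0 1) f) (f ` ball 0 1)"
    "inj_on f (ball 0 1)" "f 0 = 0" "fd f 0 u = u" "f \<in> extensional unit_ball"
    "z \<in> ball 0 1 \<Longrightarrow> inv_into (ball 0 1) f (f z) = z"
proof -
  have *: "f \<in> hol_maps" "biholomorphism f (ball 0 1) (f ` ball 0 1)" "f 0 = 0" "(f has_derivative (\<lambda>v. v)) (at 0)"
    using assms by (auto simp: normalized_univalent_def unit_ball_def)
  show "fd f 0 u = u" using fd_eqI[OF *(4)] by simp
  show inj: "inj_on f (ball 0 1)" using *(2) by (simp add: biholomorphism_def bij_betw_def)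
  show "z \<in> ball 0 1 \<Longrightarrow> inv_into (ball 0 1) f (f z) = z" using inj by simp
qed (use assms in \<open>auto simp: normalized_univalent_def hol_maps_def unit_ball_def biholomorphism_def\<close>)

lemma normalized_univalentI:
  assumes "holomorphic_map_on f (ball 0 1)" "biholomorphism f (ball 0 1) (f ` ball 0 1)" "f \<in> extensional unit_ball"
    "f 0 = 0" "\<And>u. fd f 0 u = u"
  shows "f \<in> normalized_univalent"
proof -
  have "(0 :: complex^'a) \<in> ball 0 1" by simp
  moreover have "fd f 0 = (\<lambda>v. v)" using assms(5) by (simp add: fun_eq_iff)
  ultimately have "(f has_derivative (\<lambda>v. v)) (at 0)"
    using hol_map_on_fd(1)[OF assms(1)] by metis
  then show ?thesis using assms by (simp add: normalized_univalent_def hol_maps_def unit_ball_def)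
qed

section \<open>Closedness of the spirallike class\<close>

lemma spirallike_maps_iff:
  "f \<in> spirallike_maps A \<longleftrightarrow> f \<in> normalized_univalent \<and> (\<forall>t\<ge>0. eflow A (- t) ` f ` ball 0 1 \<subseteq> f ` ball 0 1)"
  by (simp add: spirallike_maps_def eflow_def unit_ball_def)

lemma m_op_le:
  fixes A :: "complex^'n \<Rightarrow> complex^'n"
  assumes A: "complex_linear A"
  shows "m_op A * (norm z)\<^sup>2 \<le> A z \<bullet> z"
proof (cases "z = 0")
  case False
  define w where "w = (1 / norm z) *\<^sub>R z"
  have "norm w = 1" using False by (simp add: w_def)
  then have "m_op A \<le> A w \<bullet> w" using m_op_attained[OF A] by (auto simp: Re_hinner)
  moreover have "A w = (1 / norm z) *\<^sub>R A z"
    unfolding w_def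
    by (rule linear_scale[OF complex_linear_imp_linear[OF A]])
  ultimately have "m_op A \<le> (A z \<bullet> z) / (norm z)\<^sup>2" by (simp add: w_def power2_eq_square)
  then show ?thesis using False by (simp add: pos_le_divide_eq)
qed simp

lemma spirallike_map_locale:
  assumes A: "complex_linear A" "m_op A > 0" and f: "f \<in> spirallike_maps A"
  shows "spirallike_map A f (inv_into (ball 0 1) f) (m_op A)"
proof -
  have fn: "f \<in> normalized_univalent" and sp: "\<forall>t\<ge>0. eflow A (- t) ` f ` ball 0 1 \<subseteq> f ` ball 0 1"
    using f unfolding spirallike_maps_iff by blast+
  note N = normalized_univalentD[OF fn]
  show ?thesis
  proof unfold_locales
    show "eflow A (- t) ` f ` ball 0 1 \<subseteq> f ` ball 0 1" if "t \<ge> 0" for t using sp that by blast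
    show "inv_into (ball 0 1) f (f z) = z" if "norm z < 1" for z using N(7) that by simp
  qed (use A N(1,2,4,5) m_op_le[OF A(1)] in \<open>auto simp: complex_linear_iff\<close>)
qed

text \<open>For invariance of the limit image, \<open>V n z\<close> denotes the point whose image
  under \<open>F n\<close> is the flow applied to \<open>F n z\<close>. All \<open>V n z\<close> lie
  in \<open>cball 0 (norm z)\<close>, and the limit \<open>y\<close> of a convergent subsequence
  satisfies \<open>f y = eflow A (- t) (f z)\<close>.\<close>

lemma spirallike_limit:
  fixes A :: "complex^'n \<Rightarrow> complex^'n"
  assumes A: "complex_linear A" and F: "\<And>n. F n \<in> spirallike_maps A" and f: "f \<in> hol_maps"
    and lim: "\<And>r. r < 1 \<Longrightarrow> uniform_limit (cball 0 r) F f sequentially"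
  shows "f \<in> spirallike_maps A"
proof -
  have Fn: "F n \<in> normalized_univalent" and Fs: "t \<ge> 0 \<Longrightarrow> eflow A (- t) ` F n ` ball 0 1 \<subseteq> F n ` ball 0 1" for n t
    using F[of n] by (auto simp only: spirallike_maps_iff)
  note N = normalized_univalentD[OF Fn]
  have fhol: "holomorphic_map_on f (ball 0 1)" and fext: "f \<in> extensional unit_ball"
    using f by (auto simp: hol_maps_def unit_ball_def)
  have ptw: "(\<lambda>n. F n z) \<longlonglongrightarrow> f z" if "z \<in> ball 0 1" for z
    using tendsto_uniform_limitI[OF lim[of "norm z"]] that by simp
  have z0: "(0 :: complex^'n) \<in> ball 0 1" by simp
  have "f 0 = 0" using ptw[OF z0] N(4) by (simp add: LIMSEQ_const_iff)
  have fdf: "fd f 0 u = u" for u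
  proof -
    have "(\<lambda>n. fd (F n) 0 u) \<longlonglongrightarrow> fd f 0 u"
      by (rule weierstrass_hol_map(2)[OF open_ball N(1) local_uniform_limit_ball[OF lim] z0])
    then show ?thesis using N(5) by (simp add: LIMSEQ_const_iff)
  qed
  have Finj: "u = 0" if "z \<in> ball 0 1" "fd (F n) z u = 0" for n z u
  proof -
    have "linear (fd (inv_into (ball 0 1) (F n)) (F n z))"
      using hol_map_on_fd(1)[OF N(2)] that(1) has_derivative_linear by blast
    then show ?thesis
      using fd_inverse(1)[OF N(1)[of n] N(2)[of n] N(7) that(1), of u] that(2) by (simp add: linear_0)
  qed
  have finj': "u = 0" if "z \<in> ball 0 1" "fd f z u = 0" for z u
    by (rule locally_uniform_limit_jacobian[OF N(1) fhol lim Finj fdf]) (use that in auto)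
  have finj: "inj_on f (ball 0 1)"
    by (rule locally_uniform_limit_injective[OF N(1,3) fhol lim finj'])
  have "f \<in> normalized_univalent"
    by (intro normalized_univalentI fhol fext \<open>f 0 = 0\<close> fdf biholomorphism_if_injective finj) (rule finj')
  moreover have "eflow A (- t) (f z) \<in> f ` ball 0 1" if t: "t \<ge> 0" and z: "z \<in> ball 0 1" for t z
  proof -
    let ?e = "eflow A (- t)"
    have lin: "complex_linear ?e" by (rule eflow_linear[OF A])
    have e0: "?e 0 = 0" using eflow_smult[OF A, of "- t" 0 0] by simp
    define V where "V n z = inv_into (ball 0 1) (F n) (?e (F n z))" for n z
    have eF: "?e (F n z) \<in> F n ` ball 0 1" if "z \<in> ball 0 1" for n z
      using Fs[OF t, of n] that by blast
    have Vb: "V n z \<in> ball 0 1" and FV: "F n (V n z) = ?e (F n z)" if "z \<in> ball 0 1" for n z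
      unfolding V_def using inv_into_into[OF eF[OF that]] f_inv_into_f[OF eF[OF that]] by auto
    have "norm (V n z) \<le> norm z" for n
    proof (rule schwarz_map)
      have "holomorphic_map_on (\<lambda>z. ?e (F n z)) (ball 0 1)"
        by (rule hol_map_on_compose(1)[OF hol_map_on_linear[OF lin open_UNIV] N(1)]) auto
      then show "holomorphic_map_on (V n) (ball 0 1)"
        unfolding V_def by (intro hol_map_on_compose(1)[OF N(2)]) (use eF in auto)
      show "V n ` ball 0 1 \<subseteq> ball 0 1" using Vb by blast
      show "V n 0 = 0" using N(7)[OF z0, of n] by (simp add: V_def N(4) e0)
      show "norm z < 1" using z by simp
    qed
    then have "\<forall>n. V n z \<in> cball 0 (norm z)" by simp
    obtain y \<sigma> where y: "y \<in> cball 0 (norm z)" "strict_mono \<sigma>" "((\<lambda>n. V n z) \<circ> \<sigma>) \<longlonglongrightarrow> y"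
      by (rule seq_compactE[OF compact_imp_seq_compact[OF compact_cball] \<open>\<forall>n. V n z \<in> cball 0 (norm z)\<close>])
    have z1: "norm z < 1" using z by simp
    have yb: "y \<in> ball 0 1" using y(1) z1 by simp
    have "(\<lambda>n. f (V (\<sigma> n) z)) \<longlonglongrightarrow> f y"
      using continuous_on_tendsto_compose[OF hol_map_on_continuous[OF fhol] y(3) yb] Vb[OF z] by (simp add: o_def)
    \<comment> \<open>The argument moves with \<open>n\<close>, so pointwise convergence is not
      enough; uniformity on \<open>cball 0 (norm z)\<close> is used.\<close>
    moreover have "(\<lambda>n. F (\<sigma> n) (V (\<sigma> n) z) - f (V (\<sigma> n) z)) \<longlonglongrightarrow> 0"
    proof (rule LIMSEQ_I)
      fix e :: real assume e: "e > 0"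
      obtain M where M: "\<And>n x. n \<ge> M \<Longrightarrow> x \<in> cball 0 (norm z) \<Longrightarrow> dist (F n x) (f x) < e"
        using uniform_limitD[OF lim[OF z1] e] unfolding eventually_sequentially by blast
      have "norm (F (\<sigma> n) (V (\<sigma> n) z) - f (V (\<sigma> n) z) - 0) < e" if "n \<ge> M" for n
        using M[of "\<sigma> n" "V (\<sigma> n) z"] \<open>\<forall>n. V n z \<in> cball 0 (norm z)\<close> seq_suble[OF y(2), of n] that
        by (simp add: dist_norm)
      then show "\<exists>no. \<forall>n\<ge>no. norm (F (\<sigma> n) (V (\<sigma> n) z) - f (V (\<sigma> n) z) - 0) < e" by blast
    qed
    ultimately have "(\<lambda>n. F (\<sigma> n) (V (\<sigma> n) z)) \<longlonglongrightarrow> f y"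
      using tendsto_add by fastforce
    then have "(\<lambda>n. ?e (F (\<sigma> n) z)) \<longlonglongrightarrow> f y" by (simp add: FV[OF z])
    moreover have "(\<lambda>n. ?e (F (\<sigma> n) z)) \<longlonglongrightarrow> ?e (f z)"
      by (rule bounded_linear.tendsto[OF complex_linear_bounded_linear[OF lin]])
         (use LIMSEQ_subseq_LIMSEQ[OF ptw[OF z] y(2)] in \<open>simp add: o_def\<close>)
    ultimately have "?e (f z) = f y" using LIMSEQ_unique by blast
    then show ?thesis using yb by blast
  qed
  ultimately show ?thesis by (auto simp: spirallike_maps_iff)
qed

text \<open>Uniform closeness on \<open>K\<close> is not given as an open condition. It is obtained
  by applying \<open>limitin_hol_topology\<close> to the identity along the filter of neighbourhoods
  of \<open>f\<close> restricted to \<open>S\<close>.\<close>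

lemma closure_of_hol_topologyD:
  assumes f: "f \<in> hol_topology closure_of S" and S: "S \<subseteq> hol_maps" and K: "compact K" "K \<subseteq> unit_ball" and e: "e > 0"
  obtains g where "g \<in> S" "\<And>z. z \<in> K \<Longrightarrow> dist (g z) (f z) < e"
proof -
  have fh: "f \<in> hol_maps" using f in_closure_of topspace_hol_topology by metis
  define G where "G = inf (nhdsin hol_topology f) (principal S)"
  have ev: "eventually P G \<longleftrightarrow> (\<exists>U. openin hol_topology U \<and> f \<in> U \<and> (\<forall>g\<in>U. g \<in> S \<longrightarrow> P g))" for P
    unfolding G_def eventually_inf_principal eventually_nhdsin
    using fh by (simp add: topspace_hol_topology)
  have "limitin hol_topology (\<lambda>g. g) f G"
    unfolding limitin_def ev using fh by (auto simp: topspace_hol_topology)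
  moreover have "\<forall>\<^sub>F g in G. g \<in> hol_maps"
    unfolding ev using fh S openin_topspace[of hol_topology] by (auto simp: topspace_hol_topology)
  ultimately have "uniform_limit K (\<lambda>g. g) f G"
    using limitin_hol_topology[where h = "\<lambda>g. g" and F = G, OF _ fh] K by blast
  then have "\<forall>\<^sub>F g in G. \<forall>z\<in>K. dist (g z) (f z) < e" using e by (rule uniform_limitD)
  then obtain U where U: "openin hol_topology U" "f \<in> U" "\<forall>g\<in>U. g \<in> S \<longrightarrow> (\<forall>z\<in>K. dist (g z) (f z) < e)"
    unfolding ev by blast
  then obtain g where "g \<in> S" "g \<in> U" using f unfolding in_closure_of by blast
  then show ?thesis using U(3) that by blast
qed

lemma closure_of_hol_topologyI:
  assumes f: "f \<in> hol_maps" and S: "S \<subseteq> hol_maps"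
    and approx: "\<And>K e. compact K \<Longrightarrow> K \<subseteq> unit_ball \<Longrightarrow> e > 0 \<Longrightarrow> \<exists>g\<in>S. \<forall>z\<in>K. dist (g z) (f z) < e"
  shows "f \<in> hol_topology closure_of S"
  unfolding in_closure_of
proof (intro conjI allI impI)
  show "f \<in> topspace hol_topology" using f by (simp add: topspace_hol_topology)
  fix U assume U: "f \<in> U \<and> openin hol_topology U"
  then have "\<exists>K e. compact K \<and> K \<subseteq> unit_ball \<and> e > 0 \<and> (\<forall>g\<in>hol_maps. (\<forall>z\<in>K. dist (g z) (f z) < e) \<longrightarrow> g \<in> U)"
    by (auto simp only: openin_hol_topology)
  then obtain K e where K: "compact K" "K \<subseteq> unit_ball" "e > 0"
    "\<And>g. g \<in> hol_maps \<Longrightarrow> \<forall>z\<in>K. dist (g z) (f z) < e \<Longrightarrow> g \<in> U"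
    by blast
  then show "\<exists>y. y \<in> S \<and> y \<in> U" using approx[OF K(1-3)] S by blast
qed

lemma spirallike_subset_hol_maps: "spirallike_maps A \<subseteq> hol_maps"
  by (auto simp: spirallike_maps_def normalized_univalent_def)

text \<open>Approximating on the balls of radius \<open>1 - 1 / (n + 1)\<close> with tolerance
  \<open>1 / (n + 1)\<close> replaces the topological closure by a sequence converging uniformly on
  each smaller ball.\<close>

lemma spirallike_closed:
  fixes A :: "complex^'n \<Rightarrow> complex^'n"
  assumes A: "complex_linear A" and f: "f \<in> hol_topology closure_of (spirallike_maps A \<inter> B)"
  shows "f \<in> spirallike_maps A"
proof -
  have "\<exists>g\<in>spirallike_maps A. \<forall>z\<in>cball 0 (1 - 1 / real (Suc n)). dist (g z) (f z) < 1 / real (Suc n)" for n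
  proof -
    have sub: "cball (0 :: complex^'n) (1 - 1 / real (Suc n)) \<subseteq> unit_ball"
    proof
      fix x :: "complex^'n" assume "x \<in> cball 0 (1 - 1 / real (Suc n))"
      then have "norm x \<le> 1 - 1 / real (Suc n)" by simp
      moreover have "0 < 1 / real (Suc n)" by simp
      ultimately have "norm x < 1" by linarith
      then show "x \<in> unit_ball" by (simp add: unit_ball_def)
    qed
    obtain g where "g \<in> spirallike_maps A \<inter> B"
      "\<And>z. z \<in> cball 0 (1 - 1 / real (Suc n)) \<Longrightarrow> dist (g z) (f z) < 1 / real (Suc n)"
    proof (rule closure_of_hol_topologyD[OF f])
      show "spirallike_maps A \<inter> B \<subseteq> hol_maps" using spirallike_subset_hol_maps by blast
      show "0 < 1 / real (Suc n)" by simp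
    qed (rule compact_cball, rule sub, blast)
    then show ?thesis by blast
  qed
  then obtain F where F: "\<And>n. F n \<in> spirallike_maps A"
    "\<And>n z. z \<in> cball 0 (1 - 1 / real (Suc n)) \<Longrightarrow> dist (F n z) (f z) < 1 / real (Suc n)"
    by metis
  have lim: "uniform_limit (cball 0 r) F f sequentially" if r: "r < 1" for r
  proof (rule uniform_limitI)
    fix e :: real assume e: "e > 0"
    have "(\<lambda>n. 1 / real (Suc n)) \<longlonglongrightarrow> 0" by (intro LIMSEQ_Suc lim_const_over_n)
    moreover have "min e (1 - r) > 0" using e r by simp
    ultimately have "\<forall>\<^sub>F n in sequentially. 1 / real (Suc n) < min e (1 - r)" by (rule order_tendstoD(2))
    then show "\<forall>\<^sub>F n in sequentially. \<forall>x\<in>cball 0 r. dist (F n x) (f x) < e"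
    proof (rule eventually_mono, intro ballI)
      fix n and x :: "complex^'n" assume n: "1 / real (Suc n) < min e (1 - r)" and x: "x \<in> cball 0 r"
      have "x \<in> cball 0 (1 - 1 / real (Suc n))" using n x by (simp del: of_nat_Suc)
      from F(2)[OF this] show "dist (F n x) (f x) < e" using n by linarith
    qed
  qed
  have "f \<in> hol_maps" using f in_closure_of topspace_hol_topology by metis
  then show ?thesis by (rule spirallike_limit[of A F f, OF A F(1) _ lim])
qed

text \<open>An automorphism \<open>\<Psi>\<close> whose generator is positive on the ball of radius
  \<open>\<rho>\<close> maps that ball onto a spirallike domain. The dilation
  \<open>\<Psi> (\<rho> z) / \<rho>\<close> transports this to the unit ball, keeps the
  normalisation and commutes with the linear flow.\<close>

lemma spirallike_approx:
  fixes A :: "complex^'n \<Rightarrow> complex^'n"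
  assumes card: "CARD('n) \<ge> 2" and A: "complex_linear A" "m_op A > 0" and f: "f \<in> spirallike_maps A"
    and K: "compact K" "K \<subseteq> unit_ball" and e: "e > 0"
  shows "\<exists>g\<in>spirallike_maps A \<inter> Aut_restrictions. \<forall>z\<in>K. dist (g z) (f z) < e"
proof -
  interpret spirallike_map A f "inv_into (ball 0 1) f" "m_op A"
    by (rule spirallike_map_locale[OF A f])
  obtain r where r: "0 < r" "r < 1" "K \<subseteq> cball 0 r"
    using compact_subset_smaller_cball[of K] K by (metis unit_ball_def)
  define r' where "r' = (1 + r) / 2"
  have r': "r < r'" "r' < 1" using r by (auto simp: r'_def)
  have sub: "cball 0 r' \<subseteq> ball (0 :: complex^'n) 1" using r' by auto
  obtain M where M: "M > 0" "\<And>z. norm z \<le> r' \<Longrightarrow> norm (f z) \<le> M"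
    using hol_map_on_bounded_cball[OF spirallike_map.f[OF spirallike_map_axioms] sub] by metis
  define L where "L = M / (r' - r)"
  have L: "L > 0" using M r' by (simp add: L_def)
  have lip: "norm (f x - f y) \<le> L * norm (x - y)" if "norm x \<le> r" "norm y \<le> r" for x y
    unfolding L_def
    by (rule lipschitz_on_smaller_ball[OF spirallike_map.f[OF spirallike_map_axioms] sub _ r'(1)]) (use M(2) that in auto)
  \<comment> \<open>\<open>\<theta> = 1 - \<rho>\<close> is the defect of the dilation:
    \<open>\<theta> * L\<close> and \<open>\<theta> * M\<close> bound its effect in the source and
    in the target. Each of three errors is at most \<open>e / 8\<close>, and with
    \<open>1 / \<rho> \<le> 2\<close> the sum stays below \<open>e\<close>. It is fixed first,
    because the closeness required of \<open>\<Psi>\<close> depends on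
    \<open>\<rho>\<close>.\<close>
  define \<theta> where "\<theta> = min (1 / 2) (e / (8 * (L + M)))"
  have LM: "L + M > 0" using L M by simp
  have \<theta>: "0 < \<theta>" "\<theta> \<le> 1 / 2" "\<theta> \<le> e / (8 * (L + M))"
    unfolding \<theta>_def by (use e LM in simp, rule min.cobounded1, rule min.cobounded2)
  have \<theta>e: "\<theta> * (L + M) \<le> e / 8"
  proof -
    have "\<theta> * (L + M) \<le> e / (8 * (L + M)) * (L + M)" using \<theta>(3) LM by (intro mult_right_mono) auto
    moreover have "e / (8 * x) * x = e / 8" if "x > 0" for x using that by simp
    ultimately show ?thesis using LM by metis
  qed
  define \<rho> where "\<rho> = 1 - \<theta>"
  have \<rho>: "0 < \<rho>" "\<rho> < 1" "1 / 2 \<le> \<rho>" using \<theta> by (auto simp: \<rho>_def)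
  obtain \<epsilon>0 where \<epsilon>0: "\<epsilon>0 > 0" "\<And>\<Psi> \<Psi>' y. \<Psi> \<in> Aut_space \<Longrightarrow> holomorphic_map_on \<Psi>' UNIV \<Longrightarrow> (\<And>z. \<Psi>' (\<Psi> z) = z) \<Longrightarrow> \<Psi> 0 = 0
     \<Longrightarrow> (\<And>z. norm z \<le> (1 + \<rho>) / 2 \<Longrightarrow> norm (\<Psi> z - f z) \<le> \<epsilon>0) \<Longrightarrow> norm y \<le> \<rho>
     \<Longrightarrow> 0 \<le> fd \<Psi>' (\<Psi> y) (A (\<Psi> y)) \<bullet> y"
    using generator_positive_of_close[OF \<rho>(1,2)] by blast
  define \<epsilon> where "\<epsilon> = min \<epsilon>0 (e / 8)"
  have \<epsilon>: "\<epsilon> > 0" "\<epsilon> \<le> \<epsilon>0" "\<epsilon> \<le> e / 8" using \<epsilon>0(1) e by (auto simp: \<epsilon>_def)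
  have \<rho>2: "0 < (1 + \<rho>) / 2" "(1 + \<rho>) / 2 < 1" using \<rho> by auto
  obtain \<Psi> where \<Psi>: "\<Psi> \<in> Aut_space" "\<Psi> 0 = 0" "\<And>u. fd \<Psi> 0 u = u" "\<And>z. norm z \<le> (1 + \<rho>) / 2 \<Longrightarrow> norm (\<Psi> z - f z) \<le> \<epsilon>"
    using f_approx_normalized_Aut[OF card \<rho>2 \<epsilon>(1)] by blast
  obtain \<Psi>' where \<Psi>': "holomorphic_map_on \<Psi> UNIV" "holomorphic_map_on \<Psi>' UNIV" "\<And>z. \<Psi>' (\<Psi> z) = z" "\<And>z. \<Psi> (\<Psi>' z) = z"
    using Aut_spaceE[OF \<Psi>(1)] by metis
  have pos: "0 \<le> fd \<Psi>' (\<Psi> y) (A (\<Psi> y)) \<bullet> y" if "norm y \<le> \<rho>" for y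
  proof (rule \<epsilon>0(2)[OF \<Psi>(1) \<Psi>'(2,3) \<Psi>(2) _ that])
    show "norm (\<Psi> z - f z) \<le> \<epsilon>0" if "norm z \<le> (1 + \<rho>) / 2" for z
      using \<Psi>(4)[OF that] \<epsilon>(2) by linarith
  qed
  let ?c = "complex_of_real \<rho>" and ?d = "complex_of_real (1 / \<rho>)"
  have cd: "?c \<noteq> 0" "?d \<noteq> 0" "?d * ?c = 1" "?c * ?d = 1" using \<rho> by auto
  define \<Phi> where "\<Phi> z = ?d *s \<Psi> (?c *s z)" for z
  have \<Phi>A: "\<Phi> \<in> Aut_space"
    unfolding \<Phi>_def
    using Aut_space_compose[OF smult_Aut[OF cd(2)] Aut_space_compose[OF \<Psi>(1) smult_Aut[OF cd(1)]]] by simp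
  obtain \<Phi>' where \<Phi>': "holomorphic_map_on \<Phi> UNIV" "holomorphic_map_on \<Phi>' UNIV" "\<And>z. \<Phi>' (\<Phi> z) = z" "\<And>z. \<Phi> (\<Phi>' z) = z"
    using Aut_spaceE[OF \<Phi>A] by metis
  define G where "G = restrict \<Phi> unit_ball"
  have G\<Phi>: "G z = \<Phi> z" if "z \<in> ball 0 1" for z using that by (simp add: G_def unit_ball_def)
  have Gim: "G ` ball 0 1 = \<Phi> ` ball 0 1" using G\<Phi> by (intro image_cong) auto
  have Ghol: "holomorphic_map_on G (ball 0 1)"
    by (rule hol_map_on_cong[OF hol_map_on_subset[OF \<Phi>'(1)]]) (use G\<Phi> in auto)
  have im_open: "open (\<Phi> ` ball 0 1)"
  proof -
    have "\<Phi> ` ball 0 1 = \<Phi>' -` ball 0 1"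
    proof (intro equalityI subsetI)
      fix x assume "x \<in> \<Phi>' -` ball 0 1"
      then have "\<Phi> (\<Phi>' x) \<in> \<Phi> ` ball 0 1" by (intro imageI) simp
      then show "x \<in> \<Phi> ` ball 0 1" by (simp only: \<Phi>'(4))
    qed (auto simp: \<Phi>'(3))
    moreover have "open (\<Phi>' -` ball 0 1)"
      using hol_map_on_continuous[OF \<Phi>'(2)] by (intro open_vimage) auto
    ultimately show ?thesis by simp
  qed
  have "biholomorphism G (ball 0 1) (G ` ball 0 1)"
  proof (rule biholomorphismI[OF Ghol])
    show "holomorphic_map_on \<Phi>' (G ` ball 0 1)"
      unfolding Gim by (rule hol_map_on_subset[OF \<Phi>'(2)]) (use im_open in auto)
    show "z \<in> ball 0 1 \<Longrightarrow> \<Phi>' (G z) = z" for z by (simp add: G\<Phi> \<Phi>'(3))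
  qed
  moreover have "fd G 0 u = u" for u
  proof -
    have z0: "(0 :: complex^'n) \<in> ball 0 1" by simp
    have "(\<Psi> has_derivative (\<lambda>u. u)) (at (?c *s 0))"
      using hol_map_on_fd(1)[OF \<Psi>'(1), of 0] \<Psi>(3) by (simp add: ext[of "fd \<Psi> 0" "\<lambda>u. u"])
    from diff_chain_at[OF bounded_linear_imp_has_derivative[OF bounded_linear_smult_right] this]
    have "((\<lambda>z. \<Psi> (?c *s z)) has_derivative (\<lambda>u. ?c *s u)) (at 0)" by (simp add: o_def)
    from bounded_linear.has_derivative[OF bounded_linear_smult_right[of ?d] this]
    have "(\<Phi> has_derivative (\<lambda>u. u)) (at 0)"
      by (simp only: \<Phi>_def[abs_def] vector_smult_assoc cd(3)) simp
    then have "(G has_derivative (\<lambda>u. u)) (at 0)"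
      by (rule has_derivative_transform_within_open[OF _ open_ball z0]) (simp add: G\<Phi>)
    then show ?thesis using fd_eqI by metis
  qed
  moreover have "G 0 = 0" using G\<Phi>[of 0] by (simp add: \<Phi>_def \<Psi>(2))
  moreover have "G \<in> extensional unit_ball" by (simp add: G_def)
  ultimately have Gn: "G \<in> normalized_univalent" using Ghol by (intro normalized_univalentI)
  have "eflow A (- t) (G z) \<in> G ` ball 0 1" if t: "t \<ge> 0" and z: "z \<in> ball 0 1" for t z
  proof -
    have "\<rho> * norm z < \<rho>" using z \<rho> by simp
    then have "norm (?c *s z) < \<rho>" using \<rho> by simp
    from Aut_image_spiral[OF A(1) \<Psi>' pos t this]
    obtain x where x: "norm x < \<rho>" "eflow A (- t) (\<Psi> (?c *s z)) = \<Psi> x" by auto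
    have "norm (?d *s x) < 1" using x(1) \<rho> by (simp add: norm_divide)
    then have xb: "?d *s x \<in> ball 0 1" by simp
    have "eflow A (- t) (G z) = ?d *s eflow A (- t) (\<Psi> (?c *s z))"
      unfolding G\<Phi>[OF z] \<Phi>_def by (rule eflow_smult[OF A(1)])
    also have "\<dots> = \<Phi> (?d *s x)"
      unfolding x(2) \<Phi>_def vector_smult_assoc cd(4) by simp
    also have "\<dots> = G (?d *s x)" using G\<Phi>[OF xb] by simp
    finally show ?thesis using xb by blast
  qed
  then have "G \<in> spirallike_maps A" using Gn by (auto simp: spirallike_maps_iff)
  moreover have "G \<in> Aut_restrictions" using \<Phi>A by (simp add: G_def Aut_restrictions_def)
  moreover have "dist (G z) (f z) < e" if "z \<in> K" for z
  proof -
    have z: "norm z \<le> r" using r(3) that by auto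
    have zb: "z \<in> ball 0 1" using z r by simp
    let ?y = "?c *s z"
    have y: "norm ?y \<le> r"
      using mult_left_le_one_le[of "norm z" \<rho>] z \<rho> by simp
    have y2: "norm ?y \<le> (1 + \<rho>) / 2"
    proof -
      have "norm ?y = \<rho> * norm z" using \<rho> by simp
      also have "\<dots> \<le> \<rho> * 1" using z r \<rho> by (intro mult_left_mono) auto
      also have "\<dots> \<le> (1 + \<rho>) / 2" using \<rho> by simp
      finally show ?thesis .
    qed
    \<comment> \<open>The three errors: replacing \<open>\<Psi>\<close> by \<open>f\<close> at the
      dilated point, moving that point back to \<open>z\<close>, and the missing factor
      \<open>\<rho>\<close> in the target.\<close>
    have "G z - f z = ?d *s ((\<Psi> ?y - f ?y) + (f ?y - f z) + (1 - ?c) *s f z)"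
    proof -
      have "(\<Psi> ?y - f ?y) + (f ?y - f z) + (1 - ?c) *s f z = \<Psi> ?y - ?c *s f z"
        by (simp add: vector_sub_rdistrib)
      then show ?thesis
        by (simp only: G\<Phi>[OF zb] \<Phi>_def vector_ssub_ldistrib vector_smult_assoc cd(3)) simp
    qed
    then have "dist (G z) (f z) = (1 / \<rho>) * norm ((\<Psi> ?y - f ?y) + (f ?y - f z) + (1 - ?c) *s f z)"
      unfolding dist_norm using \<rho> by (simp only: norm_smult norm_of_real) simp
    also have "\<dots> \<le> 2 * (e / 8 + e / 8 + e / 8)"
    proof (intro mult_mono norm_triangle_le add_mono)
      show "1 / \<rho> \<le> 2" using \<rho> by (simp add: field_simps)
      show "norm (\<Psi> ?y - f ?y) \<le> e / 8" using \<Psi>(4)[OF y2] \<epsilon>(3) by linarith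
      have yz: "norm (?y - z) \<le> \<theta>"
      proof -
        have "?y - z = (?c - 1) *s z" by (simp add: vector_sub_rdistrib)
        then have "norm (?y - z) = \<theta> * norm z"
          using \<theta> by (simp only: norm_smult) (simp add: \<rho>_def)
        also have "\<dots> \<le> \<theta>" using z r \<theta> by (intro mult_left_le) auto
        finally show ?thesis .
      qed
      have "norm (f ?y - f z) \<le> L * norm (?y - z)" by (rule lip[OF y z])
      also have "\<dots> \<le> L * \<theta>" using yz L by (intro mult_left_mono) auto
      also have "\<dots> \<le> \<theta> * (L + M)" using \<theta> M by (simp add: algebra_simps)
      finally show "norm (f ?y - f z) \<le> e / 8" using \<theta>e by linarith
      have "norm ((1 - ?c) *s f z) = \<theta> * norm (f z)"
        using \<theta> by (simp only: norm_smult) (simp add: \<rho>_def)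
      also have "\<dots> \<le> \<theta> * M" using M(2)[of z] z r' \<theta> by (intro mult_left_mono) auto
      also have "\<dots> \<le> \<theta> * (L + M)" using \<theta> L by (simp add: algebra_simps)
      finally show "norm ((1 - ?c) *s f z) \<le> e / 8" using \<theta>e by linarith
    qed (use e in auto)
    finally show ?thesis using e by simp
  qed
  ultimately show ?thesis by blast
qed

lemma eflow_id: "eflow (\<lambda>z. z) s w = exp s *\<^sub>R (w :: complex^'n)"
proof -
  have lin: "complex_linear (\<lambda>z :: complex^'n. z)" by (simp add: complex_linear_iff)
  have "((\<lambda>z. z) ^^ k) w = w" for k by (induction k) auto
  then have "(\<lambda>k. (s ^ k / fact k) *\<^sub>R w) sums eflow (\<lambda>z. z) s w"
    using eflow_sums(1)[OF lin, of s w] by simp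
  moreover have "(\<lambda>k. (s ^ k / fact k) *\<^sub>R w) sums (exp s *\<^sub>R w)"
    using bounded_linear.sums[OF bounded_linear_scaleR_left exp_converges[of s], of w]
    by (simp add: divide_inverse mult.commute)
  ultimately show ?thesis by (rule sums_unique2)
qed

text \<open>The flow of minus the identity is multiplication by \<open>exp (- t)\<close>, which runs
  through all factors in \<open>(0, 1]\<close>; the remaining endpoint 0 of a segment is
  \<open>f 0\<close>.\<close>

lemma starlike_eq_spirallike_id: "starlike_maps = spirallike_maps (\<lambda>z :: complex^'n. z)"
proof -
  have *: "(\<forall>w\<in>f ` ball 0 1. closed_segment 0 w \<subseteq> f ` ball 0 1) \<longleftrightarrow>
      (\<forall>t\<ge>0. eflow (\<lambda>z. z) (- t) ` f ` ball 0 1 \<subseteq> f ` ball 0 1)"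
    if f0: "f 0 = 0" for f :: "complex^'n \<Rightarrow> complex^'n"
  proof (intro iffI ballI allI impI subsetI)
    fix t :: real and x
    assume seg: "\<forall>w\<in>f ` ball 0 1. closed_segment 0 w \<subseteq> f ` ball 0 1" and t: "t \<ge> 0"
      and x: "x \<in> eflow (\<lambda>z. z) (- t) ` f ` ball 0 1"
    then obtain w where w: "w \<in> f ` ball 0 1" "x = exp (- t) *\<^sub>R w" by (auto simp: eflow_id)
    have "x \<in> closed_segment 0 w"
      unfolding closed_segment_def w(2) using t by (auto intro!: exI[of _ "exp (- t)"])
    then show "x \<in> f ` ball 0 1" using seg w(1) by blast
  next
    fix w x
    assume sp: "\<forall>t\<ge>0. eflow (\<lambda>z. z) (- t) ` f ` ball 0 1 \<subseteq> f ` ball 0 1"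
      and w: "w \<in> f ` ball 0 1" and x: "x \<in> closed_segment 0 w"
    then obtain u where u: "0 \<le> u" "u \<le> 1" "x = u *\<^sub>R w" by (auto simp: closed_segment_def)
    show "x \<in> f ` ball 0 1"
    proof (cases "u = 0")
      case True
      have "f 0 \<in> f ` ball 0 1" by (rule imageI) simp
      then show ?thesis using True u f0 by simp
    next
      case False
      then have "- ln u \<ge> 0" "exp (- (- ln u)) = u" using u by auto
      then have "eflow (\<lambda>z. z) (- (- ln u)) w = x" using u by (simp add: eflow_id)
      then show ?thesis using sp w \<open>- ln u \<ge> 0\<close> by blast
    qed
  qed
  have "f \<in> starlike_maps \<longleftrightarrow> f \<in> spirallike_maps (\<lambda>z. z)" for f :: "complex^'n \<Rightarrow> complex^'n"
    unfolding starlike_maps_def mem_Collect_eq spirallike_maps_iff unit_ball_def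
  proof (cases "f \<in> normalized_univalent")
    case True
    have f0: "f 0 = 0" by (rule normalized_univalentD(4)[OF True])
    show "(f \<in> normalized_univalent \<and> (\<forall>w\<in>f ` ball 0 1. closed_segment 0 w \<subseteq> f ` ball 0 1)) \<longleftrightarrow>
        (f \<in> normalized_univalent \<and> (\<forall>t\<ge>0. eflow (\<lambda>z. z) (- t) ` f ` ball 0 1 \<subseteq> f ` ball 0 1))"
      by (simp only: *[of f, OF f0])
  qed simp
  then show ?thesis by blast
qed

theorem theorem1p1:
  assumes "CARD('n::finite) \<ge> 2"
  shows "(\<forall>A :: complex^'n \<Rightarrow> complex^'n. complex_linear A \<and> m_op A > 0 \<longrightarrow>
            spirallike_maps A = hol_topology closure_of (spirallike_maps A \<inter> Aut_restrictions))
       \<and> (starlike_maps :: (complex^'n \<Rightarrow> complex^'n) set)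
            = hol_topology closure_of (starlike_maps \<inter> Aut_restrictions)"
proof -
  have main: "spirallike_maps A = hol_topology closure_of (spirallike_maps A \<inter> Aut_restrictions)"
    if A: "complex_linear A" "m_op A > 0" for A :: "complex^'n \<Rightarrow> complex^'n"
  proof (intro equalityI subsetI)
    fix f assume f: "f \<in> spirallike_maps A"
    show "f \<in> hol_topology closure_of (spirallike_maps A \<inter> Aut_restrictions)"
      by (rule closure_of_hol_topologyI)
         (use f spirallike_subset_hol_maps spirallike_approx[OF assms A f] in blast)+
  next
    fix f assume "f \<in> hol_topology closure_of (spirallike_maps A \<inter> Aut_restrictions)"
    then show "f \<in> spirallike_maps A" by (rule spirallike_closed[OF A(1)])
  qed
  have id: "complex_linear (\<lambda>z :: complex^'n. z)" by (simp add: complex_linear_iff)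
  have "m_op (\<lambda>z :: complex^'n. z) > 0"
    using m_op_attained[OF id] by (auto simp: hinner_self)
  with main id show ?thesis unfolding starlike_eq_spirallike_id by blast
qed

end
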